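(* Fix $\Lambda>0$ and $k\in\{0,\dots,n-1\}$. For any $\varepsilon>0$ there exist $C=C(n,N,\Lambda,\varepsilon)>0$ and $\delta_8=\delta_8(n,N,\Lambda,\varepsilon)>0$ such that the following holds. Let $u\in\widehat H^{1/2}_\Lambda(D_{10},N)$ be a stationary $1/2$-harmonic map in $D_{10}$, $0<r\le1$ and $x\in D_1$. If $u^e$ is boundary $(0,\delta_8)$-symmetric but not boundary $(k+1,\varepsilon)$-symmetric on $B^+_{8r}(\mathbf{x})$, then for every nonnegative finite Borel measure $\mu$ on $D_r(x)$, $$\beta^k_{2,\mu}(x,r)^2\le Cr^{-k}\int_{D_r(x)}W_r(y)\,d\mu(y).$$
   Context: Standing notation: $n\ge2$; $N\subset\mathbb{R}^d$ smooth compact embedded submanifold without boundary; $\mathbb{R}^{n+1}_+=\mathbb{R}^n\times(0,\infty)$; for $x\in\mathbb{R}^n$, $\mathbf{x}=(x,0)$; $D_r(x)$ open ball of $\mathbb{R}^n$, $D_r=D_r(0)$; $B^+_r(\mathbf{x})=\{\mathbf{y}\in\mathbb{R}^{n+1}_+:|\mathbf{y}-\mathbf{x}|<r\}$. $\gamma_n=\pi^{-(n+1)/2}\Gamma(\tfrac{n+1}{2})$; $\mathcal E(u,\Omega)=\frac{\gamma_n}{4}\iint_{(\mathbb{R}^n\times\mathbb{R}^n)\setminus(\Omega^c\times\Omega^c)}\frac{|u(x)-u(y)|^2}{|x-y|^{n+1}}dxdy$; $\widehat H^{1/2}_\Lambda(\Omega,N)$: $u\in L^2_{loc}(\mathbb{R}^n,\mathbb{R}^d)$,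 $u\in N$ a.e., $\mathcal E(u,\Omega)<\Lambda$. Weakly $1/2$-harmonic: $\frac{d}{dt}|_{t=0}\mathcal E(\pi_N(u+t\varphi),\Omega)=0$ for $\varphi\in C^\infty_c(\Omega,\mathbb{R}^d)$; stationary: also $\frac{d}{dt}|_{t=0}\mathcal E(u\circ\phi_{-t},\Omega)=0$ for flows of $X\in C^1_c(\Omega,\mathbb{R}^n)$. $u^e(x,z)=\gamma_n\int\frac{z\,u(y)}{(|x-y|^2+z^2)^{(n+1)/2}}dy$. Boundary $k$-symmetric $h$: measurable $h:\overline{\mathbb{R}^{n+1}_+}\to\mathbb{R}^d$, $0$-homogeneous, invariant under translations by a $k$-dimensional subspace of $\mathbb{R}^n\times\{0\}$; $u^e$ is boundary $(k,\varepsilon)$-symmetric on $B^+_r(\mathbf{x})$ if some such $h$ has $\frac{1}{|B^+_r(\mathbf{x})|}\int_{B^+_r(\mathbf{x})}|u^e(\mathbf{y})-h(\mathbf{y}-\mathbf{x})|^2\le\varepsilon$. For $y\in\mathbb{R}^n$, $r>0$: $W_r(y)=\int_{B^+_{8r}(\mathbf{y})\setminus B^+_r(\mathbf{y})}\frac{|(\mathbf{z}-\mathbf{y})\cdot\nabla u^e(\mathbf{z})|^2}{|\mathbf{z}-\mathbf{y}|^{n+1}}d\mathbf{z}$. Jones' number: for a nonnegative Radon measure $\mu$ on $\mathbb{R}^n$, $\beta^k_{2,\mu}(x,r)^2=\inf_V\int_{D_r(x)}\frac{\mathrm{dist}(y,V)^2}{r^2}\frac{d\mu(y)}{r^k}$,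 the infimum over $k$-dimensional affine subspaces $V\subset\mathbb{R}^n$. *)

theory Defs
  imports "HOL-Analysis.Analysis" "HOL-Probability.Probability"
begin

primrec Ck_on :: "nat \<Rightarrow> 'a::euclidean_space set \<Rightarrow> ('a \<Rightarrow> 'b::euclidean_space) \<Rightarrow> bool" where
  "Ck_on 0 S f = continuous_on S f"
| "Ck_on (Suc k) S f = (f differentiable_on S \<and>
      (\<forall>v. Ck_on k S (\<lambda>x. frechet_derivative f (at x) v)))"

definition smooth_on :: "'a::euclidean_space set \<Rightarrow> ('a \<Rightarrow> 'b::euclidean_space) \<Rightarrow> bool" where
  "smooth_on S f \<longleftrightarrow> (\<forall>k. Ck_on k S f)"

definition smooth_submanifold :: "(real^'d) set \<Rightarrow> bool" where
  "smooth_submanifold N \<longleftrightarrow>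
     (\<forall>p\<in>N. \<exists>U V (\<psi>::real^'d \<Rightarrow> real^'d) g T.
        open U \<and> p \<in> U \<and> open V \<and> subspace T \<and>
        smooth_on U \<psi> \<and> smooth_on V g \<and> \<psi> ` U = V \<and>
        (\<forall>x\<in>U. g (\<psi> x) = x) \<and> (\<forall>y\<in>V. \<psi> (g y) = y) \<and>
        \<psi> ` (U \<inter> N) = V \<inter> T)"

text \<open>Nearest point projection onto N (well defined in a tubular neighbourhood).\<close>
definition nearest_proj :: "(real^'d) set \<Rightarrow> real^'d \<Rightarrow> real^'d" where
  "nearest_proj N y = (SOME p. p \<in> N \<and> (\<forall>q\<in>N. dist y p \<le> dist y q))"

definition gamma_n :: "nat \<Rightarrow> real" where
  "gamma_n n = pi powr (- (real n + 1) / 2) * Gamma ((real n + 1) / 2)"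

definition energy :: "(real^'n \<Rightarrow> real^'d) \<Rightarrow> (real^'n) set \<Rightarrow> ennreal" where
  "energy u \<Omega> = ennreal (gamma_n CARD('n) / 4) *
     (\<integral>\<^sup>+ p. indicator (- ((- \<Omega>) \<times> (- \<Omega>))) p *
        ennreal (norm (u (fst p) - u (snd p)) ^ 2 / norm (fst p - snd p) ^ (CARD('n) + 1))
      \<partial>(lborel \<Otimes>\<^sub>M lborel))"

definition H_half :: "real \<Rightarrow> (real^'n) set \<Rightarrow> (real^'d) set \<Rightarrow> (real^'n \<Rightarrow> real^'d) set" where
  "H_half \<Lambda> \<Omega> N = {u. u \<in> borel_measurable lborel \<and>
      (\<forall>K. compact K \<longrightarrow> (\<integral>\<^sup>+ x\<in>K. ennreal (norm (u x) ^ 2) \<partial>lborel) < \<infinity>) \<and>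
      (AE x in lborel. u x \<in> N) \<and> energy u \<Omega> < ennreal \<Lambda>}"

definition compact_support_in :: "(real^'n \<Rightarrow> 'b::real_normed_vector) \<Rightarrow> (real^'n) set \<Rightarrow> bool" where
  "compact_support_in f \<Omega> \<longleftrightarrow> compact (closure {x. f x \<noteq> 0}) \<and> closure {x. f x \<noteq> 0} \<subseteq> \<Omega>"

definition weakly_half_harmonic :: "(real^'d) set \<Rightarrow> (real^'n) set \<Rightarrow> (real^'n \<Rightarrow> real^'d) \<Rightarrow> bool" where
  "weakly_half_harmonic N \<Omega> u \<longleftrightarrow>
     (\<forall>\<phi>::real^'n \<Rightarrow> real^'d. smooth_on UNIV \<phi> \<and> compact_support_in \<phi> \<Omega> \<longrightarrow>
        ((\<lambda>t. enn2real (energy (\<lambda>x. nearest_proj N (u x + t *\<^sub>R \<phi> x)) \<Omega>)) has_real_derivative 0) (at 0))"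

definition stationary_half_harmonic :: "(real^'d) set \<Rightarrow> (real^'n) set \<Rightarrow> (real^'n \<Rightarrow> real^'d) \<Rightarrow> bool" where
  "stationary_half_harmonic N \<Omega> u \<longleftrightarrow> weakly_half_harmonic N \<Omega> u \<and>
     (\<forall>(X::real^'n \<Rightarrow> real^'n) (\<Phi>::real \<Rightarrow> real^'n \<Rightarrow> real^'n).
        Ck_on 1 UNIV X \<and> compact_support_in X \<Omega> \<and>
        (\<forall>x. \<Phi> 0 x = x) \<and>
        (\<forall>x t. ((\<lambda>s. \<Phi> s x) has_vector_derivative X (\<Phi> t x)) (at t)) \<longrightarrow>
        ((\<lambda>t. enn2real (energy (\<lambda>x. u (\<Phi> (- t) x)) \<Omega>)) has_real_derivative 0) (at 0))"

definition upper_half :: "((real^'n) \<times> real) set" where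
  "upper_half = {p. snd p > 0}"

definition closed_upper_half :: "((real^'n) \<times> real) set" where
  "closed_upper_half = {p. snd p \<ge> 0}"

definition half_ball :: "real^'n \<Rightarrow> real \<Rightarrow> ((real^'n) \<times> real) set" where
  "half_ball x r = ball (x, 0) r \<inter> upper_half"

definition poisson_ext :: "(real^'n \<Rightarrow> real^'d) \<Rightarrow> (real^'n) \<times> real \<Rightarrow> real^'d" where
  "poisson_ext u p = (\<integral>y. (gamma_n CARD('n) * snd p /
       (norm (fst p - y) ^ 2 + snd p ^ 2) powr ((real CARD('n) + 1) / 2)) *\<^sub>R u y \<partial>lborel)"

definition boundary_symmetric :: "nat \<Rightarrow> ((real^'n) \<times> real \<Rightarrow> real^'d) \<Rightarrow> bool" where
  "boundary_symmetric k h \<longleftrightarrow> set_borel_measurable lebesgue closed_upper_half h \<and>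
     (\<forall>p\<in>closed_upper_half. \<forall>c>0. h (c *\<^sub>R p) = h p) \<and>
     (\<exists>L::(real^'n) set. subspace L \<and> dim L = k \<and>
        (\<forall>p\<in>closed_upper_half. \<forall>v\<in>L. h (p + (v, 0)) = h p))"

definition boundary_eps_symmetric ::
    "nat \<Rightarrow> real \<Rightarrow> ((real^'n) \<times> real \<Rightarrow> real^'d) \<Rightarrow> real^'n \<Rightarrow> real \<Rightarrow> bool" where
  "boundary_eps_symmetric k \<epsilon> U x r \<longleftrightarrow>
     (\<exists>h. boundary_symmetric k h \<and>
        ennreal (1 / measure lborel (half_ball x r)) *
          (\<integral>\<^sup>+ p\<in>half_ball x r. ennreal (norm (U p - h (p - (x, 0))) ^ 2) \<partial>lborel)
        \<le> ennreal \<epsilon>)"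

definition W_density :: "(real^'n \<Rightarrow> real^'d) \<Rightarrow> real \<Rightarrow> real^'n \<Rightarrow> ennreal" where
  "W_density u r y = (\<integral>\<^sup>+ p\<in>half_ball y (8 * r) - half_ball y r.
      ennreal (norm (frechet_derivative (poisson_ext u) (at p) (p - (y, 0))) ^ 2
               / norm (p - (y, 0)) ^ (CARD('n) + 1)) \<partial>lborel)"

definition jones_beta2 :: "nat \<Rightarrow> (real^'n) measure \<Rightarrow> real^'n \<Rightarrow> real \<Rightarrow> ennreal" where
  "jones_beta2 k \<mu> x r = (INF V\<in>{V. affine V \<and> V \<noteq> {} \<and> aff_dim V = int k}.
      \<integral>\<^sup>+ y\<in>ball x r. ennreal (infdist y V ^ 2 / r ^ 2 / r ^ k) \<partial>\<mu>)"

end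

theory Submission
  imports Defs "HOL-Complex_Analysis.Great_Picard"
begin

text \<open>
  Since \<open>N\<close> is compact, \<open>u\<close> is bounded, and its Poisson extension \<open>U\<close> satisfies \<open>\<bar>U\<bar> \<le> M\<close>, \<open>\<bar>DU\<bar> \<le> M / z\<close> and a Lipschitz bound \<open>M / z\<^sup>2\<close> for \<open>DU\<close>, where \<open>z\<close> is the
  distance to the boundary. These bounds are scale invariant and give compactness: if \<open>U\<close> is almost
  \<open>0\<close>-homogeneous but not almost \<open>(k + 1)\<close>-symmetric on a half ball of radius \<open>8 r\<close>, then, at unit scale,
  the energy of \<open>U\<close> in the directions of any orthonormal \<open>(k + 1)\<close>-frame on the annulus
  \<open>2 < \<bar>p\<bar> < 7\<close> is at least some \<open>c > 0\<close>.

  Let \<open>\<lambda>\<^sub>0 \<ge> \<lambda>\<^sub>1 \<ge> \<dots>\<close> and \<open>v\<^sub>0, v\<^sub>1, \<dots>\<close> be the eigenvalues and eigenvectors of the covariance form of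
  \<open>\<mu>\<close> about its centre of mass \<open>m\<close>. The affine span of \<open>m\<close> and \<open>v\<^sub>0, \<dots>, v\<^sub>k\<^sub>-\<^sub>1\<close> shows that the Jones
  number is at most \<open>n \<lambda>\<^sub>k / r\<^sup>k\<^sup>+\<^sup>2\<close>. On the other hand
  \<open>\<lambda>\<^sub>j DU(p) v\<^sub>j = \<integral> (v\<^sub>j \<bullet> (y - m)) DU(p) (y - p) d\<mu>(y)\<close>, hence
  \<open>\<lambda>\<^sub>j \<bar>DU(p) v\<^sub>j\<bar>\<^sup>2 \<le> \<integral> \<bar>DU(p) (p - y)\<bar>\<^sup>2 d\<mu>(y)\<close>. Summing over \<open>j \<le> k\<close>, integrating over the annulus
  and exchanging the integrals bounds \<open>c \<lambda>\<^sub>k\<close> by \<open>r\<^sup>2 \<integral> W\<^sub>r d\<mu>\<close> up to a constant.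
\<close>

section \<open>Eigenvectors of the covariance form\<close>

text \<open>The frame is produced by \<open>\<mu>\<close>, while \<open>C\<close> and
  \<open>\<delta>\<close> must not depend on \<open>\<mu>\<close>. The energy bound is therefore
  proved uniformly over all orthonormal frames, and in the compactness argument the frames pass to a
  limit along with the functions. The interior estimates blow up at the flat boundary, so no
  convergence is uniform up to height zero. The limit is taken pointwise in the open half space, and
  the sup bound alone turns this into the square-integral convergence in which symmetry is measured.
  The limit is never shown to be differentiable. What survives is stated without derivatives:
  homogeneity passes through integrals, and a vanishing directional derivative becomes a quadratic
  bound on increments. This is why the regularity class records the Taylor remainder next to the
  size of the derivative. The competitors \<open>h\<close> are only Lebesgue measurable, which is
  why several integrals are moved to the completed measure.\<close>

lemma quadratic_nonneg_imp_linear_coeff_zero: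
  fixes b c :: real
  assumes "\<And>t. 0 \<le> b * t + c * t\<^sup>2"
  shows "b = 0"
proof (rule ccontr)
  assume "b \<noteq> 0"
  \<comment> \<open>At \<open>t = - s * b\<close> the expression equals
    \<open>s * b\<^sup>2 * (c * s - 1)\<close>, and this \<open>s\<close> keeps \<open>c * s\<close>
    below 1 even when \<open>c\<close> is zero.\<close>
  define s where "s = 1 / (\<bar>c\<bar> + 1)"
  have s: "s > 0" "\<bar>c\<bar> * s < 1" by (auto simp: s_def field_simps)
  have "0 \<le> b * (- s * b) + c * (- s * b)\<^sup>2" by (rule assms)
  also have "\<dots> = s * b\<^sup>2 * (c * s - 1)" by (simp add: power2_eq_square algebra_simps)
  finally have "0 \<le> s * b\<^sup>2 * (c * s - 1)" .
  moreover have "0 < s * b\<^sup>2" using s \<open>b \<noteq> 0\<close> by simp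
  ultimately have "0 \<le> c * s - 1" by (metis zero_le_mult_iff not_less)
  moreover have "c * s \<le> \<bar>c\<bar> * s" using s by (intro mult_right_mono) auto
  ultimately show False using s by linarith
qed

text \<open>Successive maximisation of the Rayleigh quotient on the orthogonal complement of the
  vectors already found. The third clause keeps this maximality: it bounds the form on the whole
  complement and, tested on later eigenvectors, orders the eigenvalues decreasingly.\<close>

lemma self_adjoint_top_eigenvectors:
  fixes Q :: "'a::euclidean_space \<Rightarrow> 'a"
  assumes lin: "linear Q" and sym: "\<And>x y. Q x \<bullet> y = x \<bullet> Q y" and "k \<le> DIM('a)"
  shows "\<exists>v::nat \<Rightarrow> 'a. \<exists>lam::nat \<Rightarrow> real.
     (\<forall>i<k. \<forall>j<k. v i \<bullet> v j = (if i = j then 1 else 0)) \<and>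
     (\<forall>i<k. Q (v i) = lam i *\<^sub>R v i) \<and>
     (\<forall>j<k. \<forall>w. (\<forall>i<j. v i \<bullet> w = 0) \<longrightarrow> w \<bullet> Q w \<le> lam j * (w \<bullet> w))"
  using \<open>k \<le> DIM('a)\<close>
proof (induction k)
  case 0
  show ?case by simp
next
  case (Suc k)
  from Suc.IH[OF Suc_leD[OF Suc.prems]]
  obtain v :: "nat \<Rightarrow> 'a" and lam :: "nat \<Rightarrow> real" where
    on: "\<And>i j. i < k \<Longrightarrow> j < k \<Longrightarrow> v i \<bullet> v j = (if i = j then 1 else 0)" and
    ev: "\<And>i. i < k \<Longrightarrow> Q (v i) = lam i *\<^sub>R v i" and
    mx: "\<And>j w. j < k \<Longrightarrow> (\<forall>i<j. v i \<bullet> w = 0) \<Longrightarrow> w \<bullet> Q w \<le> lam j * (w \<bullet> w)"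
    by metis
  define S where "S = {w. \<forall>i<k. v i \<bullet> w = 0}"
  have "dim (v ` {..<k}) \<le> card (v ` {..<k})"
    by (rule dim_le_card') auto
  also have "\<dots> \<le> k" using card_image_le[of "{..<k}" v] by simp
  also have "k < DIM('a)" using Suc.prems by simp
  finally obtain x where "x \<noteq> 0" and x: "\<And>y. y \<in> span (v ` {..<k}) \<Longrightarrow> orthogonal x y"
    using orthogonal_to_subspace_exists by blast
  have "x \<in> S"
    using x[OF span_base] by (auto simp: S_def orthogonal_def inner_commute[of _ x])
  have subS: "subspace S"
    by (auto simp: S_def subspace_def inner_add_right)
  have clS: "closed S" using subS by (rule closed_subspace)
  have "(1 / norm x) *\<^sub>R x \<in> sphere 0 1 \<inter> S"
    using \<open>x \<noteq> 0\<close> \<open>x \<in> S\<close> subS by (auto intro: subspace_scale)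
  moreover have "compact (sphere 0 1 \<inter> S)"
    using clS by (intro compact_Int_closed) auto
  moreover have "continuous_on (sphere 0 1 \<inter> S) (\<lambda>w. w \<bullet> Q w)"
    using linear_continuous_on[of Q] lin
    by (intro continuous_intros) (auto simp: linear_conv_bounded_linear)
  ultimately obtain e where e: "e \<in> sphere 0 1 \<inter> S"
    and emax: "\<And>w. w \<in> sphere 0 1 \<inter> S \<Longrightarrow> w \<bullet> Q w \<le> e \<bullet> Q e"
    using continuous_attains_sup[of "sphere 0 1 \<inter> S" "\<lambda>w. w \<bullet> Q w"] by blast
  define l where "l = e \<bullet> Q e"
  have ee: "e \<bullet> e = 1" using e by (simp add: dot_square_norm)
  have maxS: "w \<bullet> Q w \<le> l * (w \<bullet> w)" if "w \<in> S" for w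
  proof (cases "w = 0")
    case False
    have "(1 / norm w) *\<^sub>R w \<in> sphere 0 1 \<inter> S"
      using that False subS by (auto intro: subspace_scale)
    from emax[OF this] have "(w \<bullet> Q w) / (norm w)\<^sup>2 \<le> l"
      using lin by (simp add: l_def linear_scale power2_eq_square)
    then show ?thesis using False by (simp add: dot_square_norm field_simps)
  qed (use lin in \<open>simp add: linear_0\<close>)
  have crit: "l * (e \<bullet> w) = w \<bullet> Q e" if "w \<in> S" for w
  proof -
    \<comment> \<open>The defect \<open>l * (w \<bullet> w) - w \<bullet> Q w\<close> is nonnegative
      on \<open>S\<close> and vanishes at the maximiser \<open>e\<close>. Along
      \<open>e + t w\<close> it is a quadratic in \<open>t\<close> without constant term, so its
      linear coefficient must vanish.\<close>
    have "0 \<le> 2 * (l * (e \<bullet> w) - w \<bullet> Q e) * t + (l * (w \<bullet> w) - w \<bullet> Q w) * t\<^sup>2" for t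
    proof -
      have "e + t *\<^sub>R w \<in> S"
        using e that subS by (auto intro: subspace_add subspace_scale)
      from maxS[OF this]
      have "(e + t *\<^sub>R w) \<bullet> Q (e + t *\<^sub>R w) \<le> l * ((e + t *\<^sub>R w) \<bullet> (e + t *\<^sub>R w))" .
      moreover have "(e + t *\<^sub>R w) \<bullet> Q (e + t *\<^sub>R w) = l + 2 * t * (w \<bullet> Q e) + t\<^sup>2 * (w \<bullet> Q w)"
        using lin sym[of e w]
        by (simp add: linear_add linear_scale inner_add_left inner_add_right l_def
            power2_eq_square inner_commute algebra_simps)
      moreover have "(e + t *\<^sub>R w) \<bullet> (e + t *\<^sub>R w) = 1 + 2 * t * (e \<bullet> w) + t\<^sup>2 * (w \<bullet> w)"
        using ee by (simp add: inner_add_left inner_add_right power2_eq_square inner_commute algebra_simps)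
      ultimately have "l + 2 * t * (w \<bullet> Q e) + t\<^sup>2 * (w \<bullet> Q w)
          \<le> l * (1 + 2 * t * (e \<bullet> w) + t\<^sup>2 * (w \<bullet> w))"
        by (simp only:)
      then show ?thesis by (simp add: algebra_simps)
    qed
    from quadratic_nonneg_imp_linear_coeff_zero[OF this] show ?thesis by simp
  qed
  \<comment> \<open>By symmetry \<open>Q\<close> preserves \<open>S\<close>, so the residual of the
    eigenvalue equation is itself an admissible test vector, and criticality makes it orthogonal to
    itself.\<close>
  have "Q e - l *\<^sub>R e \<in> S"
  proof -
    have "v i \<bullet> Q e = 0" "v i \<bullet> e = 0" if "i < k" for i
      using ev[OF that] sym[of "v i" e] e that by (auto simp: S_def)
    then show ?thesis by (simp add: S_def inner_diff_right)
  qed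
  from crit[OF this] have "(Q e - l *\<^sub>R e) \<bullet> (Q e - l *\<^sub>R e) = 0"
    by (simp add: inner_diff_left inner_diff_right inner_commute algebra_simps)
  then have Qe: "Q e = l *\<^sub>R e" by simp
  define v' where "v' = v(k := e)"
  define lam' where "lam' = lam(k := l)"
  have vS: "\<And>i. i < k \<Longrightarrow> v i \<bullet> e = 0" using e by (auto simp: S_def)
  have "\<forall>i<Suc k. \<forall>j<Suc k. v' i \<bullet> v' j = (if i = j then 1 else 0)"
    using on vS ee by (auto simp: v'_def less_Suc_eq inner_commute)
  moreover have "\<forall>i<Suc k. Q (v' i) = lam' i *\<^sub>R v' i"
    using ev Qe by (auto simp: v'_def lam'_def less_Suc_eq)
  moreover have "\<forall>j<Suc k. \<forall>w. (\<forall>i<j. v' i \<bullet> w = 0) \<longrightarrow> w \<bullet> Q w \<le> lam' j * (w \<bullet> w)"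
  proof (intro allI impI)
    fix j w assume j: "j < Suc k" and w: "\<forall>i<j. v' i \<bullet> w = 0"
    show "w \<bullet> Q w \<le> lam' j * (w \<bullet> w)"
    proof (cases "j = k")
      case True
      then have "w \<in> S" using w by (auto simp: S_def v'_def)
      then show ?thesis using maxS True by (simp add: lam'_def)
    next
      case False
      then show ?thesis using mx[of j w] j w by (auto simp: lam'_def v'_def)
    qed
  qed
  ultimately show ?case by blast
qed

section \<open>Moments of the boundary measure and the Jones number\<close>

lemma integrable_continuous_concentrated:
  fixes f :: "real^'n \<Rightarrow> 'b::euclidean_space"
  assumes \<mu>: "sets \<mu> = sets borel" "finite_measure \<mu>" "emeasure \<mu> (- ball x r) = 0"
    and f: "continuous_on UNIV f"
  shows "integrable \<mu> f"
proof -
  interpret finite_measure \<mu> by (rule \<mu>)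
  have "bounded (f ` cball x r)"
    by (intro compact_imp_bounded compact_continuous_image continuous_on_subset[OF f]) auto
  then obtain B where B: "\<And>y. y \<in> cball x r \<Longrightarrow> norm (f y) \<le> B"
    unfolding bounded_iff by (meson imageI)
  have "AE y in \<mu>. y \<in> ball x r"
    by (rule AE_I[of _ _ "- ball x r"]) (use \<mu> in auto)
  then have "AE y in \<mu>. norm (f y) \<le> B"
    by eventually_elim (use B in auto)
  moreover have "f \<in> borel_measurable \<mu>"
    using borel_measurable_continuous_onI[OF f] measurable_cong_sets[OF \<mu>(1) refl] by blast
  ultimately show ?thesis by (rule integrable_const_bound)
qed

lemma orthonormal_family_independent:
  fixes v :: "'i \<Rightarrow> 'a::euclidean_space"
  assumes on: "\<And>i j. i \<in> I \<Longrightarrow> j \<in> I \<Longrightarrow> v i \<bullet> v j = (if i = j then 1 else 0)"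
  shows "independent (v ` I) \<and> card (v ` I) = card I"
proof
  have "inj_on v I"
    by (rule inj_onI) (metis on zero_neq_one)
  then show "card (v ` I) = card I" by (simp add: card_image)
  have "0 \<notin> v ` I" using on by (metis imageE inner_zero_left zero_neq_one)
  moreover have "pairwise orthogonal (v ` I)"
    using on by (auto simp: pairwise_def orthogonal_def)
  ultimately show "independent (v ` I)"
    using pairwise_orthogonal_independent by blast
qed

text \<open>Collects everything the measure contributes: a frame and the single number
  \<open>l\<close>, the smallest of the top \<open>k + 1\<close> eigenvalues, which serves all
  directions of the frame at once. The map \<open>T\<close> and the point \<open>p\<close> stay
  arbitrary because the inequality is applied at every point of the annulus with the derivative
  there.\<close>

lemma covariance_frame:
  fixes \<mu> :: "(real^'n) measure"
  assumes \<mu>: "sets \<mu> = sets borel" "finite_measure \<mu>" "emeasure \<mu> (- ball x r) = 0"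
    and r: "r > 0" and k: "k < CARD('n)"
  obtains v :: "nat \<Rightarrow> real^'n" and l :: real where
    "l \<ge> 0" and "\<And>i j. i \<le> k \<Longrightarrow> j \<le> k \<Longrightarrow> v i \<bullet> v j = (if i = j then 1 else 0)"
    and "jones_beta2 k \<mu> x r \<le> ennreal (real CARD('n) * l / r ^ (k + 2))"
    and "\<And>(T :: (real^'n) \<times> real \<Rightarrow> real^'d) p j. linear T \<Longrightarrow> j \<le> k \<Longrightarrow>
       ennreal (l * (norm (T (v j, 0)))\<^sup>2) \<le> (\<integral>\<^sup>+ y\<in>ball x r. ennreal ((norm (T (p - (y, 0))))\<^sup>2) \<partial>\<mu>)"
proof -
  interpret finite_measure \<mu> by (rule \<mu>)
  note int = integrable_continuous_concentrated[OF \<mu>]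
  have AEb: "AE y in \<mu>. y \<in> ball x r"
    by (rule AE_I[of _ _ "- ball x r"]) (use \<mu> in auto)
  \<comment> \<open>For the zero measure the division gives \<open>m = 0\<close>; first moments
    about \<open>m\<close> still vanish, since all integrals do.\<close>
  define m where "m = (1 / measure \<mu> (space \<mu>)) *\<^sub>R (\<integral>y. y \<partial>\<mu>)"
  define Q where "Q w = (\<integral>y. (w \<bullet> (y - m)) *\<^sub>R (y - m) \<partial>\<mu>)" for w
  have intQ: "integrable \<mu> (\<lambda>y. (w \<bullet> (y - m)) *\<^sub>R (y - m))" for w
    by (intro int continuous_intros)
  have mean0: "(\<integral>y. w \<bullet> (y - m) \<partial>\<mu>) = 0" for w
  proof (cases "measure \<mu> (space \<mu>) = 0")
    case True
    then have "emeasure \<mu> (space \<mu>) = 0" by (simp add: emeasure_eq_measure)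
    then have "AE y in \<mu>. w \<bullet> (y - m) = 0" by (intro AE_I[of _ _ "space \<mu>"]) auto
    then show ?thesis by (subst integral_cong_AE[where g = "\<lambda>_. 0"])
        (auto intro!: borel_measurable_integrable[OF int] continuous_intros)
  next
    case False
    have "(\<integral>y. w \<bullet> (y - m) \<partial>\<mu>) = w \<bullet> (\<integral>y. y - m \<partial>\<mu>)"
      by (intro integral_inner_right int continuous_intros)
    also have "(\<integral>y. y - m \<partial>\<mu>) = 0"
      using False by (subst Bochner_Integration.integral_diff)
        (auto intro!: int continuous_intros simp: m_def)
    finally show ?thesis by simp
  qed
  have innQ: "w' \<bullet> Q w = (\<integral>y. (w \<bullet> (y - m)) * (w' \<bullet> (y - m)) \<partial>\<mu>)" for w w'
    unfolding Q_def by (subst integral_inner_right[symmetric]) (use intQ in auto)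
  have linQ: "linear Q"
  proof (rule linearI)
    fix a b :: "real^'n" and c :: real
    show "Q (a + b) = Q a + Q b"
      unfolding Q_def by (subst Bochner_Integration.integral_add[symmetric])
        (use intQ in \<open>auto simp: inner_add_left scaleR_add_left\<close>)
    show "Q (c *\<^sub>R a) = c *\<^sub>R Q a"
      unfolding Q_def by (subst integral_scaleR_right[symmetric]) auto
  qed
  have symQ: "Q a \<bullet> b = a \<bullet> Q b" for a b
    using innQ[of b a] innQ[of a b] by (simp add: inner_commute mult.commute)
  have "Suc k \<le> DIM(real^'n)" using k by simp
  from self_adjoint_top_eigenvectors[OF linQ symQ this]
  obtain v :: "nat \<Rightarrow> real^'n" and lam :: "nat \<Rightarrow> real" where
    on: "\<And>i j. i \<le> k \<Longrightarrow> j \<le> k \<Longrightarrow> v i \<bullet> v j = (if i = j then 1 else 0)" and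
    ev: "\<And>i. i \<le> k \<Longrightarrow> Q (v i) = lam i *\<^sub>R v i" and
    mx: "\<And>j w. j \<le> k \<Longrightarrow> (\<forall>i<j. v i \<bullet> w = 0) \<Longrightarrow> w \<bullet> Q w \<le> lam j * (w \<bullet> w)"
    unfolding less_Suc_eq_le by metis
  have lam_eq: "lam j = (\<integral>y. (v j \<bullet> (y - m))\<^sup>2 \<partial>\<mu>)" if "j \<le> k" for j
    using innQ[of "v j" "v j"] ev[OF that] on[OF that that] by (simp add: power2_eq_square)
  have lam_nonneg: "lam k \<ge> 0" by (simp add: lam_eq)
  have lam_mono: "lam k \<le> lam j" if "j \<le> k" for j
    using mx[OF that, of "v k"] on that ev[of k] by auto

  \<comment> \<open>The orthogonal projection onto the complement of the first \<open>k\<close>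
    eigenvectors. The plane \<open>V\<close> below uses exactly these \<open>k\<close> vectors, so
    the distance to \<open>V\<close> only sees directions in which the form is at most
    \<open>lam k\<close>.\<close>
  define P where "P w = w - (\<Sum>i<k. (v i \<bullet> w) *\<^sub>R v i)" for w
  have Psym: "a \<bullet> P b = P a \<bullet> b" for a b
    by (simp add: P_def inner_diff_left inner_diff_right inner_sum_left inner_sum_right
        inner_commute mult.commute)
  have vP: "v j \<bullet> P w = 0" if "j < k" for j w
  proof -
    have "(\<Sum>i<k. (v i \<bullet> w) * (v j \<bullet> v i)) = (\<Sum>i<k. if i = j then v j \<bullet> w else 0)"
      using on that by (intro sum.cong) auto
    then show ?thesis using that by (simp add: P_def inner_diff_right inner_sum_right)
  qed
  have Pb: "P b \<bullet> P b \<le> 1" if "b \<in> Basis" for b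
  proof -
    have "P b \<bullet> P b = P b \<bullet> b - (\<Sum>i<k. (v i \<bullet> b) * (v i \<bullet> P b))"
      by (subst (2) P_def) (simp add: inner_diff_right inner_sum_right inner_commute)
    also have "\<dots> = P b \<bullet> b" using vP by simp
    also have "\<dots> = b \<bullet> b - (\<Sum>i<k. (v i \<bullet> b)\<^sup>2)"
      by (simp add: P_def inner_diff_left inner_sum_left power2_eq_square)
    also have "\<dots> \<le> 1" using that sum_nonneg[of "{..<k}" "\<lambda>i. (v i \<bullet> b)\<^sup>2"] by simp
    finally show ?thesis .
  qed
  define V where "V = (\<lambda>z. m + z) ` span (v ` {..<k})"
  have "independent (v ` {..<k}) \<and> card (v ` {..<k}) = card {..<k}"
    by (rule orthonormal_family_independent) (use on in auto)
  then have indep: "independent (v ` {..<k})" "card (v ` {..<k}) = k" by auto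
  have "dim (span (v ` {..<k})) = k"
    using dim_eq_card_independent[OF indep(1)] indep(2) by (simp add: dim_span)
  then have "aff_dim V = int k"
    by (simp add: V_def aff_dim_translation_eq aff_dim_subspace)
  moreover have "affine V" unfolding V_def
    by (simp add: affine_translation[symmetric] subspace_imp_affine)
  moreover have "V \<noteq> {}" unfolding V_def by (auto intro: span_zero)
  ultimately have "jones_beta2 k \<mu> x r \<le> (\<integral>\<^sup>+ y\<in>ball x r. ennreal (infdist y V ^ 2 / r ^ 2 / r ^ k) \<partial>\<mu>)"
    unfolding jones_beta2_def by (intro INF_lower) auto
  also have "\<dots> \<le> (\<integral>\<^sup>+ y. ennreal ((norm (P (y - m)))\<^sup>2 / r ^ (k + 2)) \<partial>\<mu>)"
  proof (rule nn_integral_mono)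
    fix y
    have "m + (\<Sum>i<k. (v i \<bullet> (y - m)) *\<^sub>R v i) \<in> V"
      unfolding V_def by (intro imageI span_sum span_scale span_base) auto
    then have "infdist y V \<le> dist y (m + (\<Sum>i<k. (v i \<bullet> (y - m)) *\<^sub>R v i))"
      by (rule infdist_le)
    also have "\<dots> = norm (P (y - m))" by (simp add: dist_norm P_def algebra_simps)
    finally have "infdist y V ^ 2 / r ^ 2 / r ^ k \<le> (norm (P (y - m)))\<^sup>2 / r ^ 2 / r ^ k"
      using r by (intro divide_right_mono power_mono infdist_nonneg) auto
    also have "\<dots> = (norm (P (y - m)))\<^sup>2 / r ^ (k + 2)" by (simp add: power_add power2_eq_square)
    finally show "ennreal (infdist y V ^ 2 / r ^ 2 / r ^ k) * indicator (ball x r) y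
        \<le> ennreal ((norm (P (y - m)))\<^sup>2 / r ^ (k + 2))"
      by (auto simp: indicator_def intro: ennreal_leI)
  qed
  also have "\<dots> = ennreal (\<integral>y. (norm (P (y - m)))\<^sup>2 / r ^ (k + 2) \<partial>\<mu>)"
    using r unfolding P_def
    by (intro nn_integral_eq_integral int continuous_intros) auto
  also have "(\<integral>y. (norm (P (y - m)))\<^sup>2 / r ^ (k + 2) \<partial>\<mu>)
      = (\<integral>y. (norm (P (y - m)))\<^sup>2 \<partial>\<mu>) / r ^ (k + 2)" by simp
  \<comment> \<open>Parseval in the standard basis, with \<open>P\<close> moved onto the basis
    vectors. The resulting sum is the trace of \<open>P Q P\<close>; its \<open>CARD('n)\<close>
    terms are at most \<open>lam k\<close> each, which is where the dimension enters the
    bound.\<close>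
  also have "(\<integral>y. (norm (P (y - m)))\<^sup>2 \<partial>\<mu>) = (\<integral>y. (\<Sum>b\<in>Basis. (P b \<bullet> (y - m))\<^sup>2) \<partial>\<mu>)"
  proof (rule Bochner_Integration.integral_cong[OF refl])
    fix y
    have "(norm (P (y - m)))\<^sup>2 = (\<Sum>b\<in>Basis. (P (y - m) \<bullet> b)\<^sup>2)"
      unfolding power2_norm_eq_inner by (subst euclidean_inner) (simp add: power2_eq_square)
    also have "\<dots> = (\<Sum>b\<in>Basis. (P b \<bullet> (y - m))\<^sup>2)"
      by (simp only: Psym[of "y - m", symmetric] inner_commute[of "y - m"])
    finally show "(norm (P (y - m)))\<^sup>2 = (\<Sum>b\<in>Basis. (P b \<bullet> (y - m))\<^sup>2)" .
  qed
  also have "\<dots> = (\<Sum>b\<in>Basis. P b \<bullet> Q (P b))"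
    by (subst Bochner_Integration.integral_sum)
      (auto intro!: int continuous_intros simp: innQ power2_eq_square)
  also have "ennreal (\<dots> / r ^ (k + 2)) \<le> ennreal (real CARD('n) * lam k / r ^ (k + 2))"
  proof (intro ennreal_leI divide_right_mono)
    have "(\<Sum>b\<in>Basis. P b \<bullet> Q (P b)) \<le> (\<Sum>b\<in>(Basis::(real^'n) set). lam k)"
    proof (intro sum_mono)
      fix b :: "real^'n" assume "b \<in> Basis"
      then have "lam k * (P b \<bullet> P b) \<le> lam k"
        using Pb[of b] lam_nonneg by (metis mult.right_neutral mult_left_mono)
      then show "P b \<bullet> Q (P b) \<le> lam k" using mx[of k "P b"] vP by fastforce
    qed
    then show "(\<Sum>b\<in>Basis. P b \<bullet> Q (P b)) \<le> real CARD('n) * lam k" by simp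
  qed (use r in auto)
  finally have beta: "jones_beta2 k \<mu> x r \<le> ennreal (real CARD('n) * lam k / r ^ (k + 2))" .

  have main: "ennreal (lam k * (norm (T (v j, 0)))\<^sup>2) \<le> (\<integral>\<^sup>+ y\<in>ball x r. ennreal ((norm (T (p - (y, 0))))\<^sup>2) \<partial>\<mu>)"
    if T: "linear T" and j: "j \<le> k" for T :: "(real^'n) \<times> real \<Rightarrow> real^'d" and p j
  proof -
    have blT: "bounded_linear T" using T by (simp add: linear_conv_bounded_linear)
    note [continuous_intros] = bounded_linear.continuous_on[OF blT]
    define a where "a = T (v j, 0)"
    let ?s = "\<lambda>y. v j \<bullet> (y - m)"
    have bl: "bounded_linear (\<lambda>z::real^'n. a \<bullet> T (z, 0))"
      by (intro bounded_linear_compose[OF bounded_linear_inner_right]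
          bounded_linear_compose[OF blT] bounded_linear_Pair bounded_linear_ident bounded_linear_zero)
    have "lam j * (norm a)\<^sup>2 = a \<bullet> T (lam j *\<^sub>R v j, 0)"
      using T linear_scale[OF T, of "lam j" "(v j, 0)"] by (simp add: a_def dot_square_norm)
    also have "\<dots> = (\<integral>y. a \<bullet> T (?s y *\<^sub>R (y - m), 0) \<partial>\<mu>)"
      using integral_bounded_linear[OF bl intQ[of "v j"]] ev[OF j] by (simp add: Q_def)
    \<comment> \<open>Writing \<open>y - m\<close> as \<open>(y - p) + (p - m)\<close> exchanges the
      centre of mass for \<open>p\<close>: the second part is constant in \<open>y\<close> and is
      integrated against the mean-zero weight \<open>?s\<close>.\<close>
    also have "\<dots> = (\<integral>y. ?s y * (a \<bullet> T ((y, 0) - p)) + ?s y * (a \<bullet> T (p - (m, 0))) \<partial>\<mu>)"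
    proof (rule Bochner_Integration.integral_cong[OF refl])
      fix y :: "real^'n"
      have "T (?s y *\<^sub>R (y - m), 0) = ?s y *\<^sub>R T (((y, 0) - p) + (p - (m, 0)))"
        using linear_scale[OF T, of "?s y" "(y - m, 0)"] by simp
      then show "a \<bullet> T (?s y *\<^sub>R (y - m), 0)
          = ?s y * (a \<bullet> T ((y, 0) - p)) + ?s y * (a \<bullet> T (p - (m, 0)))"
        by (simp only: linear_add[OF T] inner_scaleR_right inner_add_right distrib_left)
    qed
    also have "\<dots> = (\<integral>y. ?s y * (a \<bullet> T ((y, 0) - p)) \<partial>\<mu>)"
      by (subst Bochner_Integration.integral_add)
        (auto intro!: int continuous_intros simp: mean0)
    \<comment> \<open>Since the integral of \<open>(?s y)\<^sup>2\<close> is \<open>lam j\<close>,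
      half of the left side reappears and is absorbed. Compared with Cauchy-Schwarz on the integral,
      this avoids dividing by \<open>lam j\<close>, which may be zero.\<close>
    also have "\<dots> \<le> (\<integral>y. ((?s y)\<^sup>2 * (norm a)\<^sup>2 + (norm (T (p - (y, 0))))\<^sup>2) / 2 \<partial>\<mu>)"
    proof (intro integral_mono int continuous_intros)
      fix y :: "real^'n"
      have "?s y * (a \<bullet> T ((y, 0) - p)) \<le> \<bar>?s y\<bar> * \<bar>a \<bullet> T ((y, 0) - p)\<bar>"
        by (metis abs_ge_self abs_mult)
      also have "\<dots> \<le> \<bar>?s y\<bar> * (norm a * norm (T ((y, 0) - p)))"
        by (intro mult_left_mono Cauchy_Schwarz_ineq2) auto
      also have "norm (T ((y, 0) - p)) = norm (T (p - (y, 0)))"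
        by (metis T linear_diff norm_minus_commute)
      also have "\<bar>?s y\<bar> * (norm a * norm (T (p - (y, 0))))
          \<le> ((\<bar>?s y\<bar> * norm a)\<^sup>2 + (norm (T (p - (y, 0))))\<^sup>2) / 2"
        using sum_squares_bound[of "\<bar>?s y\<bar> * norm a" "norm (T (p - (y, 0)))"] by simp
      finally show "?s y * (a \<bullet> T ((y, 0) - p)) \<le> ((?s y)\<^sup>2 * (norm a)\<^sup>2 + (norm (T (p - (y, 0))))\<^sup>2) / 2"
        by (simp add: power_mult_distrib)
    qed auto
    also have "\<dots> = (lam j * (norm a)\<^sup>2 + (\<integral>y. (norm (T (p - (y, 0))))\<^sup>2 \<partial>\<mu>)) / 2"
      by (simp add: lam_eq[OF j], subst Bochner_Integration.integral_add)
        (auto intro!: int continuous_intros)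
    finally have "lam j * (norm a)\<^sup>2 \<le> (\<integral>y. (norm (T (p - (y, 0))))\<^sup>2 \<partial>\<mu>)" by simp
    moreover have "lam k * (norm a)\<^sup>2 \<le> lam j * (norm a)\<^sup>2"
      using lam_mono[OF j] by (intro mult_right_mono) auto
    ultimately have "ennreal (lam k * (norm a)\<^sup>2) \<le> ennreal (\<integral>y. (norm (T (p - (y, 0))))\<^sup>2 \<partial>\<mu>)"
      by (intro ennreal_leI) linarith
    also have "\<dots> = (\<integral>\<^sup>+y. ennreal ((norm (T (p - (y, 0))))\<^sup>2) \<partial>\<mu>)"
      by (intro nn_integral_eq_integral[symmetric] int continuous_intros) auto
    also have "\<dots> = (\<integral>\<^sup>+ y\<in>ball x r. ennreal ((norm (T (p - (y, 0))))\<^sup>2) \<partial>\<mu>)"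
      using AEb by (intro nn_integral_cong_AE) (auto elim!: eventually_mono)
    finally show ?thesis by (simp add: a_def)
  qed
  show ?thesis by (rule that[OF lam_nonneg on beta main])
qed

section \<open>The Poisson kernel and its derivatives\<close>

text \<open>At \<open>a = (n + 1) / 2\<close> and \<open>q = p - (y, 0)\<close> this is the Poisson
  kernel without the factor \<open>gamma_n\<close>. The two functions after it are its first
  derivative in direction \<open>w\<close> and the derivative of that in direction
  \<open>h\<close>.\<close>

definition halfkernel :: "real \<Rightarrow> 'a::euclidean_space \<times> real \<Rightarrow> real" where
  "halfkernel a q = snd q * (q \<bullet> q) powr (- a)"

definition halfkernel1 :: "real \<Rightarrow> 'a::euclidean_space \<times> real \<Rightarrow> 'a \<times> real \<Rightarrow> real" where
  "halfkernel1 a q w = snd w * (q \<bullet> q) powr (- a) - 2 * a * snd q * (q \<bullet> w) * (q \<bullet> q) powr (- a - 1)"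

definition halfkernel2 :: "real \<Rightarrow> 'a::euclidean_space \<times> real \<Rightarrow> 'a \<times> real \<Rightarrow> 'a \<times> real \<Rightarrow> real" where
  "halfkernel2 a q w h =
     4 * a * (a + 1) * (snd q * (q \<bullet> w) * (q \<bullet> h) * (q \<bullet> q) powr (- a - 2))
     - 2 * a * ((snd w * (q \<bullet> h) + snd h * (q \<bullet> w) + snd q * (h \<bullet> w)) * (q \<bullet> q) powr (- a - 1))"

lemma inner_self_powr_has_derivative:
  fixes q :: "'b::real_inner"
  assumes "q \<noteq> 0"
  shows "((\<lambda>q. (q \<bullet> q) powr s) has_derivative (\<lambda>h. 2 * s * (q \<bullet> h) * (q \<bullet> q) powr (s - 1))) (at q)"
proof -
  have pos: "q \<bullet> q > 0" using assms by simp
  have "((\<lambda>q. (q \<bullet> q) powr s) has_derivative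
      (\<lambda>h. (q \<bullet> q) powr s * (0 * ln (q \<bullet> q) + (q \<bullet> h + h \<bullet> q) * s / (q \<bullet> q)))) (at q)"
    by (rule has_derivative_powr) (use pos in \<open>auto intro!: derivative_eq_intros\<close>)
  moreover have "(q \<bullet> q) powr (s - 1) = (q \<bullet> q) powr s / (q \<bullet> q)"
    using pos by (simp add: powr_diff)
  ultimately show ?thesis
    by (simp add: inner_commute field_simps)
qed

lemma halfkernel_has_derivative:
  fixes q :: "'a::euclidean_space \<times> real"
  assumes "q \<noteq> 0"
  shows "(halfkernel a has_derivative halfkernel1 a q) (at q)"
proof -
  have "((\<lambda>q. snd q * (q \<bullet> q) powr (- a)) has_derivative
     (\<lambda>h. snd q * (2 * (- a) * (q \<bullet> h) * (q \<bullet> q) powr (- a - 1)) + snd h * (q \<bullet> q) powr (- a))) (at q)"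
    by (intro has_derivative_mult has_derivative_snd has_derivative_ident
        inner_self_powr_has_derivative assms)
  moreover have "(\<lambda>h. snd q * (2 * (- a) * (q \<bullet> h) * (q \<bullet> q) powr (- a - 1)) + snd h * (q \<bullet> q) powr (- a))
     = halfkernel1 a q"
    by (rule ext) (simp add: halfkernel1_def algebra_simps)
  moreover have "(\<lambda>q. snd q * (q \<bullet> q) powr (- a)) = (halfkernel a :: 'a \<times> real \<Rightarrow> real)"
    by (rule ext) (simp add: halfkernel_def)
  ultimately show ?thesis by (simp only:)
qed

lemma halfkernel1_has_derivative:
  assumes "q \<noteq> 0"
  shows "((\<lambda>q. halfkernel1 a q w) has_derivative halfkernel2 a q w) (at q)"
proof -
  have "((\<lambda>q. snd w * (q \<bullet> q) powr (- a) - 2 * a * ((snd q * (q \<bullet> w)) * (q \<bullet> q) powr (- a - 1))) has_derivative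
     (\<lambda>h. snd w * (2 * (- a) * (q \<bullet> h) * (q \<bullet> q) powr (- a - 1))
        - 2 * a * ((snd q * (q \<bullet> w)) * (2 * (- a - 1) * (q \<bullet> h) * (q \<bullet> q) powr (- a - 1 - 1))
           + (snd q * (h \<bullet> w) + snd h * (q \<bullet> w)) * (q \<bullet> q) powr (- a - 1)))) (at q)"
    by (intro has_derivative_diff has_derivative_mult_right has_derivative_mult has_derivative_snd
        has_derivative_inner_left has_derivative_ident inner_self_powr_has_derivative assms)
  moreover have "(\<lambda>h. snd w * (2 * (- a) * (q \<bullet> h) * (q \<bullet> q) powr (- a - 1))
        - 2 * a * ((snd q * (q \<bullet> w)) * (2 * (- a - 1) * (q \<bullet> h) * (q \<bullet> q) powr (- a - 1 - 1))
           + (snd q * (h \<bullet> w) + snd h * (q \<bullet> w)) * (q \<bullet> q) powr (- a - 1)))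
     = halfkernel2 a q w"
    by (rule ext) (simp add: halfkernel2_def algebra_simps)
  moreover have "(\<lambda>q. snd w * (q \<bullet> q) powr (- a) - 2 * a * ((snd q * (q \<bullet> w)) * (q \<bullet> q) powr (- a - 1)))
     = (\<lambda>q. halfkernel1 a q w)"
    by (rule ext) (simp add: halfkernel1_def algebra_simps)
  ultimately show ?thesis by simp
qed

lemma inner_self_powr: "(q \<bullet> q) powr s = norm q powr (2 * s)" for q :: "'b::real_inner"
proof (cases "q = 0")
  case False
  have "q \<bullet> q = norm q powr 2"
    using False by (simp add: dot_square_norm)
  then show ?thesis by (simp only: powr_powr)
qed simp

lemma abs_snd_le_norm: "\<bar>snd p\<bar> \<le> norm p" for p :: "'b::real_normed_vector \<times> real"
  using norm_snd_le[of "snd p" "fst p"] by simp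

text \<open>The kernel is homogeneous of degree \<open>1 - 2 * a\<close>, so each derivative lowers
  the power of \<open>norm q\<close> by one. Only the numerical factor has to be tracked.\<close>

lemma halfkernel1_bound:
  assumes "a \<ge> 0" "q \<noteq> 0"
  shows "\<bar>halfkernel1 a q w\<bar> \<le> (1 + 2 * a) * norm w * norm q powr (- 2 * a)"
proof -
  let ?N = "norm q"
  have N: "?N > 0" using assms by simp
  have "\<bar>halfkernel1 a q w\<bar> \<le> \<bar>snd w * (q \<bullet> q) powr (- a)\<bar> + \<bar>2 * a * snd q * (q \<bullet> w) * (q \<bullet> q) powr (- a - 1)\<bar>"
    unfolding halfkernel1_def by (rule abs_triangle_ineq4)
  also have "\<bar>snd w * (q \<bullet> q) powr (- a)\<bar> \<le> norm w * ?N powr (- 2 * a)"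
    by (simp add: inner_self_powr abs_mult mult_right_mono abs_snd_le_norm)
  also have "\<bar>2 * a * snd q * (q \<bullet> w) * (q \<bullet> q) powr (- a - 1)\<bar>
      = 2 * a * (\<bar>snd q\<bar> * \<bar>q \<bullet> w\<bar>) * (q \<bullet> q) powr (- a - 1)"
    using assms by (simp add: abs_mult)
  also have "\<dots> \<le> 2 * a * (?N * (?N * norm w)) * (q \<bullet> q) powr (- a - 1)"
    using assms by (intro mult_right_mono mult_left_mono mult_mono abs_snd_le_norm Cauchy_Schwarz_ineq2) auto
  also have "\<dots> = 2 * a * norm w * (?N powr 2 * ?N powr (2 * (- a - 1)))"
    using N by (simp add: inner_self_powr power2_eq_square)
  also have "?N powr 2 * ?N powr (2 * (- a - 1)) = ?N powr (- 2 * a)"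
    by (subst powr_add[symmetric]) (rule arg_cong2[of _ _ _ _ "(powr)"], simp_all)
  finally show ?thesis by (simp add: algebra_simps)
qed

lemma halfkernel2_bound:
  assumes "a \<ge> 0" "q \<noteq> 0"
  shows "\<bar>halfkernel2 a q w h\<bar> \<le> (6 * a + 4 * a * (a + 1)) * norm q powr (- 2 * a - 1) * norm w * norm h"
proof -
  let ?N = "norm q"
  have N: "?N > 0" using assms by simp
  let ?A = "snd q * (q \<bullet> w) * (q \<bullet> h) * (q \<bullet> q) powr (- a - 2)"
  let ?B = "(snd w * (q \<bullet> h) + snd h * (q \<bullet> w) + snd q * (h \<bullet> w)) * (q \<bullet> q) powr (- a - 1)"
  let ?E = "norm w * norm h * ?N powr (- 2 * a - 1)"
  have "\<bar>snd q * (q \<bullet> w) * (q \<bullet> h)\<bar> \<le> ?N * (?N * norm w) * (?N * norm h)"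
    unfolding abs_mult
    by (intro mult_mono abs_snd_le_norm Cauchy_Schwarz_ineq2) auto
  also have "\<dots> = norm w * norm h * ?N powr 3"
    using N by (simp add: power3_eq_cube)
  finally have "\<bar>?A\<bar> \<le> norm w * norm h * ?N powr 3 * (q \<bullet> q) powr (- a - 2)"
    unfolding abs_mult[of "snd q * (q \<bullet> w) * (q \<bullet> h)"] by (intro mult_mono) auto
  also have "\<dots> = norm w * norm h * (?N powr 3 * ?N powr (2 * (- a - 2)))"
    by (simp add: inner_self_powr)
  also have "?N powr 3 * ?N powr (2 * (- a - 2)) = ?N powr (- 2 * a - 1)"
    by (subst powr_add[symmetric]) (rule arg_cong2[of _ _ _ _ "(powr)"], simp_all)
  finally have A: "\<bar>?A\<bar> \<le> ?E" .
  have "\<bar>snd w * (q \<bullet> h)\<bar> \<le> norm w * (?N * norm h)" "\<bar>snd h * (q \<bullet> w)\<bar> \<le> norm h * (?N * norm w)"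
    "\<bar>snd q * (h \<bullet> w)\<bar> \<le> ?N * (norm h * norm w)"
    unfolding abs_mult by (intro mult_mono abs_snd_le_norm Cauchy_Schwarz_ineq2; simp)+
  then have "\<bar>snd w * (q \<bullet> h) + snd h * (q \<bullet> w) + snd q * (h \<bullet> w)\<bar> \<le> 3 * (norm w * norm h * ?N)"
    by (simp add: algebra_simps)
  also have "?N = ?N powr 1" using N by simp
  finally have "\<bar>?B\<bar> \<le> 3 * (norm w * norm h * ?N powr 1) * (q \<bullet> q) powr (- a - 1)"
    unfolding abs_mult by (intro mult_mono) auto
  also have "\<dots> = 3 * (norm w * norm h * (?N powr 1 * ?N powr (2 * (- a - 1))))"
    by (simp add: inner_self_powr)
  also have "?N powr 1 * ?N powr (2 * (- a - 1)) = ?N powr (- 2 * a - 1)"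
    by (subst powr_add[symmetric]) (rule arg_cong2[of _ _ _ _ "(powr)"], simp_all)
  finally have B: "\<bar>?B\<bar> \<le> 3 * ?E" .
  have "\<bar>halfkernel2 a q w h\<bar> \<le> \<bar>4 * a * (a + 1) * ?A\<bar> + \<bar>2 * a * ?B\<bar>"
    unfolding halfkernel2_def by (rule abs_triangle_ineq4)
  also have "\<dots> = 4 * a * (a + 1) * \<bar>?A\<bar> + 2 * a * \<bar>?B\<bar>"
    using assms(1) by (simp add: abs_mult)
  also have "\<dots> \<le> 4 * a * (a + 1) * ?E + 2 * a * (3 * ?E)"
    using assms(1) A B by (intro add_mono mult_left_mono) auto
  finally show ?thesis by (simp add: algebra_simps)
qed

text \<open>The polynomial factor is the constant of the second derivative; the power of 2 pays for
  replacing \<open>norm z\<close> by \<open>norm p\<close> when \<open>norm z\<close> is at least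
  \<open>norm p / 2\<close>. The added \<open>2 * a + 1\<close> makes the same number dominate the
  constant of the first derivative and be at least 1.\<close>

definition kconst :: "real \<Rightarrow> real" where
  "kconst a = (6 * a + 4 * a * (a + 1)) * 2 powr (2 * a + 1) + 2 * a + 1"

lemma kconst_ge_1: "a \<ge> 0 \<Longrightarrow> kconst a \<ge> 1"
  by (simp add: kconst_def)

lemma halfkernel1_linear: "linear (halfkernel1 a q)"
  by (rule linearI) (auto simp: halfkernel1_def inner_add_right algebra_simps)

text \<open>Mean value inequality on the closed ball of radius \<open>norm p / 2\<close> about
  \<open>p\<close>, which stays away from the singularity at 0 and on which norms are comparable to
  \<open>norm p\<close>.\<close>

lemma halfkernel1_lipschitz:
  assumes a: "a \<ge> 0" and p: "p \<noteq> 0" and q: "norm (q - p) \<le> norm p / 2"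
  shows "\<bar>halfkernel1 a q w - halfkernel1 a p w\<bar>
    \<le> kconst a * norm p powr (- 2 * a - 1) * norm w * norm (q - p)"
proof -
  have ge: "norm z \<ge> norm p / 2" "z \<noteq> 0" if "z \<in> cball p (norm p / 2)" for z
  proof -
    have "norm (z - p) \<le> norm p / 2" using that by (simp add: dist_norm norm_minus_commute)
    then show "norm z \<ge> norm p / 2" using norm_triangle_ineq2[of p z] by (simp add: norm_minus_commute)
    then show "z \<noteq> 0" using p by auto
  qed
  let ?B = "kconst a * norm p powr (- 2 * a - 1) * norm w"
  have "norm (halfkernel1 a q w - halfkernel1 a p w) \<le> ?B * norm (q - p)"
  proof (rule differentiable_bound[of "cball p (norm p / 2)" _ "\<lambda>z. halfkernel2 a z w"])
    fix z assume z: "z \<in> cball p (norm p / 2)"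
    show "((\<lambda>z. halfkernel1 a z w) has_derivative halfkernel2 a z w) (at z within cball p (norm p / 2))"
      using halfkernel1_has_derivative[OF ge(2)[OF z]] by (rule has_derivative_at_withinI)
    show "onorm (halfkernel2 a z w) \<le> ?B"
    proof (rule onorm_bound)
      show "0 \<le> ?B" using kconst_ge_1[OF a] by simp
      fix h
      have "norm z powr (- 2 * a - 1) \<le> (norm p / 2) powr (- 2 * a - 1)"
        using ge(1)[OF z] p a by (intro powr_mono2') auto
      also have "\<dots> = 2 powr (2 * a + 1) * norm p powr (- 2 * a - 1)"
        using powr_minus_divide[of 2 "2 * a + 1"] by (simp add: powr_divide)
      finally have *: "norm z powr (- 2 * a - 1) \<le> 2 powr (2 * a + 1) * norm p powr (- 2 * a - 1)" .
      have "norm (halfkernel2 a z w h) \<le> (6 * a + 4 * a * (a + 1)) * norm z powr (- 2 * a - 1) * norm w * norm h"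
        using halfkernel2_bound[OF a ge(2)[OF z]] by simp
      also have "\<dots> \<le> (6 * a + 4 * a * (a + 1)) * (2 powr (2 * a + 1) * norm p powr (- 2 * a - 1)) * norm w * norm h"
        using a by (intro mult_right_mono mult_left_mono *) auto
      also have "\<dots> \<le> ?B * norm h"
        using a by (auto simp: kconst_def algebra_simps)
      finally show "norm (halfkernel2 a z w h) \<le> ?B * norm h" .
    qed
  qed (use p q in \<open>auto simp: dist_norm norm_minus_commute\<close>)
  then show ?thesis by simp
qed

lemma halfkernel_taylor:
  assumes a: "a \<ge> 0" and p: "p \<noteq> 0" and q: "norm (q - p) \<le> norm p / 2"
  shows "\<bar>halfkernel a q - halfkernel a p - halfkernel1 a p (q - p)\<bar>
    \<le> kconst a * norm p powr (- 2 * a - 1) * (norm (q - p))\<^sup>2"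
proof -
  let ?L = "kconst a * norm p powr (- 2 * a - 1)"
  \<comment> \<open>The radius is \<open>norm (q - p)\<close> and not \<open>norm p / 2\<close>: on
    this ball the derivative of \<open>g\<close> is itself of size \<open>norm (q - p)\<close>,
    which yields the second factor of the quadratic bound.\<close>
  let ?S = "cball p (norm (q - p))"
  define g where "g z = halfkernel a z - halfkernel1 a p z" for z
  have "norm (g q - g p) \<le> (?L * norm (q - p)) * norm (q - p)"
  proof (rule differentiable_bound[of ?S _ "\<lambda>z h. halfkernel1 a z h - halfkernel1 a p h"])
    fix z assume z: "z \<in> ?S"
    then have zp: "norm (z - p) \<le> norm (q - p)" by (simp add: dist_norm norm_minus_commute)
    with q have zp2: "norm (z - p) \<le> norm p / 2" by linarith
    then have "z \<noteq> 0" using p by auto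
    have "(halfkernel1 a p has_derivative halfkernel1 a p) (at z within ?S)"
      using halfkernel1_linear[of a p]
      by (intro bounded_linear_imp_has_derivative) (simp add: linear_conv_bounded_linear)
    then show "(g has_derivative (\<lambda>h. halfkernel1 a z h - halfkernel1 a p h)) (at z within ?S)"
      unfolding g_def using halfkernel_has_derivative[OF \<open>z \<noteq> 0\<close>]
      by (intro has_derivative_diff) (auto intro: has_derivative_at_withinI)
    show "onorm (\<lambda>h. halfkernel1 a z h - halfkernel1 a p h) \<le> ?L * norm (q - p)"
    proof (rule onorm_bound)
      show "0 \<le> ?L * norm (q - p)" using kconst_ge_1[OF a] by simp
      fix h
      have "norm (halfkernel1 a z h - halfkernel1 a p h) \<le> ?L * norm h * norm (z - p)"
        using halfkernel1_lipschitz[OF a p zp2] by simp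
      also have "\<dots> \<le> ?L * norm h * norm (q - p)"
        using kconst_ge_1[OF a] by (intro mult_left_mono zp) auto
      finally show "norm (halfkernel1 a z h - halfkernel1 a p h) \<le> ?L * norm (q - p) * norm h"
        by (simp add: mult_ac)
    qed
  qed (auto simp: dist_norm norm_minus_commute)
  moreover have "g q - g p = halfkernel a q - halfkernel a p - halfkernel1 a p (q - p)"
    by (simp add: g_def linear_diff[OF halfkernel1_linear])
  ultimately show ?thesis by (simp add: power2_eq_square mult.assoc)
qed

section \<open>Interior estimates for the Poisson extension\<close>

text \<open>The value of the dyadic sum below: \<open>2 ^ (n + 1)\<close> from the kernel on each
  shell, the volume of the unit ball, and a factor 2 from the geometric series.\<close>

definition tail_const :: "'n::finite itself \<Rightarrow> real" where
  "tail_const _ = 2 ^ (CARD('n) + 2) * measure lborel (ball (0::real^'n) 1)"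

lemma tail_const_pos: "tail_const TYPE('n::finite) > 0"
  by (simp add: tail_const_def content_ball_pos)

lemma snd_le_norm_diff_boundary:
  fixes p :: "(real^'n) \<times> real"
  assumes "snd p > 0"
  shows "snd p \<le> norm (p - (y, 0))"
  using abs_snd_le_norm[of "p - (y, 0)"] assms by simp

text \<open>Splitting the boundary into dyadic balls of radius \<open>2\<^sup>i\<close> times the height of \<open>p\<close>.\<close>

lemma nn_integral_norm_powr_boundary:
  fixes p :: "(real^'n) \<times> real"
  assumes z: "snd p > 0"
  shows "(\<integral>\<^sup>+y. ennreal (norm (p - (y, 0)) powr (- (real CARD('n) + 1))) \<partial>lborel)
    \<le> ennreal (tail_const TYPE('n) / snd p)"
proof -
  let ?n = "CARD('n)" and ?z = "snd p" and ?x = "fst p"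
  \<comment> \<open>The bound for the kernel on the \<open>i\<close>-th shell, where the distance
    from \<open>p\<close> is at least \<open>?z * 2 ^ i / 2\<close>. Multiplied by the volume of the
    \<open>i\<close>-th ball it decays like \<open>2 ^ (- i)\<close>.\<close>
  define c where "c i = (2 / (?z * 2 ^ i)) ^ (?n + 1)" for i :: nat
  have le_suminf: "f i \<le> suminf f" for f :: "nat \<Rightarrow> ennreal" and i
    using sum_le_suminf[of f "{i}"] by simp
  have c: "c i \<ge> 0" for i using z by (simp add: c_def)
  have "(\<integral>\<^sup>+y. ennreal (norm (p - (y, 0)) powr (- (real ?n + 1))) \<partial>lborel)
      \<le> (\<integral>\<^sup>+y. (\<Sum>i. ennreal (c i) * indicator (ball ?x (?z * 2 ^ i)) y) \<partial>lborel)"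
  proof (rule nn_integral_mono)
    fix y :: "real^'n"
    have "\<exists>i. dist ?x y < ?z * 2 ^ i"
    proof -
      obtain i :: nat where "dist ?x y / ?z < 2 ^ i" using real_arch_pow[of 2 "dist ?x y / ?z"] by auto
      then show ?thesis using z by (auto simp: field_simps)
    qed
    \<comment> \<open>Minimality supplies the lower bound for the distance: \<open>y\<close> lies
      outside the preceding ball. For \<open>i = 0\<close> there is none, and the height of
      \<open>p\<close> takes its role.\<close>
    define i where "i = (LEAST i. dist ?x y < ?z * 2 ^ i)"
    have i: "dist ?x y < ?z * 2 ^ i"
      unfolding i_def by (rule LeastI_ex) fact
    have "norm (p - (y, 0)) \<ge> ?z * 2 ^ i / 2"
    proof (cases i)
      case 0
      then show ?thesis using snd_le_norm_diff_boundary[OF z, of y] z by simp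
    next
      case (Suc j)
      have "\<not> dist ?x y < ?z * 2 ^ j"
        using not_less_Least[of j "\<lambda>i. dist ?x y < ?z * 2 ^ i"] Suc by (simp add: i_def)
      then have "?z * 2 ^ i / 2 \<le> norm (fst (p - (y, 0)))"
        by (simp add: Suc dist_norm)
      also have "\<dots> \<le> norm (p - (y, 0))"
        by (metis norm_fst_le prod.collapse)
      finally show ?thesis .
    qed
    then have "norm (p - (y, 0)) powr (- (real ?n + 1)) \<le> (?z * 2 ^ i / 2) powr (- (real ?n + 1))"
      using z by (intro powr_mono2') auto
    also have "\<dots> = 1 / (?z * 2 ^ i / 2) powr (real (?n + 1))"
      by (subst powr_minus_divide) (simp add: add.commute)
    also have "\<dots> = c i"
      using z by (subst powr_realpow) (auto simp: c_def power_divide)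
    finally have "ennreal (norm (p - (y, 0)) powr (- (real ?n + 1)))
        \<le> ennreal (c i) * indicator (ball ?x (?z * 2 ^ i)) y"
      using i by (simp add: ennreal_leI)
    also have "\<dots> \<le> (\<Sum>i. ennreal (c i) * indicator (ball ?x (?z * 2 ^ i)) y)"
      by (rule le_suminf)
    finally show "ennreal (norm (p - (y, 0)) powr (- (real ?n + 1)))
        \<le> (\<Sum>i. ennreal (c i) * indicator (ball ?x (?z * 2 ^ i)) y)" .
  qed
  also have "\<dots> = (\<Sum>i. \<integral>\<^sup>+y. ennreal (c i) * indicator (ball ?x (?z * 2 ^ i)) y \<partial>lborel)"
    by (rule nn_integral_suminf) (measurable, simp)
  also have "\<dots> = (\<Sum>i. ennreal ((2 ^ (?n + 1) * measure lborel (ball (0::real^'n) 1) / ?z) * (1 / 2) ^ i))"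
  proof (rule suminf_cong)
    fix i
    have "(\<integral>\<^sup>+y. ennreal (c i) * indicator (ball ?x (?z * 2 ^ i)) y \<partial>lborel)
        = ennreal (c i) * ennreal (measure lborel (ball ?x (?z * 2 ^ i)))"
      using emeasure_lborel_ball_finite[of ?x "?z * 2 ^ i"]
      by (subst nn_integral_cmult_indicator) (auto simp: emeasure_eq_ennreal_measure)
    also have "measure lborel (ball ?x (?z * 2 ^ i)) = (?z * 2 ^ i) ^ ?n * measure lborel (ball (0::real^'n) 1)"
      using z content_ball_conv_unit_ball[of "?z * 2 ^ i" ?x] by simp
    also have "ennreal (c i) * ennreal ((?z * 2 ^ i) ^ ?n * measure lborel (ball (0::real^'n) 1))
        = ennreal (c i * ((?z * 2 ^ i) ^ ?n * measure lborel (ball (0::real^'n) 1)))"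
      using c by (simp add: ennreal_mult')
    also have "c i * ((?z * 2 ^ i) ^ ?n * measure lborel (ball (0::real^'n) 1))
        = (2 ^ (?n + 1) * measure lborel (ball (0::real^'n) 1) / ?z) * (1 / 2) ^ i"
      using z by (simp add: c_def power_divide power_mult_distrib field_simps)
    finally show "(\<integral>\<^sup>+y. ennreal (c i) * indicator (ball ?x (?z * 2 ^ i)) y \<partial>lborel)
        = ennreal ((2 ^ (?n + 1) * measure lborel (ball (0::real^'n) 1) / ?z) * (1 / 2) ^ i)" .
  qed
  also have "\<dots> = ennreal ((2 ^ (?n + 1) * measure lborel (ball (0::real^'n) 1) / ?z) * 2)"
    using z by (intro suminf_ennreal_eq sums_mult) (auto simp: power_half_series geometric_sums[of "1/2::real", simplified])
  also have "(2 ^ (?n + 1) * measure lborel (ball (0::real^'n) 1) / ?z) * 2 = tail_const TYPE('n) / ?z"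
    by (simp add: tail_const_def)
  finally show ?thesis .
qed

text \<open>The one integral estimate behind all interior bounds. It is applied with
  \<open>f\<close> the kernel, its derivative, the Taylor remainder of the former and the increment
  of the latter, each dominated by a multiple of the same power of the distance.\<close>

lemma boundary_weighted_integral:
  fixes u :: "real^'n \<Rightarrow> real^'d" and p :: "(real^'n) \<times> real"
  assumes z: "snd p > 0" and u: "u \<in> borel_measurable borel" "AE y in lborel. norm (u y) \<le> M" "M \<ge> 0"
    and f: "f \<in> borel_measurable borel" "\<And>y. \<bar>f y\<bar> \<le> B * norm (p - (y, 0)) powr (- (real CARD('n) + 1))"
    and B: "B \<ge> 0"
  shows "integrable lborel (\<lambda>y. f y *\<^sub>R u y)"
    and "norm (\<integral>y. f y *\<^sub>R u y \<partial>lborel) \<le> B * M * (tail_const TYPE('n) / snd p)"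
proof -
  let ?k = "\<lambda>y::real^'n. norm (p - (y, 0)) powr (- (real CARD('n) + 1))"
  have "(\<integral>\<^sup>+y. ennreal (norm (f y *\<^sub>R u y)) \<partial>lborel) \<le> (\<integral>\<^sup>+y. ennreal (B * M) * ennreal (?k y) \<partial>lborel)"
  proof (rule nn_integral_mono_AE)
    show "AE y in lborel. ennreal (norm (f y *\<^sub>R u y)) \<le> ennreal (B * M) * ennreal (?k y)"
      using u(2)
    proof eventually_elim
      case (elim y)
      have "norm (f y *\<^sub>R u y) \<le> (B * ?k y) * M"
        using elim f(2)[of y] B by (simp, intro mult_mono) auto
      then show ?case using B u(3) by (subst ennreal_mult[symmetric]) (auto intro!: ennreal_leI simp: mult_ac)
    qed
  qed
  also have "\<dots> = ennreal (B * M) * (\<integral>\<^sup>+y. ennreal (?k y) \<partial>lborel)"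
    by (rule nn_integral_cmult)
      (use z in \<open>auto intro!: measurable_compose[OF _ measurable_ennreal]
          borel_measurable_continuous_onI continuous_intros simp: prod_eq_iff\<close>)
  also have "\<dots> \<le> ennreal (B * M) * ennreal (tail_const TYPE('n) / snd p)"
    by (intro mult_left_mono nn_integral_norm_powr_boundary z) auto
  also have "\<dots> = ennreal (B * M * (tail_const TYPE('n) / snd p))"
    using B u(3) tail_const_pos[where 'n='n] z by (subst ennreal_mult[symmetric]) auto
  finally have le: "(\<integral>\<^sup>+y. ennreal (norm (f y *\<^sub>R u y)) \<partial>lborel) \<le> ennreal (B * M * (tail_const TYPE('n) / snd p))" .
  show int: "integrable lborel (\<lambda>y. f y *\<^sub>R u y)"
  proof (rule integrableI_bounded)
    show "(\<lambda>y. f y *\<^sub>R u y) \<in> borel_measurable lborel" using f(1) u(1) by simp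
    show "(\<integral>\<^sup>+y. ennreal (norm (f y *\<^sub>R u y)) \<partial>lborel) < \<infinity>"
      using le by (rule le_less_trans) simp
  qed
  have "0 \<le> B * M * (tail_const TYPE('n) / snd p)"
    using B u(3) tail_const_pos[where 'n='n] z by simp
  then show "norm (\<integral>y. f y *\<^sub>R u y \<partial>lborel) \<le> B * M * (tail_const TYPE('n) / snd p)"
    using order_trans[OF integral_norm_bound_ennreal[OF int] le] by (simp add: ennreal_le_iff)
qed

text \<open>The interior estimates of bounded harmonic functions, in a form invariant under
  \<open>F \<mapsto> F((x, 0) + r q)\<close>.\<close>

definition half_regular :: "real \<Rightarrow> ((real^'n) \<times> real \<Rightarrow> real^'d) \<Rightarrow> bool" where
  "half_regular M F \<longleftrightarrow> (\<forall>p\<in>upper_half. F differentiable at p \<and> norm (F p) \<le> M \<and>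
     (\<forall>w. norm (frechet_derivative F (at p) w) \<le> M * norm w / snd p) \<and>
     (\<forall>q. norm (q - p) \<le> snd p / 2 \<longrightarrow>
        norm (F q - F p - frechet_derivative F (at p) (q - p)) \<le> M * (norm (q - p))\<^sup>2 / (snd p)\<^sup>2 \<and>
        (\<forall>w. norm (frechet_derivative F (at q) w - frechet_derivative F (at p) w)
            \<le> M * norm (q - p) * norm w / (snd p)\<^sup>2)))"

text \<open>The absolute value and the added 1 make the constant positive without any evaluation of
  \<open>gamma_n\<close>.\<close>

definition poisson_const :: "'n::finite itself \<Rightarrow> real" where
  "poisson_const _ = (\<bar>gamma_n CARD('n)\<bar> + 1) * kconst ((real CARD('n) + 1) / 2) * tail_const TYPE('n)"

lemma poisson_const_pos: "poisson_const TYPE('n::finite) > 0"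
  using kconst_ge_1[of "(real CARD('n) + 1) / 2"] tail_const_pos[where 'n='n]
  by (simp add: poisson_const_def)

lemma poisson_ext_kernel:
  fixes u :: "real^'n \<Rightarrow> real^'d"
  shows "poisson_ext u p
    = (\<integral>y. (gamma_n CARD('n) * halfkernel ((real CARD('n) + 1) / 2) (p - (y, 0))) *\<^sub>R u y \<partial>lborel)"
proof -
  have "(p - (y, 0)) \<bullet> (p - (y, 0)) = norm (fst p - y) ^ 2 + snd p ^ 2" for y
    by (simp add: inner_prod_def dot_square_norm power2_eq_square)
  then show ?thesis
    unfolding poisson_ext_def halfkernel_def by (simp add: powr_minus_divide)
qed

text \<open>The kernel estimates are integrated against \<open>u\<close>. Differentiability comes
  out of the Taylor estimate: the integrated remainder is quadratic in \<open>q - p\<close>, so the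
  integral of the kernel derivative is the Frechet derivative, without differentiating under the
  integral sign.\<close>

lemma poisson_ext_half_regular:
  fixes u :: "real^'n \<Rightarrow> real^'d"
  assumes u: "u \<in> borel_measurable borel" "AE y in lborel. norm (u y) \<le> M" "M \<ge> 0"
  shows "half_regular (poisson_const TYPE('n) * M) (poisson_ext u)"
proof -
  define a where "a = (real CARD('n) + 1) / 2"
  define g where "g = gamma_n CARD('n)"
  define Z where "Z = tail_const TYPE('n)"
  define C where "C = poisson_const TYPE('n)"
  have a: "a \<ge> 0" and a2: "- 2 * a = - (real CARD('n) + 1)"
    by (auto simp: a_def field_simps)
  have Z: "Z > 0" by (simp add: Z_def tail_const_pos)
  have k1: "kconst a \<ge> 1" using kconst_ge_1[OF a] .
  have Cge: "\<bar>g\<bar> * t * Z \<le> C" if "t \<le> kconst a" "t \<ge> 0" for t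
  proof -
    have "\<bar>g\<bar> * t * Z \<le> (\<bar>g\<bar> + 1) * kconst a * Z"
      using that Z by (intro mult_right_mono mult_mono) auto
    then show ?thesis by (simp add: C_def poisson_const_def g_def a_def Z_def)
  qed
  define \<rho> where "\<rho> p y = norm (p - (y, 0)) powr (- 2 * a)" for p :: "(real^'n) \<times> real" and y
  have nz: "p - (y, 0) \<noteq> 0" if "snd p > 0" for p :: "(real^'n) \<times> real" and y
    using that by (auto simp: prod_eq_iff)
  have mK: "(\<lambda>y. g * halfkernel a (p - (y, 0))) \<in> borel_measurable borel" if "snd p > 0" for p :: "(real^'n) \<times> real"
    unfolding halfkernel_def using nz[OF that]
    by (intro borel_measurable_continuous_onI continuous_intros) auto
  have mK1: "(\<lambda>y. g * halfkernel1 a (p - (y, 0)) w) \<in> borel_measurable borel" if "snd p > 0" for p w :: "(real^'n) \<times> real"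
    unfolding halfkernel1_def using nz[OF that]
    by (intro borel_measurable_continuous_onI continuous_intros) auto
  have bK: "\<bar>g * halfkernel a (p - (y, 0))\<bar> \<le> (\<bar>g\<bar> * snd p) * \<rho> p y" if "snd p > 0" for p :: "(real^'n) \<times> real" and y
    using that by (simp add: halfkernel_def inner_self_powr \<rho>_def abs_mult)
  have bK1: "\<bar>g * halfkernel1 a (p - (y, 0)) w\<bar> \<le> (\<bar>g\<bar> * (1 + 2 * a) * norm w) * \<rho> p y"
    if "snd p > 0" for p w :: "(real^'n) \<times> real" and y
  proof -
    have "\<bar>g\<bar> * \<bar>halfkernel1 a (p - (y, 0)) w\<bar> \<le> \<bar>g\<bar> * ((1 + 2 * a) * norm w * norm (p - (y, 0)) powr (- 2 * a))"
      by (intro mult_left_mono halfkernel1_bound a nz that) auto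
    then show ?thesis by (simp add: abs_mult \<rho>_def mult_ac)
  qed
  \<comment> \<open>The additional negative power in the second-order estimates is traded for
    \<open>1 / snd p\<close>, since no boundary point is closer to \<open>p\<close> than its
    height.\<close>
  have \<rho>1: "norm (p - (y, 0)) powr (- 2 * a - 1) \<le> \<rho> p y / snd p" if "snd p > 0" for p :: "(real^'n) \<times> real" and y
  proof -
    have "norm (p - (y, 0)) powr (- 2 * a - 1) = \<rho> p y / norm (p - (y, 0))"
      unfolding \<rho>_def using nz[OF that] by (simp add: powr_diff)
    also have "\<dots> \<le> \<rho> p y / snd p"
      using that nz[OF that] snd_le_norm_diff_boundary[OF that] by (intro divide_left_mono) (auto simp: \<rho>_def)
    finally show ?thesis .
  qed
  \<comment> \<open>One condition on \<open>q\<close>, measured by the height, puts it in the range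
    of the kernel estimates for all boundary points \<open>y\<close> simultaneously.\<close>
  have close: "norm ((q - (y, 0)) - (p - (y, 0))) \<le> norm (p - (y, 0)) / 2"
    if "snd p > 0" "norm (q - p) \<le> snd p / 2" for p q :: "(real^'n) \<times> real" and y
    using snd_le_norm_diff_boundary[OF that(1), of y] that(2) by simp
  have qpos: "snd q > 0" if "snd p > 0" "norm (q - p) \<le> snd p / 2" for p q :: "(real^'n) \<times> real"
    using abs_snd_le_norm[of "q - p"] that by simp

  define D where "D p w = (\<integral>y. (g * halfkernel1 a (p - (y, 0)) w) *\<^sub>R u y \<partial>lborel)" for p w
  note U = poisson_ext_kernel[of u, folded a_def g_def]
  note wi = boundary_weighted_integral[OF _ u, unfolded a2[symmetric], folded \<rho>_def Z_def]
  have intK: "integrable lborel (\<lambda>y. (g * halfkernel a (p - (y, 0))) *\<^sub>R u y)" if "snd p > 0" for p :: "(real^'n) \<times> real"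
    by (rule wi(1)[OF that mK[OF that] bK[OF that]]) (use that in auto)
  have intK1: "integrable lborel (\<lambda>y. (g * halfkernel1 a (p - (y, 0)) w) *\<^sub>R u y)" if "snd p > 0" for p w :: "(real^'n) \<times> real"
    by (rule wi(1)[OF that mK1[OF that] bK1[OF that]]) (use a in auto)
  have linD: "linear (D p)" if "snd p > 0" for p
  proof (rule linearI)
    fix v w :: "(real^'n) \<times> real" and c :: real
    show "D p (v + w) = D p v + D p w"
      unfolding D_def by (subst Bochner_Integration.integral_add[symmetric])
        (use intK1[OF that] in \<open>auto simp: linear_add[OF halfkernel1_linear] algebra_simps\<close>)
    show "D p (c *\<^sub>R w) = c *\<^sub>R D p w"
      unfolding D_def by (subst integral_scaleR_right[symmetric])
        (auto simp: linear_scale[OF halfkernel1_linear] mult_ac)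
  qed
  have U_bound: "norm (poisson_ext u p) \<le> C * M" if "snd p > 0" for p
  proof -
    have "norm (poisson_ext u p) \<le> (\<bar>g\<bar> * snd p) * M * (Z / snd p)"
      unfolding U by (rule wi(2)[OF that mK[OF that] bK[OF that]]) (use that in auto)
    also have "\<dots> = (\<bar>g\<bar> * 1 * Z) * M" using that by simp
    also have "\<dots> \<le> C * M" by (intro mult_right_mono Cge k1 u) auto
    finally show ?thesis .
  qed
  have D_bound: "norm (D p w) \<le> C * M * norm w / snd p" if "snd p > 0" for p w
  proof -
    have "norm (D p w) \<le> (\<bar>g\<bar> * (1 + 2 * a) * norm w) * M * (Z / snd p)"
      unfolding D_def by (rule wi(2)[OF that mK1[OF that] bK1[OF that]]) (use a in auto)
    also have "\<dots> = (\<bar>g\<bar> * (1 + 2 * a) * Z) * (M * norm w / snd p)" by simp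
    also have "\<dots> \<le> C * (M * norm w / snd p)"
      using that a u by (intro mult_right_mono Cge) (auto simp: kconst_def)
    finally show ?thesis by simp
  qed
  have fin: "(\<bar>g\<bar> * kconst a * t / snd p) * M * (Z / snd p) \<le> C * M * t / (snd p)\<^sup>2"
    if "snd p > 0" "t \<ge> 0" for t and p :: "(real^'n) \<times> real"
  proof -
    have "(\<bar>g\<bar> * kconst a * t / snd p) * M * (Z / snd p) = (\<bar>g\<bar> * kconst a * Z) * (M * t / (snd p)\<^sup>2)"
      by (simp add: power2_eq_square)
    also have "\<dots> \<le> C * (M * t / (snd p)\<^sup>2)"
      using that u k1 by (intro mult_right_mono Cge) auto
    finally show ?thesis by simp
  qed
  have taylor: "norm (poisson_ext u q - poisson_ext u p - D p (q - p)) \<le> C * M * (norm (q - p))\<^sup>2 / (snd p)\<^sup>2"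
    if p: "snd p > 0" and q: "norm (q - p) \<le> snd p / 2" for p q
  proof -
    note q0 = qpos[OF p q]
    define f where "f y = g * halfkernel a (q - (y, 0)) - g * halfkernel a (p - (y, 0))
        - g * halfkernel1 a (p - (y, 0)) (q - p)" for y :: "real^'n"
    have "poisson_ext u q - poisson_ext u p - D p (q - p) = (\<integral>y. f y *\<^sub>R u y \<partial>lborel)"
      unfolding U D_def f_def
      using intK[OF p] intK[OF q0] intK1[OF p, of "q - p"]
      by (simp add: scaleR_diff_left)
    also have "norm \<dots> \<le> (\<bar>g\<bar> * kconst a * (norm (q - p))\<^sup>2 / snd p) * M * (Z / snd p)"
    proof (rule wi(2)[OF p])
      show "f \<in> borel_measurable borel"
        unfolding f_def by (intro borel_measurable_diff mK mK1 p q0)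
      fix y
      have "\<bar>f y\<bar> = \<bar>g\<bar> * \<bar>halfkernel a (q - (y, 0)) - halfkernel a (p - (y, 0))
          - halfkernel1 a (p - (y, 0)) ((q - (y, 0)) - (p - (y, 0)))\<bar>"
        by (simp add: f_def abs_mult[symmetric] algebra_simps)
      also have "\<dots> \<le> \<bar>g\<bar> * (kconst a * norm (p - (y, 0)) powr (- 2 * a - 1) * (norm ((q - (y, 0)) - (p - (y, 0))))\<^sup>2)"
        by (intro mult_left_mono halfkernel_taylor a nz p close q) auto
      also have "\<dots> \<le> \<bar>g\<bar> * (kconst a * (\<rho> p y / snd p) * (norm ((q - (y, 0)) - (p - (y, 0))))\<^sup>2)"
        using k1 by (intro mult_left_mono mult_right_mono \<rho>1 p) auto
      finally show "\<bar>f y\<bar> \<le> (\<bar>g\<bar> * kconst a * (norm (q - p))\<^sup>2 / snd p) * \<rho> p y"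
        by (simp add: mult_ac)
    qed (use p k1 in auto)
    also have "\<dots> \<le> C * M * (norm (q - p))\<^sup>2 / (snd p)\<^sup>2" by (rule fin[OF p]) auto
    finally show ?thesis .
  qed
  have lip: "norm (D q w - D p w) \<le> C * M * norm (q - p) * norm w / (snd p)\<^sup>2"
    if p: "snd p > 0" and q: "norm (q - p) \<le> snd p / 2" for p q w
  proof -
    note q0 = qpos[OF p q]
    define f where "f y = g * halfkernel1 a (q - (y, 0)) w - g * halfkernel1 a (p - (y, 0)) w" for y :: "real^'n"
    have "D q w - D p w = (\<integral>y. f y *\<^sub>R u y \<partial>lborel)"
      unfolding D_def f_def
      using intK1[OF p, of w] intK1[OF q0, of w]
      by (simp add: scaleR_diff_left)
    also have "norm \<dots> \<le> (\<bar>g\<bar> * kconst a * (norm w * norm (q - p)) / snd p) * M * (Z / snd p)"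
    proof (rule wi(2)[OF p])
      show "f \<in> borel_measurable borel"
        unfolding f_def by (intro borel_measurable_diff mK1 p q0)
      fix y
      have "\<bar>f y\<bar> = \<bar>g\<bar> * \<bar>halfkernel1 a (q - (y, 0)) w - halfkernel1 a (p - (y, 0)) w\<bar>"
        by (simp add: f_def abs_mult[symmetric] algebra_simps)
      also have "\<dots> \<le> \<bar>g\<bar> * (kconst a * norm (p - (y, 0)) powr (- 2 * a - 1) * norm w * norm ((q - (y, 0)) - (p - (y, 0))))"
        by (intro mult_left_mono halfkernel1_lipschitz a nz p close q) auto
      also have "\<dots> \<le> \<bar>g\<bar> * (kconst a * (\<rho> p y / snd p) * norm w * norm ((q - (y, 0)) - (p - (y, 0))))"
        using k1 by (intro mult_left_mono mult_right_mono \<rho>1 p) auto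
      finally show "\<bar>f y\<bar> \<le> (\<bar>g\<bar> * kconst a * (norm w * norm (q - p)) / snd p) * \<rho> p y"
        by (simp add: mult_ac)
    qed (use p k1 in auto)
    also have "\<dots> \<le> C * M * (norm w * norm (q - p)) / (snd p)\<^sup>2" by (rule fin[OF p]) auto
    finally show ?thesis by (simp add: mult_ac)
  qed
  have deriv: "(poisson_ext u has_derivative D p) (at p)" if p: "snd p > 0" for p
    unfolding has_derivative_at_alt
  proof (intro conjI allI impI)
    show "bounded_linear (D p)" using linD[OF p] by (simp add: linear_conv_bounded_linear)
    fix e :: real assume e: "e > 0"
    let ?A = "C * M / (snd p)\<^sup>2"
    have A: "?A \<ge> 0" using poisson_const_pos[where 'n='n] u(3) by (simp add: C_def)
    define d where "d = min (snd p / 2) (e / (?A + 1))"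
    have d: "d > 0" using p e A by (simp add: d_def)
    show "\<exists>d>0. \<forall>y. norm (y - p) < d \<longrightarrow> norm (poisson_ext u y - poisson_ext u p - D p (y - p)) \<le> e * norm (y - p)"
    proof (intro exI[of _ d] conjI allI impI d)
      fix y assume y: "norm (y - p) < d"
      then have "norm (y - p) \<le> e / (?A + 1)" by (simp add: d_def)
      then have "(?A + 1) * norm (y - p) \<le> e" using A by (simp add: field_simps pos_le_divide_eq)
      then have *: "?A * norm (y - p) \<le> e" by (simp add: distrib_right) (use norm_ge_zero[of "y - p"] in linarith)
      have "norm (poisson_ext u y - poisson_ext u p - D p (y - p)) \<le> C * M * (norm (y - p))\<^sup>2 / (snd p)\<^sup>2"
        using y by (intro taylor p) (simp add: d_def)
      also have "\<dots> = (?A * norm (y - p)) * norm (y - p)" by (simp add: power2_eq_square)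
      also have "\<dots> \<le> e * norm (y - p)" by (intro mult_right_mono *) auto
      finally show "norm (poisson_ext u y - poisson_ext u p - D p (y - p)) \<le> e * norm (y - p)" .
    qed
  qed
  have fd: "frechet_derivative (poisson_ext u) (at p) = D p" if "snd p > 0" for p
    using frechet_derivative_at[OF deriv[OF that]] by simp
  show ?thesis
    unfolding half_regular_def upper_half_def C_def[symmetric]
  proof (intro ballI conjI allI impI)
    fix p :: "(real^'n) \<times> real" assume "p \<in> {p. snd p > 0}"
    then have p: "snd p > 0" by simp
    show "poisson_ext u differentiable at p" using deriv[OF p] by (rule differentiableI)
    show "norm (poisson_ext u p) \<le> C * M" by (rule U_bound[OF p])
    show "norm (frechet_derivative (poisson_ext u) (at p) w) \<le> C * M * norm w / snd p" for w
      using D_bound[OF p] fd[OF p] by simp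
    fix q assume q: "norm (q - p) \<le> snd p / 2"
    show "norm (poisson_ext u q - poisson_ext u p - frechet_derivative (poisson_ext u) (at p) (q - p))
        \<le> C * M * (norm (q - p))\<^sup>2 / (snd p)\<^sup>2"
      using taylor[OF p q] fd[OF p] by simp
    show "norm (frechet_derivative (poisson_ext u) (at q) w - frechet_derivative (poisson_ext u) (at p) w)
        \<le> C * M * norm (q - p) * norm w / (snd p)\<^sup>2" for w
      using lip[OF p q] fd[OF p] fd[OF qpos[OF p q]] by simp
  qed
qed

section \<open>Rescaling to the unit scale\<close>

text \<open>Needed for Lebesgue measurable \<open>f\<close>, because a symmetric competitor
  \<open>h\<close> is no better. The substitution is made for the completed measure, whose
  nonnegative integrals agree with those of \<open>lborel\<close>.\<close>

lemma nn_integral_lborel_affine: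
  fixes t :: "'a::euclidean_space"
  assumes f: "f \<in> borel_measurable lebesgue" and c: "c \<noteq> 0"
  shows "(\<integral>\<^sup>+x. f x \<partial>lborel) = ennreal (\<bar>c\<bar> ^ DIM('a)) * (\<integral>\<^sup>+x. f (t + c *\<^sub>R x) \<partial>lborel)"
proof -
  have T: "(\<Sum>j\<in>Basis. (c * (x \<bullet> j)) *\<^sub>R j) = c *\<^sub>R x" for x :: 'a
    unfolding scaleR_scaleR[symmetric] scaleR_sum_right[symmetric] euclidean_representation ..
  have L: "lebesgue = density (distr lebesgue lebesgue (\<lambda>x::'a. t + c *\<^sub>R x)) (\<lambda>_. ennreal (\<bar>c\<bar> ^ DIM('a)))"
    using lebesgue_affine_euclidean[of "\<lambda>_. c" t] c by (simp add: T)
  have m: "(\<lambda>x::'a. t + c *\<^sub>R x) \<in> lebesgue \<rightarrow>\<^sub>M lebesgue"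
    using lebesgue_affine_measurable[of "\<lambda>_. c" t] c by (simp add: T)
  have fd: "f \<in> borel_measurable (distr lebesgue lebesgue (\<lambda>x. t + c *\<^sub>R x))"
    using f by simp
  have "(\<integral>\<^sup>+x. f x \<partial>lebesgue) = (\<integral>\<^sup>+x. ennreal (\<bar>c\<bar> ^ DIM('a)) * f x \<partial>distr lebesgue lebesgue (\<lambda>x. t + c *\<^sub>R x))"
    by (subst L, subst nn_integral_density) (use fd in auto)
  also have "\<dots> = ennreal (\<bar>c\<bar> ^ DIM('a)) * (\<integral>\<^sup>+x. f x \<partial>distr lebesgue lebesgue (\<lambda>x. t + c *\<^sub>R x))"
    by (rule nn_integral_cmult[OF fd])
  also have "(\<integral>\<^sup>+x. f x \<partial>distr lebesgue lebesgue (\<lambda>x. t + c *\<^sub>R x)) = (\<integral>\<^sup>+x. f (t + c *\<^sub>R x) \<partial>lebesgue)"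
    by (rule nn_integral_distr[OF m fd])
  finally show ?thesis by (simp add: nn_integral_completion)
qed

lemma open_upper_half: "open (upper_half :: ((real^'n) \<times> real) set)"
  unfolding upper_half_def by (intro open_Collect_less continuous_intros)

lemma open_half_ball: "open (half_ball x r)"
  unfolding half_ball_def by (intro open_Int open_ball open_upper_half)

lemma borel_half_ball [measurable]: "half_ball x r \<in> sets borel"
  using open_half_ball by (rule borel_open)

lemma half_ball_subset_upper_half: "half_ball x r \<subseteq> upper_half"
  by (auto simp: half_ball_def)

lemma half_ball_emeasure_finite: "emeasure lborel (half_ball x r) < \<infinity>"
proof -
  have "emeasure lborel (half_ball x r) \<le> emeasure lborel (ball (x, 0 :: real) r)"
    by (intro emeasure_mono) (auto simp: half_ball_def)
  then show ?thesis using emeasure_lborel_ball_finite[of "(x, 0::real)" r] by (rule le_less_trans)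
qed

lemma emeasure_half_ball: "emeasure lborel (half_ball x r) = ennreal (measure lborel (half_ball x r))"
  using half_ball_emeasure_finite[of x r] by (intro emeasure_eq_ennreal_measure) auto

lemma measure_half_ball_pos:
  assumes "r > 0"
  shows "measure lborel (half_ball x r) > 0"
proof -
  have "(x, r / 2) \<in> half_ball x r"
    using assms by (simp add: half_ball_def upper_half_def dist_prod_def)
  then have "\<not> negligible (half_ball x r)"
    using open_not_negligible[OF open_half_ball] by blast
  then have "emeasure lborel (half_ball x r) \<noteq> 0"
    using negligible_iff_null_sets null_sets_completionI borel_half_ball[of x r]
    by (metis null_setsI sets_lborel)
  then show ?thesis
    by (simp add: emeasure_half_ball zero_less_measure_iff)
qed

lemma half_ball_rescale:
  assumes "r > 0"
  shows "(x, 0) + r *\<^sub>R q \<in> half_ball x (R * r) \<longleftrightarrow> q \<in> half_ball 0 R"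
proof -
  have "dist (x, 0) ((x, 0) + r *\<^sub>R q) = r * dist (0, 0) q"
    using assms by (simp add: dist_norm zero_prod_def[symmetric])
  then show ?thesis
    using assms by (simp add: half_ball_def upper_half_def zero_less_mult_iff mult.commute)
qed

lemma measure_half_ball_rescale:
  fixes x :: "real^'n"
  assumes r: "r > 0"
  shows "measure lborel (half_ball x (R * r)) = r ^ (CARD('n) + 1) * measure lborel (half_ball (0::real^'n) R)"
proof -
  have "emeasure lborel (half_ball x (R * r)) = (\<integral>\<^sup>+p. indicator (half_ball x (R * r)) p \<partial>lborel)" by simp
  also have "\<dots> = ennreal (\<bar>r\<bar> ^ DIM((real^'n) \<times> real)) * (\<integral>\<^sup>+q. indicator (half_ball x (R * r)) ((x, 0) + r *\<^sub>R q) \<partial>lborel)"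
    using r borel_half_ball[of x "R * r"] by (intro nn_integral_lborel_affine borel_measurable_indicator) auto
  also have "(\<lambda>q. indicator (half_ball x (R * r)) ((x, 0) + r *\<^sub>R q)) = (indicator (half_ball 0 R) :: _ \<Rightarrow> ennreal)"
    by (rule ext) (simp only: indicator_def half_ball_rescale[OF r])
  finally have "ennreal (measure lborel (half_ball x (R * r)))
      = ennreal (r ^ (CARD('n) + 1)) * ennreal (measure lborel (half_ball (0::real^'n) R))"
    using r by (simp add: emeasure_half_ball)
  then show ?thesis using r by (simp add: ennreal_mult'[symmetric])
qed

text \<open>\<open>F\<close> is controlled on the open half space and \<open>h\<close> on the closed
  one, so each is cut off by its own indicator. Both cutoffs equal 1 on the half ball.\<close>

lemma sq_dist_measurable:
  fixes F :: "(real^'n) \<times> real \<Rightarrow> real^'d"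
  assumes F: "continuous_on upper_half F" and h: "set_borel_measurable lebesgue closed_upper_half h"
  shows "(\<lambda>q. ennreal ((norm (F q - h q))\<^sup>2) * indicator (half_ball x R) q) \<in> borel_measurable lebesgue"
proof -
  have "(\<lambda>q. indicator upper_half q *\<^sub>R F q) \<in> borel_measurable borel"
    by (intro borel_measurable_continuous_on_indicator borel_open open_upper_half F)
  then have "(\<lambda>q. indicator upper_half q *\<^sub>R F q) \<in> borel_measurable lebesgue"
    using measurable_completion[of _ lborel] by simp
  moreover have "(\<lambda>q. indicator closed_upper_half q *\<^sub>R h q) \<in> borel_measurable lebesgue"
    using h by (simp add: set_borel_measurable_def)
  moreover have "half_ball x R \<in> sets lebesgue" using borel_half_ball[of x R] by simp
  ultimately have "(\<lambda>q. ennreal ((norm (indicator upper_half q *\<^sub>R F q - indicator closed_upper_half q *\<^sub>R h q))\<^sup>2)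
      * indicator (half_ball x R) q) \<in> borel_measurable lebesgue"
    by measurable
  also have "(\<lambda>q. ennreal ((norm (indicator upper_half q *\<^sub>R F q - indicator closed_upper_half q *\<^sub>R h q))\<^sup>2)
      * indicator (half_ball x R) q) = (\<lambda>q. ennreal ((norm (F q - h q))\<^sup>2) * indicator (half_ball x R) q)"
    by (auto simp: indicator_def half_ball_def upper_half_def closed_upper_half_def fun_eq_iff)
  finally show ?thesis .
qed

lemma rescale_in_upper_half:
  "r > 0 \<Longrightarrow> (x, 0) + r *\<^sub>R q \<in> upper_half \<longleftrightarrow> q \<in> upper_half"
  by (simp add: upper_half_def zero_less_mult_iff)

text \<open>The same \<open>h\<close> serves at both scales because it is 0-homogeneous. The
  Jacobian cancels against the normalising volume, leaving the fixed volume of the half ball of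
  radius 8.\<close>

lemma boundary_eps_symmetric_rescale:
  fixes U :: "(real^'n) \<times> real \<Rightarrow> real^'d"
  assumes U: "continuous_on upper_half U" and r: "r > 0" and \<epsilon>: "\<epsilon> \<ge> 0"
  shows "boundary_eps_symmetric k \<epsilon> U x (8 * r) \<longleftrightarrow>
    (\<exists>h. boundary_symmetric k h \<and>
      (\<integral>\<^sup>+q\<in>half_ball 0 8. ennreal ((norm (U ((x, 0) + r *\<^sub>R q) - h q))\<^sup>2) \<partial>lborel)
        \<le> ennreal (\<epsilon> * measure lborel (half_ball (0::real^'n) 8)))"
proof -
  let ?n = "CARD('n) + 1" and ?m = "measure lborel (half_ball (0::real^'n) 8)"
  have m: "?m > 0" by (rule measure_half_ball_pos) simp
  have F: "continuous_on upper_half (\<lambda>q. U ((x, 0) + r *\<^sub>R q))"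
    by (rule continuous_on_compose2[OF U]) (use r in \<open>auto intro!: continuous_intros simp: upper_half_def\<close>)
  have "ennreal (1 / measure lborel (half_ball x (8 * r))) *
          (\<integral>\<^sup>+ p\<in>half_ball x (8 * r). ennreal (norm (U p - h (p - (x, 0))) ^ 2) \<partial>lborel) \<le> ennreal \<epsilon>
     \<longleftrightarrow> (\<integral>\<^sup>+q\<in>half_ball 0 8. ennreal ((norm (U ((x, 0) + r *\<^sub>R q) - h q))\<^sup>2) \<partial>lborel) \<le> ennreal (\<epsilon> * ?m)"
    if h: "boundary_symmetric k h" for h
  proof -
    let ?I = "(\<integral>\<^sup>+q\<in>half_ball 0 8. ennreal ((norm (U ((x, 0) + r *\<^sub>R q) - h q))\<^sup>2) \<partial>lborel)"
    let ?J = "(\<integral>\<^sup>+ p\<in>half_ball x (8 * r). ennreal (norm (U p - h (p - (x, 0))) ^ 2) \<partial>lborel)"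
    define G where "G q = ennreal ((norm (U ((x, 0) + r *\<^sub>R q) - h q))\<^sup>2) * indicator (half_ball 0 8) q" for q
    have G: "G \<in> borel_measurable lebesgue"
      unfolding G_def using h by (intro sq_dist_measurable F) (simp add: boundary_symmetric_def)
    have "?I = (\<integral>\<^sup>+q. G q \<partial>lborel)" by (simp add: G_def)
    also have "\<dots> = ennreal (\<bar>1 / r\<bar> ^ DIM((real^'n) \<times> real)) * (\<integral>\<^sup>+p. G (- ((1 / r) *\<^sub>R (x, 0)) + (1 / r) *\<^sub>R p) \<partial>lborel)"
      using r by (intro nn_integral_lborel_affine G) auto
    also have "(\<integral>\<^sup>+p. G (- ((1 / r) *\<^sub>R (x, 0)) + (1 / r) *\<^sub>R p) \<partial>lborel) = ?J"
    proof (rule nn_integral_cong)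
      fix p :: "(real^'n) \<times> real"
      define q where "q = - ((1 / r) *\<^sub>R (x, 0)) + (1 / r) *\<^sub>R p"
      have pq: "p = (x, 0) + r *\<^sub>R q" using r by (simp add: q_def algebra_simps zero_prod_def)
      have "G q = ennreal (norm (U ((x, 0) + r *\<^sub>R q) - h (((x, 0) + r *\<^sub>R q) - (x, 0))) ^ 2)
          * indicator (half_ball x (8 * r)) ((x, 0) + r *\<^sub>R q)"
      proof (cases "q \<in> half_ball 0 8")
        case True
        then have "q \<in> closed_upper_half" by (simp add: half_ball_def upper_half_def closed_upper_half_def)
        then have "h (r *\<^sub>R q) = h q" using h r by (simp add: boundary_symmetric_def)
        then show ?thesis
          using True half_ball_rescale[OF r, of x q 8] by (simp add: G_def)
      next
        case False
        then show ?thesis using half_ball_rescale[OF r, of x q 8] by (simp add: G_def)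
      qed
      then show "G (- ((1 / r) *\<^sub>R (x, 0)) + (1 / r) *\<^sub>R p)
          = ennreal (norm (U p - h (p - (x, 0))) ^ 2) * indicator (half_ball x (8 * r)) p"
        unfolding pq[symmetric] unfolding q_def .
    qed
    finally have IJ: "?I = ennreal ((1 / r) ^ ?n) * ?J" using r by simp
    have "ennreal (1 / measure lborel (half_ball x (8 * r))) * ?J = ennreal (1 / ?m) * ?I"
      unfolding IJ mult.assoc[symmetric] measure_half_ball_rescale[OF r] using r m
      by (subst ennreal_mult[symmetric]) (auto simp: power_divide mult.commute)
    moreover have "ennreal (1 / ?m) * ?I \<le> ennreal \<epsilon> \<longleftrightarrow> ?I \<le> ennreal (\<epsilon> * ?m)"
    proof
      assume "ennreal (1 / ?m) * ?I \<le> ennreal \<epsilon>"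
      then have "ennreal ?m * (ennreal (1 / ?m) * ?I) \<le> ennreal ?m * ennreal \<epsilon>" by (rule mult_left_mono) simp
      then show "?I \<le> ennreal (\<epsilon> * ?m)"
        using m \<epsilon> by (simp add: mult.assoc[symmetric] ennreal_mult[symmetric] mult.commute)
    next
      assume "?I \<le> ennreal (\<epsilon> * ?m)"
      then have "ennreal (1 / ?m) * ?I \<le> ennreal (1 / ?m) * ennreal (\<epsilon> * ?m)" by (rule mult_left_mono) simp
      then show "ennreal (1 / ?m) * ?I \<le> ennreal \<epsilon>"
        using m \<epsilon> by (simp add: ennreal_mult[symmetric])
    qed
    ultimately show ?thesis by simp
  qed
  then show ?thesis unfolding boundary_eps_symmetric_def by auto
qed

lemma half_regularD:
  assumes "half_regular M F" "p \<in> upper_half"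
  shows "F differentiable at p" "norm (F p) \<le> M"
    "\<And>w. norm (frechet_derivative F (at p) w) \<le> M * norm w / snd p"
    "\<And>q. norm (q - p) \<le> snd p / 2 \<Longrightarrow>
       norm (F q - F p - frechet_derivative F (at p) (q - p)) \<le> M * (norm (q - p))\<^sup>2 / (snd p)\<^sup>2"
    "\<And>q w. norm (q - p) \<le> snd p / 2 \<Longrightarrow>
       norm (frechet_derivative F (at q) w - frechet_derivative F (at p) w)
         \<le> M * norm (q - p) * norm w / (snd p)\<^sup>2"
  using assms by (auto simp: half_regular_def)

lemma half_regular_continuous_on: "half_regular M F \<Longrightarrow> continuous_on upper_half F"
  by (meson continuous_at_imp_continuous_on differentiable_imp_continuous_within half_regularD(1))

lemma half_regular_linear:
  "half_regular M F \<Longrightarrow> p \<in> upper_half \<Longrightarrow> linear (frechet_derivative F (at p))"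
  using half_regularD(1) linear_frechet_derivative by blast

lemma frechet_derivative_rescale:
  fixes F :: "(real^'n) \<times> real \<Rightarrow> real^'d"
  assumes F: "half_regular M F" and r: "r > 0" and q: "q \<in> upper_half"
  shows "((\<lambda>q. F ((x, 0) + r *\<^sub>R q)) has_derivative (\<lambda>w. frechet_derivative F (at ((x, 0) + r *\<^sub>R q)) (r *\<^sub>R w))) (at q)"
    and "frechet_derivative (\<lambda>q. F ((x, 0) + r *\<^sub>R q)) (at q)
       = (\<lambda>w. r *\<^sub>R frechet_derivative F (at ((x, 0) + r *\<^sub>R q)) w)"
proof -
  have q': "(x, 0) + r *\<^sub>R q \<in> upper_half" using q r by (simp add: rescale_in_upper_half)
  have "(F has_derivative frechet_derivative F (at ((x, 0) + r *\<^sub>R q))) (at ((x, 0) + r *\<^sub>R q))"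
    using half_regularD(1)[OF F q'] by (simp add: frechet_derivative_works)
  moreover have "((\<lambda>q. (x, 0) + r *\<^sub>R q) has_derivative (\<lambda>w. r *\<^sub>R w)) (at q)"
    by (auto intro!: derivative_eq_intros)
  ultimately show d: "((\<lambda>q. F ((x, 0) + r *\<^sub>R q)) has_derivative (\<lambda>w. frechet_derivative F (at ((x, 0) + r *\<^sub>R q)) (r *\<^sub>R w))) (at q)"
    by (rule has_derivative_compose[rotated])
  show "frechet_derivative (\<lambda>q. F ((x, 0) + r *\<^sub>R q)) (at q)
       = (\<lambda>w. r *\<^sub>R frechet_derivative F (at ((x, 0) + r *\<^sub>R q)) w)"
    using frechet_derivative_at[OF d] linear_scale[OF half_regular_linear[OF F q']] by (simp add: fun_eq_iff)
qed

lemma half_regular_rescale: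
  fixes F :: "(real^'n) \<times> real \<Rightarrow> real^'d"
  assumes F: "half_regular M F" and r: "r > 0"
  shows "half_regular M (\<lambda>q. F ((x, 0) + r *\<^sub>R q))"
  unfolding half_regular_def
proof (intro ballI conjI allI impI)
  fix p :: "(real^'n) \<times> real" assume p: "p \<in> upper_half"
  let ?T = "\<lambda>q. (x, 0) + r *\<^sub>R q"
  have p': "?T p \<in> upper_half" using p r by (simp add: rescale_in_upper_half)
  have z: "snd p > 0" "snd (?T p) = r * snd p" using p by (auto simp: upper_half_def)
  note D = half_regularD[OF F p']
  note fd = frechet_derivative_rescale(2)[OF F r, of _ x]
  show "(\<lambda>q. F (?T q)) differentiable at p"
    using frechet_derivative_rescale(1)[OF F r p] by (rule differentiableI)
  show "norm (F (?T p)) \<le> M" by (rule D(2))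
  show "norm (frechet_derivative (\<lambda>q. F (?T q)) (at p) w) \<le> M * norm w / snd p" for w
  proof -
    have "norm (frechet_derivative (\<lambda>q. F (?T q)) (at p) w) = r * norm (frechet_derivative F (at (?T p)) w)"
      unfolding fd[OF p] using r by simp
    also have "\<dots> \<le> r * (M * norm w / snd (?T p))"
      using r by (intro mult_left_mono D(3)) auto
    also have "\<dots> = M * norm w / snd p" using r z by simp
    finally show ?thesis .
  qed
  fix q assume q: "norm (q - p) \<le> snd p / 2"
  have "snd q > 0" using abs_snd_le_norm[of "q - p"] q z by simp
  then have qu: "q \<in> upper_half" by (simp add: upper_half_def)
  have Tq: "?T q - ?T p = r *\<^sub>R (q - p)" by (simp add: algebra_simps)
  then have nT: "norm (?T q - ?T p) = r * norm (q - p)" using r by simp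
  then have q': "norm (?T q - ?T p) \<le> snd (?T p) / 2" using q r z by simp
  have "norm (F (?T q) - F (?T p) - frechet_derivative F (at (?T p)) (?T q - ?T p))
      \<le> M * (r * norm (q - p))\<^sup>2 / (r * snd p)\<^sup>2"
    using D(4)[OF q'] unfolding nT z(2) .
  also have "frechet_derivative F (at (?T p)) (?T q - ?T p) = frechet_derivative (\<lambda>q. F (?T q)) (at p) (q - p)"
    unfolding Tq fd[OF p] by (rule linear_scale[OF half_regular_linear[OF F p']])
  finally show "norm (F (?T q) - F (?T p) - frechet_derivative (\<lambda>q. F (?T q)) (at p) (q - p))
      \<le> M * (norm (q - p))\<^sup>2 / (snd p)\<^sup>2"
    using r by (simp add: power_mult_distrib)
  show "norm (frechet_derivative (\<lambda>q. F (?T q)) (at q) w - frechet_derivative (\<lambda>q. F (?T q)) (at p) w)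
      \<le> M * norm (q - p) * norm w / (snd p)\<^sup>2" for w
  proof -
    have "norm (frechet_derivative (\<lambda>q. F (?T q)) (at q) w - frechet_derivative (\<lambda>q. F (?T q)) (at p) w)
        = r * norm (frechet_derivative F (at (?T q)) w - frechet_derivative F (at (?T p)) w)"
      unfolding fd[OF p] fd[OF qu] scaleR_diff_right[symmetric] using r by simp
    also have "\<dots> \<le> r * (M * (r * norm (q - p)) * norm w / (r * snd p)\<^sup>2)"
      using D(5)[OF q', of w] r unfolding nT z(2) by (intro mult_left_mono) auto
    also have "\<dots> = M * norm (q - p) * norm w / (snd p)\<^sup>2"
      using r by (simp add: power_mult_distrib power2_eq_square)
    finally show ?thesis .
  qed
qed

section \<open>Compactness\<close>

lemma half_regular_nonneg:
  fixes F :: "(real^'n) \<times> real \<Rightarrow> real^'d"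
  assumes "half_regular M F"
  shows "M \<ge> 0"
  using order_trans[OF norm_ge_zero half_regularD(2)[OF assms, of "(0, 1)"]]
  by (simp add: upper_half_def)

lemma half_regular_lipschitz:
  fixes F :: "(real^'n) \<times> real \<Rightarrow> real^'d"
  assumes F: "half_regular M F" and p: "p \<in> upper_half" and q: "norm (q - p) \<le> snd p / 2"
  shows "norm (F q - F p) \<le> 2 * M * norm (q - p) / snd p"
proof -
  have z: "snd p > 0" using p by (simp add: upper_half_def)
  have M: "M \<ge> 0" using F by (rule half_regular_nonneg)
  have "norm (F q - F p) \<le> norm (F q - F p - frechet_derivative F (at p) (q - p)) + norm (frechet_derivative F (at p) (q - p))"
    using norm_triangle_ineq[of "F q - F p - frechet_derivative F (at p) (q - p)" "frechet_derivative F (at p) (q - p)"] by simp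
  also have "\<dots> \<le> M * (norm (q - p))\<^sup>2 / (snd p)\<^sup>2 + M * norm (q - p) / snd p"
    by (intro add_mono half_regularD[OF F p] q)
  also have "M * (norm (q - p))\<^sup>2 / (snd p)\<^sup>2 = (M * norm (q - p) / snd p) * (norm (q - p) / snd p)"
    by (simp add: power2_eq_square)
  also have "\<dots> \<le> (M * norm (q - p) / snd p) * 1"
    using q z M by (intro mult_left_mono) (auto simp: divide_simps)
  finally show ?thesis by simp
qed

text \<open>Arzela-Ascoli in pointwise form: a diagonal subsequence converges on a countable dense
  set, and the local Lipschitz bound, uniform in \<open>i\<close>, carries the Cauchy property to
  every point.\<close>

lemma half_regular_convergent_subsequence:
  fixes F :: "nat \<Rightarrow> (real^'n) \<times> real \<Rightarrow> real^'d"
  assumes F: "\<And>i. half_regular M (F i)"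
  obtains s U where "strict_mono (s :: nat \<Rightarrow> nat)" "\<And>p. p \<in> upper_half \<Longrightarrow> (\<lambda>i. F (s i) p) \<longlonglongrightarrow> U p"
proof -
  have M: "M \<ge> 0" using F by (rule half_regular_nonneg)
  obtain R :: "((real^'n) \<times> real) set" where R: "countable R" "R \<subseteq> upper_half" "upper_half \<subseteq> closure R"
    using separable by blast
  obtain s :: "nat \<Rightarrow> nat" where s: "strict_mono s" and conv: "\<And>p. p \<in> R \<Longrightarrow> \<exists>l. (\<lambda>i. F (s i) p) \<longlonglongrightarrow> l"
    using function_convergent_subsequence[OF R(1), of F M] half_regularD(2)[OF F] R(2) by (metis subsetD)
  have "convergent (\<lambda>i. F (s i) p)" if p: "p \<in> upper_half" for p
  proof (rule Cauchy_convergent, rule metric_CauchyI)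
    fix e :: real assume e: "e > 0"
    have z: "snd p > 0" using p by (simp add: upper_half_def)
    \<comment> \<open>The first entry keeps \<open>q\<close> in the range of the Lipschitz bound,
      the second makes the oscillation at most \<open>e / 4\<close>; \<open>M + 1\<close> covers the
      case \<open>M = 0\<close>.\<close>
    define d where "d = min (snd p / 2) (e * snd p / (8 * (M + 1)))"
    have d: "d > 0" using z e M by (simp add: d_def)
    obtain q where q: "q \<in> R" "dist q p < d"
      using R(3) p d by (metis closure_approachable subsetD)
    have qp: "norm (q - p) \<le> snd p / 2" "norm (q - p) \<le> e * snd p / (8 * (M + 1))"
      using q(2) by (auto simp: d_def dist_norm)
    have close: "dist (F i q) (F i p) \<le> e / 4" for i
    proof -
      have "dist (F i q) (F i p) \<le> 2 * M * norm (q - p) / snd p"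
        using half_regular_lipschitz[OF F p qp(1)] by (simp add: dist_norm)
      also have "\<dots> \<le> 2 * M * (e * snd p / (8 * (M + 1))) / snd p"
        using M z by (intro divide_right_mono mult_left_mono qp) auto
      also have "\<dots> = 2 * M * (e / (8 * (M + 1)))" using z by simp
      also have "\<dots> = (M / (M + 1)) * (e / 4)" using M by (simp add: divide_simps)
      also have "\<dots> \<le> 1 * (e / 4)" using M e by (intro mult_right_mono) auto
      finally show ?thesis by simp
    qed
    have "Cauchy (\<lambda>i. F (s i) q)" using conv[OF q(1)] convergentI convergent_Cauchy by blast
    then obtain N where N: "\<And>m n. m \<ge> N \<Longrightarrow> n \<ge> N \<Longrightarrow> dist (F (s m) q) (F (s n) q) < e / 4"
      using e by (metis metric_CauchyD zero_less_divide_iff zero_less_numeral)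
    show "\<exists>N. \<forall>m\<ge>N. \<forall>n\<ge>N. dist (F (s m) p) (F (s n) p) < e"
    proof (intro exI[of _ N] allI impI)
      fix m n assume "m \<ge> N" "n \<ge> N"
      then show "dist (F (s m) p) (F (s n) p) < e"
        using N[of m n] close[of "s m"] close[of "s n"] e
          dist_triangle[of "F (s m) p" "F (s n) p" "F (s m) q"] dist_triangle[of "F (s m) q" "F (s n) p" "F (s n) q"]
        by (simp add: dist_commute)
    qed
  qed
  then have "\<And>p. p \<in> upper_half \<Longrightarrow> (\<lambda>i. F (s i) p) \<longlonglongrightarrow> lim (\<lambda>i. F (s i) p)"
    by (simp add: convergent_LIMSEQ_iff)
  then show ?thesis by (rule that[OF s])
qed

lemma ball_le_nn_integral_sq:
  fixes g :: "'a::euclidean_space \<Rightarrow> 'b::real_normed_vector"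
  assumes "ball p \<rho> \<subseteq> S" and g: "\<And>q. q \<in> ball p \<rho> \<Longrightarrow> norm (g q) \<ge> \<eta>" and "\<eta> \<ge> 0"
  shows "ennreal (\<eta>\<^sup>2 * measure lborel (ball p \<rho>)) \<le> (\<integral>\<^sup>+q\<in>S. ennreal ((norm (g q))\<^sup>2) \<partial>lborel)"
proof -
  have "ennreal (\<eta>\<^sup>2 * measure lborel (ball p \<rho>)) = ennreal (\<eta>\<^sup>2) * emeasure lborel (ball p \<rho>)"
    using emeasure_lborel_ball_finite[of p \<rho>] by (simp add: ennreal_mult emeasure_eq_ennreal_measure)
  also have "\<dots> = (\<integral>\<^sup>+q. ennreal (\<eta>\<^sup>2) * indicator (ball p \<rho>) q \<partial>lborel)"
    by (subst nn_integral_cmult_indicator) auto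
  also have "\<dots> \<le> (\<integral>\<^sup>+q\<in>S. ennreal ((norm (g q))\<^sup>2) \<partial>lborel)"
    using assms by (intro nn_integral_mono) (auto simp: indicator_def subset_iff intro!: ennreal_leI power_mono)
  finally show ?thesis .
qed

lemma nn_integral_sq_eq_0_imp:
  fixes g :: "'a::euclidean_space \<Rightarrow> 'b::real_normed_vector"
  assumes S: "open S" and g: "continuous_on S g" and 0: "(\<integral>\<^sup>+q\<in>S. ennreal ((norm (g q))\<^sup>2) \<partial>lborel) = 0"
    and p: "p \<in> S"
  shows "g p = 0"
proof (rule ccontr)
  assume "g p \<noteq> 0"
  define \<eta> where "\<eta> = norm (g p) / 2"
  have \<eta>: "\<eta> > 0" using \<open>g p \<noteq> 0\<close> by (simp add: \<eta>_def)
  obtain d where d: "d > 0" "\<And>q. q \<in> S \<Longrightarrow> dist q p < d \<Longrightarrow> dist (g q) (g p) < \<eta>"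
    using g p \<eta> unfolding continuous_on_iff by meson
  obtain d' where d': "d' > 0" "ball p d' \<subseteq> S" using S p by (meson openE)
  define \<rho> where "\<rho> = min d d'"
  have \<rho>: "\<rho> > 0" "ball p \<rho> \<subseteq> S" using d d' by (auto simp: \<rho>_def)
  have "norm (g q) \<ge> \<eta>" if "q \<in> ball p \<rho>" for q
  proof -
    have "dist (g q) (g p) < \<eta>" using that \<rho>(2) by (intro d) (auto simp: \<rho>_def dist_commute)
    then show ?thesis using norm_triangle_ineq2[of "g p" "g q"] by (simp add: \<eta>_def dist_norm norm_minus_commute)
  qed
  from ball_le_nn_integral_sq[OF \<rho>(2), of \<eta> g, OF this] 0 \<eta>
  have "\<eta>\<^sup>2 * measure lborel (ball p \<rho>) \<le> 0" by (simp add: ennreal_eq_0_iff)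
  moreover have "\<eta>\<^sup>2 * measure lborel (ball p \<rho>) > 0" using \<eta> content_ball_pos[OF \<rho>(1), of p] by simp
  ultimately show False by linarith
qed

section \<open>Properties inherited by the pointwise limit\<close>

lemma limit_lipschitz:
  fixes F :: "nat \<Rightarrow> (real^'n) \<times> real \<Rightarrow> real^'d"
  assumes F: "\<And>i. half_regular M (F i)" and U: "\<And>p. p \<in> upper_half \<Longrightarrow> (\<lambda>i. F i p) \<longlonglongrightarrow> U p"
    and p: "p \<in> upper_half" and q: "norm (q - p) \<le> snd p / 2"
  shows "norm (U q - U p) \<le> 2 * M * norm (q - p) / snd p"
proof -
  have "q \<in> upper_half"
    using abs_snd_le_norm[of "q - p"] p q by (simp add: upper_half_def)
  then have "(\<lambda>i. norm (F i q - F i p)) \<longlonglongrightarrow> norm (U q - U p)"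
    by (intro tendsto_intros U p)
  then show ?thesis
    by (rule LIMSEQ_le_const2) (use half_regular_lipschitz[OF F p q] in auto)
qed

lemma limit_continuous_on:
  fixes F :: "nat \<Rightarrow> (real^'n) \<times> real \<Rightarrow> real^'d"
  assumes F: "\<And>i. half_regular M (F i)" and U: "\<And>p. p \<in> upper_half \<Longrightarrow> (\<lambda>i. F i p) \<longlonglongrightarrow> U p"
  shows "continuous_on upper_half U"
proof (rule continuous_at_imp_continuous_on, rule ballI)
  fix p :: "(real^'n) \<times> real" assume p: "p \<in> upper_half"
  have z: "snd p > 0" using p by (simp add: upper_half_def)
  have "((\<lambda>q. U q - U p) \<longlongrightarrow> 0) (at p)"
  proof (rule Lim_null_comparison)
    have "eventually (\<lambda>q. dist q p < snd p / 2) (at p)"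
      using z by (auto simp: eventually_at intro!: exI[of _ "snd p / 2"])
    then show "eventually (\<lambda>q. norm (U q - U p) \<le> 2 * M * norm (q - p) / snd p) (at p)"
      by eventually_elim (rule limit_lipschitz[OF F U p], auto simp: dist_norm)
    have "((\<lambda>q. 2 * M * norm (q - p) / snd p) \<longlongrightarrow> 2 * M * norm (p - p) / snd p) (at p)"
      using z by (intro tendsto_intros) auto
    then show "((\<lambda>q. 2 * M * norm (q - p) / snd p) \<longlongrightarrow> 0) (at p)" by simp
  qed
  then show "isCont U p" by (simp add: isCont_def LIM_zero_iff)
qed

text \<open>Dominated convergence: members and limit are bounded by \<open>M\<close> up to the flat
  boundary, and the half ball has finite volume, so the degeneration of the Lipschitz bounds does no
  harm.\<close>

lemma limit_L2:
  fixes F :: "nat \<Rightarrow> (real^'n) \<times> real \<Rightarrow> real^'d"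
  assumes F: "\<And>i. half_regular M (F i)" and U: "\<And>p. p \<in> upper_half \<Longrightarrow> (\<lambda>i. F i p) \<longlonglongrightarrow> U p"
  shows "(\<lambda>i. \<integral>\<^sup>+q\<in>half_ball 0 8. ennreal ((norm (F i q - U q))\<^sup>2) \<partial>lborel) \<longlonglongrightarrow> 0"
proof -
  have M: "M \<ge> 0" using F by (rule half_regular_nonneg)
  have Ub: "norm (U p) \<le> M" if "p \<in> upper_half" for p
    by (rule LIMSEQ_le_const2[OF tendsto_norm[OF U[OF that]]]) (use half_regularD(2)[OF F that] in auto)
  have cU: "continuous_on upper_half U" using F U by (rule limit_continuous_on)
  have meas: "(\<lambda>q. ennreal ((norm (F i q - U q))\<^sup>2) * indicator (half_ball 0 8) q) \<in> borel_measurable borel" for i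
  proof -
    have "(\<lambda>q. indicator (half_ball 0 8) q *\<^sub>R (F i q - U q)) \<in> borel_measurable borel"
      by (intro borel_measurable_continuous_on_indicator borel_half_ball
          continuous_on_diff continuous_on_subset[OF half_regular_continuous_on[OF F]]
          continuous_on_subset[OF cU] half_ball_subset_upper_half)
    then have "(\<lambda>q. ennreal ((norm (indicator (half_ball 0 8) q *\<^sub>R (F i q - U q)))\<^sup>2)) \<in> borel_measurable borel"
      by measurable
    also have "(\<lambda>q. ennreal ((norm (indicator (half_ball 0 8) q *\<^sub>R (F i q - U q)))\<^sup>2))
        = (\<lambda>q. ennreal ((norm (F i q - U q))\<^sup>2) * indicator (half_ball 0 8) q)"
      by (auto simp: indicator_def fun_eq_iff)
    finally show ?thesis .
  qed
  have "(\<lambda>i. \<integral>\<^sup>+q\<in>half_ball 0 8. ennreal ((norm (F i q - U q))\<^sup>2) \<partial>lborel)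
      \<longlonglongrightarrow> (\<integral>\<^sup>+q. 0 \<partial>(lborel :: ((real^'n) \<times> real) measure))"
  proof (rule nn_integral_dominated_convergence[where w = "\<lambda>q. ennreal ((2 * M)\<^sup>2) * indicator (half_ball 0 8) q"])
    show "AE q in lborel. ennreal ((norm (F i q - U q))\<^sup>2) * indicator (half_ball 0 8) q
        \<le> ennreal ((2 * M)\<^sup>2) * indicator (half_ball 0 8) q" for i
    proof (rule AE_I2)
      fix q :: "(real^'n) \<times> real"
      show "ennreal ((norm (F i q - U q))\<^sup>2) * indicator (half_ball 0 8) q
        \<le> ennreal ((2 * M)\<^sup>2) * indicator (half_ball 0 8) q"
      proof (cases "q \<in> half_ball 0 8")
        case True
        then have q: "q \<in> upper_half" using half_ball_subset_upper_half by blast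
        have "norm (F i q - U q) \<le> 2 * M"
          using norm_triangle_ineq4[of "F i q" "U q"] half_regularD(2)[OF F q, of i] Ub[OF q] by linarith
        then have "(norm (F i q - U q))\<^sup>2 \<le> (2 * M)\<^sup>2" by (intro power_mono) auto
        from ennreal_leI[OF this] show ?thesis using True by simp
      qed simp
    qed
    show "(\<integral>\<^sup>+q. ennreal ((2 * M)\<^sup>2) * indicator (half_ball 0 8) q \<partial>(lborel :: ((real^'n) \<times> real) measure)) < \<infinity>"
      by (subst nn_integral_cmult_indicator) (auto simp: emeasure_half_ball ennreal_mult_less_top)
    show "AE q in (lborel :: ((real^'n) \<times> real) measure).
        (\<lambda>i. ennreal ((norm (F i q - U q))\<^sup>2) * indicator (half_ball 0 8) q) \<longlonglongrightarrow> 0"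
    proof (rule AE_I2)
      fix q :: "(real^'n) \<times> real"
      show "(\<lambda>i. ennreal ((norm (F i q - U q))\<^sup>2) * indicator (half_ball 0 8) q) \<longlonglongrightarrow> 0"
      proof (cases "q \<in> half_ball 0 8")
        case True
        then have q: "q \<in> upper_half" using half_ball_subset_upper_half by blast
        have "(\<lambda>i. ennreal ((norm (F i q - U q))\<^sup>2)) \<longlonglongrightarrow> ennreal ((norm (U q - U q))\<^sup>2)"
          by (intro tendsto_ennrealI tendsto_intros U q)
        then show ?thesis using True by simp
      qed simp
    qed
  qed (use meas in auto)
  then show ?thesis by simp
qed

lemma nn_integral_le_double_sum:
  fixes f g e :: "'a::euclidean_space \<Rightarrow> ennreal"
  assumes f: "f \<in> borel_measurable lebesgue" and g: "g \<in> borel_measurable lebesgue"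
    and e: "\<And>x. e x \<le> 2 * f x + 2 * g x"
  shows "(\<integral>\<^sup>+x. e x \<partial>lborel) \<le> 2 * (\<integral>\<^sup>+x. f x \<partial>lborel) + 2 * (\<integral>\<^sup>+x. g x \<partial>lborel)"
proof -
  have "(\<integral>\<^sup>+x. e x \<partial>lebesgue) \<le> (\<integral>\<^sup>+x. 2 * f x + 2 * g x \<partial>lebesgue)"
    by (intro nn_integral_mono e)
  also have "\<dots> = 2 * (\<integral>\<^sup>+x. f x \<partial>lebesgue) + 2 * (\<integral>\<^sup>+x. g x \<partial>lebesgue)"
    using f g by (simp add: nn_integral_add nn_integral_cmult)
  finally show ?thesis by (simp add: nn_integral_completion)
qed

lemma norm_diff_sq_le:
  fixes a b c :: "'a::real_normed_vector"
  shows "ennreal ((norm (a - b))\<^sup>2) \<le> 2 * ennreal ((norm (c - a))\<^sup>2) + 2 * ennreal ((norm (c - b))\<^sup>2)"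
proof -
  have "norm (a - b) \<le> norm (c - a) + norm (c - b)"
    using norm_triangle_ineq4[of "c - b" "c - a"] by simp
  then have "(norm (a - b))\<^sup>2 \<le> (norm (c - a) + norm (c - b))\<^sup>2"
    by (intro power_mono) auto
  also have "\<dots> \<le> 2 * (norm (c - a))\<^sup>2 + 2 * (norm (c - b))\<^sup>2"
    using sum_squares_bound[of "norm (c - a)" "norm (c - b)"] by (simp add: power2_sum)
  finally have "ennreal ((norm (a - b))\<^sup>2) \<le> ennreal (2 * (norm (c - a))\<^sup>2 + 2 * (norm (c - b))\<^sup>2)"
    by (rule ennreal_leI)
  then show ?thesis by (simp add: ennreal_plus ennreal_mult)
qed

lemma set_borel_measurable_upper_half:
  fixes U :: "(real^'n) \<times> real \<Rightarrow> real^'d"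
  assumes "continuous_on upper_half U"
  shows "set_borel_measurable lebesgue closed_upper_half (\<lambda>q. indicator upper_half q *\<^sub>R U q)"
proof -
  have "(\<lambda>q. indicator upper_half q *\<^sub>R U q) \<in> borel_measurable borel"
    by (intro borel_measurable_continuous_on_indicator borel_open open_upper_half assms)
  then have "(\<lambda>q. indicator upper_half q *\<^sub>R U q) \<in> borel_measurable lebesgue"
    using measurable_completion[of _ lborel] by simp
  also have "(\<lambda>q. indicator upper_half q *\<^sub>R U q)
      = (\<lambda>q. indicator closed_upper_half q *\<^sub>R indicator upper_half q *\<^sub>R U q)"
    by (auto simp: indicator_def upper_half_def closed_upper_half_def fun_eq_iff)
  finally show ?thesis by (simp add: set_borel_measurable_def)
qed

text \<open>The \<open>h i\<close> approach \<open>U\<close> only in the mean, so their homogeneity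
  is transferred by an integral: \<open>U (l q)\<close> and \<open>U q\<close> are both close to the
  common value of \<open>h i\<close> at \<open>l q\<close> and \<open>q\<close>. Continuity of
  \<open>U\<close> turns the vanishing integral into a pointwise identity. Taking
  \<open>l < 1\<close> keeps \<open>l q\<close> in the half ball.\<close>

lemma limit_homogeneous:
  fixes F :: "nat \<Rightarrow> (real^'n) \<times> real \<Rightarrow> real^'d"
  assumes F: "\<And>i. half_regular M (F i)" and U: "\<And>p. p \<in> upper_half \<Longrightarrow> (\<lambda>i. F i p) \<longlonglongrightarrow> U p"
    and h: "\<And>i. boundary_symmetric 0 (h i)"
    and Fh: "(\<lambda>i. \<integral>\<^sup>+q\<in>half_ball 0 8. ennreal ((norm (F i q - h i q))\<^sup>2) \<partial>lborel) \<longlonglongrightarrow> 0"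
    and l: "0 < l" "l < 1" and p: "p \<in> half_ball 0 8"
  shows "U (l *\<^sub>R p) = U p"
proof -
  let ?B = "half_ball (0::real^'n) 8"
  let ?n = "DIM((real^'n) \<times> real)"
  have cU: "continuous_on upper_half U" using F U by (rule limit_continuous_on)
  have hm: "set_borel_measurable lebesgue closed_upper_half (h i)" for i
    using h[of i] by (simp add: boundary_symmetric_def)
  have hl: "h i (l *\<^sub>R q) = h i q" if "q \<in> ?B" for i q
  proof -
    have "q \<in> closed_upper_half" using that by (simp add: half_ball_def upper_half_def closed_upper_half_def)
    then show ?thesis using h[of i] l unfolding boundary_symmetric_def by blast
  qed
  have Bl: "l *\<^sub>R q \<in> ?B" if "q \<in> ?B" for q
  proof -
    have "norm (l *\<^sub>R q) \<le> norm q" using l mult_left_le_one_le[of "norm q" l] by simp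
    then show ?thesis using that l
      by (auto simp: half_ball_def upper_half_def dist_norm zero_prod_def[symmetric])
  qed
  define g where "g i q = ennreal ((norm (U q - h i q))\<^sup>2) * indicator ?B q" for i q
  define d where "d i = (\<integral>\<^sup>+q. g i q \<partial>lborel)" for i
  have gm: "g i \<in> borel_measurable lebesgue" for i
    unfolding g_def by (intro sq_dist_measurable cU hm)
  \<comment> \<open>\<open>U\<close> is unconstrained off the upper half space; the version cut off
    there is measurable and agrees with it on the half ball.\<close>
  have UFm: "(\<lambda>q. ennreal ((norm (F i q - U q))\<^sup>2) * indicator ?B q) \<in> borel_measurable lebesgue" for i
  proof -
    note set_borel_measurable_upper_half[OF cU]
    from sq_dist_measurable[OF half_regular_continuous_on[OF F[of i]] this, of 0 8]
    show ?thesis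
      by (rule measurable_cong[THEN iffD1, rotated])
        (use half_ball_subset_upper_half in \<open>auto simp: indicator_def\<close>)
  qed
  have "d i \<le> 2 * (\<integral>\<^sup>+q\<in>?B. ennreal ((norm (F i q - U q))\<^sup>2) \<partial>lborel)
      + 2 * (\<integral>\<^sup>+q\<in>?B. ennreal ((norm (F i q - h i q))\<^sup>2) \<partial>lborel)" for i
    unfolding d_def
  proof (rule nn_integral_le_double_sum)
    show "g i q \<le> 2 * (ennreal ((norm (F i q - U q))\<^sup>2) * indicator ?B q)
        + 2 * (ennreal ((norm (F i q - h i q))\<^sup>2) * indicator ?B q)" for q
      using norm_diff_sq_le[of "U q" "h i q" "F i q"] by (auto simp: g_def indicator_def)
  qed (intro UFm sq_dist_measurable half_regular_continuous_on[OF F] hm)+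
  moreover have "(\<lambda>i. 2 * (\<integral>\<^sup>+q\<in>?B. ennreal ((norm (F i q - U q))\<^sup>2) \<partial>lborel)
      + 2 * (\<integral>\<^sup>+q\<in>?B. ennreal ((norm (F i q - h i q))\<^sup>2) \<partial>lborel)) \<longlonglongrightarrow> 2 * 0 + 2 * 0"
    by (intro tendsto_add ennreal_tendsto_cmult limit_L2[OF F U] Fh) auto
  ultimately have "d \<longlonglongrightarrow> 0"
    by (intro tendsto_sandwich[OF _ _ tendsto_const, of 0 d]) (auto intro!: always_eventually)
  define X where "X = (\<integral>\<^sup>+q\<in>?B. ennreal ((norm (U (l *\<^sub>R q) - U q))\<^sup>2) \<partial>lborel)"
  \<comment> \<open>The factor \<open>l ^ ?n\<close> is the Jacobian of
    \<open>q \<mapsto> l q\<close>, so that the term at \<open>l q\<close> is also measured by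
    \<open>d i\<close>. The left side does not depend on \<open>i\<close>, the right side tends to
    0.\<close>
  have X: "ennreal (l ^ ?n) * X \<le> 4 * d i" for i
  proof -
    have gl: "(\<lambda>q. g i (l *\<^sub>R q)) \<in> borel_measurable lebesgue"
      by (rule measurable_compose[OF lebesgue_measurable_scaling gm])
    have "X \<le> 2 * (\<integral>\<^sup>+q. g i (l *\<^sub>R q) \<partial>lborel) + 2 * d i"
      unfolding X_def d_def
    proof (rule nn_integral_le_double_sum[OF gl gm])
      show "ennreal ((norm (U (l *\<^sub>R q) - U q))\<^sup>2) * indicator ?B q \<le> 2 * g i (l *\<^sub>R q) + 2 * g i q" for q
        using norm_diff_sq_le[of "U (l *\<^sub>R q)" "U q" "h i q"] hl[of q i] Bl[of q]
        by (auto simp: g_def indicator_def norm_minus_commute)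
    qed
    then have "ennreal (l ^ ?n) * X \<le> ennreal (l ^ ?n) * (2 * (\<integral>\<^sup>+q. g i (l *\<^sub>R q) \<partial>lborel) + 2 * d i)"
      by (rule mult_left_mono) simp
    also have "\<dots> = 2 * (ennreal (l ^ ?n) * (\<integral>\<^sup>+q. g i (l *\<^sub>R q) \<partial>lborel)) + ennreal (l ^ ?n) * (2 * d i)"
      by (simp add: distrib_left mult_ac)
    also have "ennreal (l ^ ?n) * (\<integral>\<^sup>+q. g i (l *\<^sub>R q) \<partial>lborel) = d i"
      using nn_integral_lborel_affine[OF gm[of i], of l 0] l by (simp add: d_def)
    also have "2 * d i + ennreal (l ^ ?n) * (2 * d i) \<le> 2 * d i + 1 * (2 * d i)"
    proof (intro add_left_mono mult_right_mono)
      show "ennreal (l ^ ?n) \<le> 1" unfolding ennreal_le_1 by (intro power_le_one) (use l in auto)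
    qed simp
    finally show ?thesis by (simp flip: distrib_right)
  qed
  have "(\<lambda>i. 4 * d i) \<longlonglongrightarrow> 4 * 0"
    by (intro ennreal_tendsto_cmult \<open>d \<longlonglongrightarrow> 0\<close>) auto
  then have "ennreal (l ^ ?n) * X \<le> 4 * 0"
    by (rule LIMSEQ_le_const) (use X in auto)
  then have "ennreal (l ^ ?n) = 0 \<or> X = 0" by (simp only: mult_zero_right le_zero_eq mult_eq_0_iff)
  moreover have "ennreal (l ^ ?n) \<noteq> 0" using zero_less_power[OF l(1), of ?n] by (simp only: ennreal_eq_0_iff not_le)
  ultimately have "X = 0" by blast
  moreover have "continuous_on ?B (\<lambda>q. U (l *\<^sub>R q) - U q)"
    by (intro continuous_on_diff continuous_on_subset[OF cU half_ball_subset_upper_half]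
        continuous_on_compose2[OF cU, of _ "\<lambda>q. l *\<^sub>R q"] continuous_intros)
      (use Bl half_ball_subset_upper_half in blast)
  ultimately have "U (l *\<^sub>R p) - U p = 0"
    by (intro nn_integral_sq_eq_0_imp[OF open_half_ball _ _ p, of "\<lambda>q. U (l *\<^sub>R q) - U q"]) (auto simp: X_def)
  then show ?thesis by simp
qed

text \<open>Upgrades mean smallness to pointwise smallness: by the uniform Lipschitz bound for
  derivatives, a value of size \<open>e\<close> at \<open>p\<close> persists at size
  \<open>e / 2\<close> on a ball independent of \<open>i\<close> and would keep the integrals
  bounded below.\<close>

lemma derivative_tendsto_zero:
  fixes F :: "nat \<Rightarrow> (real^'n) \<times> real \<Rightarrow> real^'d" and w :: "nat \<Rightarrow> (real^'n) \<times> real"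
  assumes F: "\<And>i. half_regular M (F i)" and S: "open S" "p \<in> S" "p \<in> upper_half"
    and w: "\<And>i. norm (w i) = 1"
    and c: "\<And>i. (\<integral>\<^sup>+q\<in>S. ennreal ((norm (frechet_derivative (F i) (at q) (w i)))\<^sup>2) \<partial>lborel) \<le> ennreal (c i)"
    and c0: "c \<longlonglongrightarrow> 0"
  shows "(\<lambda>i. frechet_derivative (F i) (at p) (w i)) \<longlonglongrightarrow> 0"
proof (rule tendstoI)
  fix e :: real assume e: "e > 0"
  have M: "M \<ge> 0" using F by (rule half_regular_nonneg)
  have z: "snd p > 0" using S by (simp add: upper_half_def)
  obtain d where d: "d > 0" "ball p d \<subseteq> S" using S by (meson openE)
  \<comment> \<open>The three entries keep the ball inside \<open>S\<close>, keep it in the range of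
    the derivative estimate, and limit the oscillation of the derivative to
    \<open>e / 2\<close>.\<close>
  define \<rho> where "\<rho> = Min {d, snd p / 2, e / 2 * (snd p)\<^sup>2 / (M + 1)}"
  have \<rho>: "\<rho> > 0" "\<rho> \<le> d" "\<rho> \<le> snd p / 2" "\<rho> \<le> e / 2 * (snd p)\<^sup>2 / (M + 1)"
  proof -
    show "\<rho> > 0" using d z e M by (simp add: \<rho>_def)
  qed (unfold \<rho>_def, (rule Min.coboundedI; simp)+)
  have \<rho>S: "ball p \<rho> \<subseteq> S" using \<rho>(2) d(2) by auto
  have "(M + 1) * \<rho> \<le> e / 2 * (snd p)\<^sup>2" using \<rho>(4) M by (simp add: field_simps)
  then have M\<rho>: "M * \<rho> / (snd p)\<^sup>2 \<le> e / 2"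
    using \<rho>(1) z by (simp add: pos_divide_le_eq distrib_right)
  let ?V = "(e / 2)\<^sup>2 * measure lborel (ball p \<rho>)"
  have V: "?V > 0" using e content_ball_pos[OF \<rho>(1), of p] by simp
  have "eventually (\<lambda>i. \<bar>c i\<bar> < ?V) sequentially"
    using tendstoD[OF c0 V] by simp
  then show "eventually (\<lambda>i. dist (frechet_derivative (F i) (at p) (w i)) 0 < e) sequentially"
  proof eventually_elim
    case (elim i)
    show ?case
    proof (rule ccontr)
      assume "\<not> ?thesis"
      then have ge: "norm (frechet_derivative (F i) (at p) (w i)) \<ge> e" by simp
      have "norm (frechet_derivative (F i) (at q) (w i)) \<ge> e / 2" if q: "q \<in> ball p \<rho>" for q
      proof -
        have qp: "norm (q - p) \<le> \<rho>" using q by (simp add: dist_norm norm_minus_commute)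
        have "norm (frechet_derivative (F i) (at q) (w i) - frechet_derivative (F i) (at p) (w i))
            \<le> M * norm (q - p) * norm (w i) / (snd p)\<^sup>2"
          by (rule half_regularD(5)[OF F S(3)]) (use qp \<rho>(3) in linarith)
        also have "\<dots> \<le> M * \<rho> / (snd p)\<^sup>2"
          using M qp w by (simp add: divide_right_mono mult_left_mono)
        also have "\<dots> \<le> e / 2" by (rule M\<rho>)
        finally show ?thesis
          using ge norm_triangle_ineq2[of "frechet_derivative (F i) (at p) (w i)" "frechet_derivative (F i) (at q) (w i)"]
          by (simp add: norm_minus_commute)
      qed
      from ball_le_nn_integral_sq[OF \<rho>S, of "e / 2" "\<lambda>q. frechet_derivative (F i) (at q) (w i)", OF this] e
      have "ennreal ?V \<le> ennreal (c i)" using c[of i] by (meson half_gt_zero less_imp_le order_trans)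
      then have "?V \<le> c i \<or> ?V \<le> 0" using V by (metis ennreal_le_iff2 not_less)
      then show False using V elim by linarith
    qed
  qed
qed

text \<open>The Taylor bound of each member survives the limit once its linear term has disappeared.
  What remains says that \<open>U\<close> has zero derivative at \<open>p\<close> along
  \<open>v\<close>, with no differentiability of \<open>U\<close> assumed.\<close>

lemma limit_directional:
  fixes F :: "nat \<Rightarrow> (real^'n) \<times> real \<Rightarrow> real^'d" and w :: "nat \<Rightarrow> real^'n"
  assumes F: "\<And>i. half_regular M (F i)" and U: "\<And>p. p \<in> upper_half \<Longrightarrow> (\<lambda>i. F i p) \<longlonglongrightarrow> U p"
    and p: "p \<in> upper_half" and w: "\<And>i. norm (w i) = 1" "w \<longlonglongrightarrow> v"
    and D: "(\<lambda>i. frechet_derivative (F i) (at p) (w i, 0)) \<longlonglongrightarrow> 0" and s: "\<bar>s\<bar> \<le> snd p / 2"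
  shows "norm (U (p + s *\<^sub>R (v, 0)) - U p) \<le> M * s\<^sup>2 / (snd p)\<^sup>2"
proof -
  let ?q = "p + s *\<^sub>R (v, 0)" and ?q' = "\<lambda>i. p + s *\<^sub>R (w i, 0)"
  have M: "M \<ge> 0" using F by (rule half_regular_nonneg)
  have z: "snd p > 0" using p by (simp add: upper_half_def)
  have q: "?q \<in> upper_half" "snd ?q = snd p" using p by (auto simp: upper_half_def)
  have diff: "norm (?q' i - ?q) = \<bar>s\<bar> * norm (w i - v)" for i
    by (simp add: scaleR_diff_right[symmetric] flip: scaleR_Pair)
  have t0: "(\<lambda>i. \<bar>s\<bar> * norm (w i - v)) \<longlonglongrightarrow> 0"
    using tendsto_mult_right_zero[OF tendsto_norm_zero[OF LIM_zero[OF w(2)]], of "\<bar>s\<bar>"] .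
  \<comment> \<open>The directions \<open>w i\<close> vary with \<open>i\<close>. Moving the
    endpoint from \<open>?q' i\<close> to \<open>?q\<close> costs a Lipschitz error, which is
    uniform because horizontal moves keep the height.\<close>
  have "(\<lambda>i. F i (?q' i) - F i ?q) \<longlonglongrightarrow> 0"
  proof (rule Lim_null_comparison)
    have "eventually (\<lambda>i. \<bar>s\<bar> * norm (w i - v) < snd p / 2) sequentially"
      using order_tendstoD(2)[OF t0, of "snd p / 2"] z by simp
    then show "eventually (\<lambda>i. norm (F i (?q' i) - F i ?q) \<le> 2 * M * (\<bar>s\<bar> * norm (w i - v)) / snd p) sequentially"
    proof eventually_elim
      case (elim i)
      have "norm (?q' i - ?q) \<le> snd ?q / 2" unfolding diff q(2) using elim by simp
      from half_regular_lipschitz[OF F[of i] q(1) this]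
      show ?case unfolding diff q(2) .
    qed
    show "(\<lambda>i. 2 * M * (\<bar>s\<bar> * norm (w i - v)) / snd p) \<longlonglongrightarrow> 0"
      using tendsto_mult_right_zero[OF t0, of "2 * M / snd p"] by simp
  qed
  then have "(\<lambda>i. norm ((F i (?q' i) - F i ?q) + F i ?q - F i p)) \<longlonglongrightarrow> norm (0 + U ?q - U p)"
    by (intro tendsto_intros U q p)
  then have lhs: "(\<lambda>i. norm (F i (?q' i) - F i p)) \<longlonglongrightarrow> norm (U ?q - U p)" by simp
  have "(\<lambda>i. M * s\<^sup>2 / (snd p)\<^sup>2 + \<bar>s\<bar> * norm (frechet_derivative (F i) (at p) (w i, 0)))
      \<longlonglongrightarrow> M * s\<^sup>2 / (snd p)\<^sup>2 + \<bar>s\<bar> * norm (0::real^'d)"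
    by (intro tendsto_intros D)
  then have rhs: "(\<lambda>i. M * s\<^sup>2 / (snd p)\<^sup>2 + \<bar>s\<bar> * norm (frechet_derivative (F i) (at p) (w i, 0)))
      \<longlonglongrightarrow> M * s\<^sup>2 / (snd p)\<^sup>2" by simp
  show ?thesis
  proof (rule LIMSEQ_le[OF lhs rhs], intro exI[of _ 0] allI impI)
    fix i
    have nw: "norm (?q' i - p) = \<bar>s\<bar>" using w(1)[of i] by simp
    have "norm (F i (?q' i) - F i p - frechet_derivative (F i) (at p) (?q' i - p)) \<le> M * \<bar>s\<bar>\<^sup>2 / (snd p)\<^sup>2"
      using half_regularD(4)[OF F[of i] p, of "?q' i"] s unfolding nw by simp
    moreover have "frechet_derivative (F i) (at p) (?q' i - p) = s *\<^sub>R frechet_derivative (F i) (at p) (w i, 0)"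
      using linear_scale[OF half_regular_linear[OF F[of i] p], of s "(w i, 0)"] by simp
    ultimately show "norm (F i (?q' i) - F i p)
        \<le> M * s\<^sup>2 / (snd p)\<^sup>2 + \<bar>s\<bar> * norm (frechet_derivative (F i) (at p) (w i, 0))"
      using norm_triangle_ineq[of "F i (?q' i) - F i p - s *\<^sub>R frechet_derivative (F i) (at p) (w i, 0)"
          "s *\<^sub>R frechet_derivative (F i) (at p) (w i, 0)"] by simp
  qed
qed

text \<open>The derivative vanishes everywhere. \<open>C\<close> and \<open>d\<close> may depend on
  \<open>s\<close>, as they will when each point of a line is first dilated by its own
  factor.\<close>

lemma constant_of_quadratic_bound:
  fixes \<phi> :: "real \<Rightarrow> 'a::real_normed_vector"
  assumes q: "\<And>s. \<exists>C. \<exists>d>0. \<forall>t. \<bar>t - s\<bar> < d \<longrightarrow> norm (\<phi> t - \<phi> s) \<le> C * (t - s)\<^sup>2"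
  shows "\<phi> s = \<phi> t"
proof -
  have "(\<phi> has_derivative (\<lambda>_. 0)) (at s)" for s
    unfolding has_derivative_at_alt
  proof (intro conjI allI impI)
    fix e :: real assume e: "e > 0"
    obtain C d where d: "d > 0" and C: "\<And>t. \<bar>t - s\<bar> < d \<Longrightarrow> norm (\<phi> t - \<phi> s) \<le> C * (t - s)\<^sup>2"
      using q[of s] by blast
    define d' where "d' = min d (e / (\<bar>C\<bar> + 1))"
    have "d' > 0" using d e by (simp add: d'_def)
    moreover have "norm (\<phi> t - \<phi> s - 0) \<le> e * norm (t - s)" if t: "norm (t - s) < d'" for t
    proof -
      have "\<bar>t - s\<bar> \<le> e / (\<bar>C\<bar> + 1)" using t by (simp add: d'_def)
      then have "(\<bar>C\<bar> + 1) * \<bar>t - s\<bar> \<le> e" by (simp add: pos_le_divide_eq mult.commute)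
      then have *: "\<bar>C\<bar> * \<bar>t - s\<bar> \<le> e" by (simp add: distrib_right)
      have "norm (\<phi> t - \<phi> s) \<le> C * (t - s)\<^sup>2" using t by (intro C) (simp add: d'_def)
      also have "\<dots> \<le> \<bar>C\<bar> * (t - s)\<^sup>2" by (intro mult_right_mono) auto
      also have "\<dots> = (\<bar>C\<bar> * \<bar>t - s\<bar>) * \<bar>t - s\<bar>"
        by (metis abs_power2 mult.assoc power2_abs power2_eq_square)
      also have "\<dots> \<le> e * \<bar>t - s\<bar>" by (intro mult_right_mono *) auto
      finally show ?thesis by simp
    qed
    ultimately show "\<exists>d>0. \<forall>t. norm (t - s) < d \<longrightarrow> norm (\<phi> t - \<phi> s - 0) \<le> e * norm (t - s)" by blast
  qed simp
  then show ?thesis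
    using has_derivative_zero_unique[of UNIV \<phi> s t] by auto
qed

text \<open>\<open>U\<close> is homogeneous only inside a half ball, so \<open>H\<close> is its
  radial extension from the half sphere of radius 5. That radius lies in the annulus where
  derivatives are controlled and leaves room 3 inside radius 8.\<close>

lemma symmetric_extension:
  fixes U :: "(real^'n) \<times> real \<Rightarrow> real^'d" and v :: "nat \<Rightarrow> real^'n"
  assumes cU: "continuous_on upper_half U"
    and hom: "\<And>p l. p \<in> half_ball 0 8 \<Longrightarrow> 0 < l \<Longrightarrow> l < 1 \<Longrightarrow> U (l *\<^sub>R p) = U p"
    and on: "\<And>i j. i \<le> k \<Longrightarrow> j \<le> k \<Longrightarrow> v i \<bullet> v j = (if i = j then 1 else 0)"
    and dir: "\<And>j p s. j \<le> k \<Longrightarrow> p \<in> upper_half \<Longrightarrow> norm p = 5 \<Longrightarrow> \<bar>s\<bar> \<le> snd p / 2 \<Longrightarrow>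
       norm (U (p + s *\<^sub>R (v j, 0)) - U p) \<le> M * s\<^sup>2 / (snd p)\<^sup>2"
  obtains H where "boundary_symmetric (Suc k) H" "\<And>p. p \<in> half_ball 0 8 \<Longrightarrow> H p = U p"
proof -
  \<comment> \<open>The cutoff makes \<open>H\<close> zero on the flat boundary, where nothing is
    known of \<open>U\<close>. Dilations and horizontal translations preserve that plane, so both
    symmetries hold there as well.\<close>
  define H where "H p = (indicator upper_half p :: real) *\<^sub>R U ((5 / norm p) *\<^sub>R p)" for p
  have ball: "p \<in> half_ball 0 8 \<longleftrightarrow> p \<in> upper_half \<and> norm p < 8" for p :: "(real^'n) \<times> real"
    by (auto simp: half_ball_def dist_norm zero_prod_def[symmetric])
  have scale: "c *\<^sub>R p \<in> upper_half \<longleftrightarrow> p \<in> upper_half" if "c > 0" for c and p :: "(real^'n) \<times> real"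
    using that by (simp add: upper_half_def zero_less_mult_iff)
  have npos: "norm p > 0" if "p \<in> upper_half" for p :: "(real^'n) \<times> real"
    using that by (auto simp: upper_half_def)
  have HU: "H p = U p" if p: "p \<in> half_ball 0 8" for p
  proof -
    have pu: "p \<in> upper_half" "norm p < 8" using p ball by auto
    have n0: "norm p > 0" using npos[OF pu(1)] .
    consider "norm p < 5" | "norm p = 5" | "norm p > 5" by linarith
    then have "U ((5 / norm p) *\<^sub>R p) = U p"
    proof cases
      case 1
      let ?p' = "(5 / norm p) *\<^sub>R p"
      have "?p' \<in> half_ball 0 8" using pu n0 by (simp add: ball scale)
      from hom[OF this, of "norm p / 5"] show ?thesis using 1 n0 by simp
    next
      case 2
      then show ?thesis by simp
    next
      case 3
      then show ?thesis using n0 by (intro hom p) auto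
    qed
    then show ?thesis using pu by (simp add: H_def)
  qed
  have Hhom: "H (c *\<^sub>R p) = H p" if c: "c > 0" for c p
  proof -
    have "(5 / norm (c *\<^sub>R p)) *\<^sub>R (c *\<^sub>R p) = (5 / norm p) *\<^sub>R p" using c by simp
    then show ?thesis using scale[OF c, of p] by (simp only: H_def indicator_def)
  qed
  have Hm: "set_borel_measurable lebesgue closed_upper_half H"
    unfolding H_def
  proof (rule set_borel_measurable_upper_half, rule continuous_on_compose2[OF cU])
    show "continuous_on upper_half (\<lambda>p::(real^'n) \<times> real. (5 / norm p) *\<^sub>R p)"
      using npos by (intro continuous_intros) auto
    show "(\<lambda>p::(real^'n) \<times> real. (5 / norm p) *\<^sub>R p) ` upper_half \<subseteq> upper_half"
    proof (rule image_subsetI)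
      fix p :: "(real^'n) \<times> real" assume "p \<in> upper_half"
      then show "(5 / norm p) *\<^sub>R p \<in> upper_half" using npos[of p] by (subst scale) auto
    qed
  qed
  have inv: "H (p + t *\<^sub>R (v j, 0)) = H p" if j: "j \<le> k" and p: "p \<in> upper_half" for j p t
  proof -
    have nv: "norm (v j) = 1" using on[OF j j] by (simp add: norm_eq_sqrt_inner)
    have "\<exists>C. \<exists>d>0. \<forall>t. \<bar>t - s\<bar> < d \<longrightarrow>
        norm (H (p + t *\<^sub>R (v j, 0)) - H (p + s *\<^sub>R (v j, 0))) \<le> C * (t - s)\<^sup>2" for s
    proof -
      define q where "q = p + s *\<^sub>R (v j, 0)"
      have q: "q \<in> upper_half" using p by (simp add: q_def upper_half_def)
      \<comment> \<open>The increment bound is available only at norm 5, so the point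
        \<open>q\<close> of the line is first dilated there; homogeneity of \<open>H\<close> brings
        the estimate back.\<close>
      define c where "c = 5 / norm q"
      have c: "c > 0" using npos[OF q] by (simp add: c_def)
      have cq: "c *\<^sub>R q \<in> upper_half" "norm (c *\<^sub>R q) = 5" using q c npos[OF q] by (auto simp: scale) (simp add: c_def)
      define z where "z = snd (c *\<^sub>R q)"
      have z: "z > 0" using cq(1) by (simp add: upper_half_def z_def)
      \<comment> \<open>\<open>z / 2\<close> is the range of the increment bound; 3 is
        \<open>8 - 5\<close> and keeps the moved point where \<open>H = U\<close>. Division by
        \<open>c\<close> undoes the dilation.\<close>
      define d where "d = min (z / 2) 3 / c"
      have d: "d > 0" using z c by (simp add: d_def)
      have "norm (H (p + t *\<^sub>R (v j, 0)) - H (p + s *\<^sub>R (v j, 0))) \<le> (M * c\<^sup>2 / z\<^sup>2) * (t - s)\<^sup>2"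
        if t: "\<bar>t - s\<bar> < d" for t
      proof -
        let ?h = "c * (t - s)"
        have "c * \<bar>t - s\<bar> < min (z / 2) 3" using t c by (simp add: d_def pos_less_divide_eq mult.commute)
        then have h: "\<bar>?h\<bar> \<le> z / 2" "\<bar>?h\<bar> < 3" using c by (auto simp: abs_mult)
        have eq: "c *\<^sub>R (p + t *\<^sub>R (v j, 0)) = c *\<^sub>R q + ?h *\<^sub>R (v j, 0)"
          by (simp add: q_def scaleR_add_right scaleR_diff_left right_diff_distrib zero_prod_def)
        have "norm (c *\<^sub>R q + ?h *\<^sub>R (v j, 0)) \<le> 5 + \<bar>?h\<bar>"
          using norm_triangle_ineq[of "c *\<^sub>R q" "?h *\<^sub>R (v j, 0)"] cq(2) nv by simp
        moreover have "c *\<^sub>R q + ?h *\<^sub>R (v j, 0) \<in> upper_half" using cq(1) by (simp add: upper_half_def)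
        ultimately have "H (c *\<^sub>R q + ?h *\<^sub>R (v j, 0)) = U (c *\<^sub>R q + ?h *\<^sub>R (v j, 0))"
          using h by (intro HU) (simp add: ball)
        then have 1: "H (p + t *\<^sub>R (v j, 0)) = U (c *\<^sub>R q + ?h *\<^sub>R (v j, 0))"
          using Hhom[OF c, of "p + t *\<^sub>R (v j, 0)"] eq by simp
        have "c *\<^sub>R q \<in> half_ball 0 8" using cq by (simp add: ball)
        then have 2: "H (p + s *\<^sub>R (v j, 0)) = U (c *\<^sub>R q)"
          using Hhom[OF c, of q] HU by (simp add: q_def)
        have "norm (U (c *\<^sub>R q + ?h *\<^sub>R (v j, 0)) - U (c *\<^sub>R q)) \<le> M * ?h\<^sup>2 / z\<^sup>2"
          by (rule dir[OF j cq h(1)[unfolded z_def], folded z_def])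
        then show ?thesis unfolding 1 2 by (simp add: power_mult_distrib mult_ac)
      qed
      with d show ?thesis by blast
    qed
    from constant_of_quadratic_bound[of "\<lambda>t. H (p + t *\<^sub>R (v j, 0))", OF this, of t 0]
    show ?thesis by (simp add: zero_prod_def[symmetric])
  qed
  \<comment> \<open>The set of all invariant directions is a subspace, so invariance along the frame
    extends to its span.\<close>
  define I where "I = {w::real^'n. \<forall>p\<in>upper_half. \<forall>t. H (p + t *\<^sub>R (w, 0)) = H p}"
  have up: "p + t *\<^sub>R (w, 0) \<in> upper_half" if "p \<in> upper_half" for p t and w :: "real^'n"
    using that by (simp add: upper_half_def)
  have "subspace I"
  proof (rule subspaceI)
    show "0 \<in> I" by (simp add: I_def zero_prod_def[symmetric])
    fix a b assume ab: "a \<in> I" "b \<in> I"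
    have "H (p + t *\<^sub>R (a + b, 0)) = H p" if p: "p \<in> upper_half" for p t
    proof -
      have "p + t *\<^sub>R (a + b, 0) = (p + t *\<^sub>R (a, 0)) + t *\<^sub>R (b, 0)" by (simp add: scaleR_add_right)
      then show ?thesis using ab p up[OF p] by (auto simp only: I_def mem_Collect_eq)
    qed
    then show "a + b \<in> I" by (simp add: I_def)
  next
    fix c :: real and a assume "a \<in> I"
    moreover have "t *\<^sub>R (c *\<^sub>R a, 0::real) = (t * c) *\<^sub>R (a, 0)" for t by simp
    ultimately show "c *\<^sub>R a \<in> I" by (auto simp only: I_def mem_Collect_eq)
  qed
  define L where "L = span (v ` {..k})"
  have "v ` {..k} \<subseteq> I" using inv by (auto simp only: I_def)
  then have LI: "L \<subseteq> I" unfolding L_def using \<open>subspace I\<close> by (rule span_minimal)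
  have "independent (v ` {..k}) \<and> card (v ` {..k}) = card {..k}"
    by (rule orthonormal_family_independent) (use on in auto)
  then have dimL: "dim L = Suc k"
    by (metis L_def card_atMost dim_eq_card_independent dim_span)
  have "H (p + (w, 0)) = H p" if "p \<in> closed_upper_half" "w \<in> L" for p w
  proof (cases "p \<in> upper_half")
    case True
    have "H (p + 1 *\<^sub>R (w, 0)) = H p" using True that LI by (auto simp only: I_def)
    then show ?thesis by (simp only: scaleR_one)
  next
    case False
    then have "p + (w, 0) \<notin> upper_half" by (simp add: upper_half_def)
    with False show ?thesis by (simp add: H_def)
  qed
  then have "boundary_symmetric (Suc k) H"
    unfolding boundary_symmetric_def using Hm Hhom dimL subspace_span L_def by blast
  then show ?thesis using HU that by blast
qed

text \<open>The radii 2 and 7 are those of \<open>W_density\<close>, 1 and 8, shrunk by 1 on each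
  side: moving the centre from \<open>x\<close> to a point of \<open>ball x r\<close> costs less
  than 1 at unit scale.\<close>

definition half_annulus :: "((real^'n) \<times> real) set" where
  "half_annulus = {q \<in> upper_half. 2 < norm q \<and> norm q < 7}"

lemma open_half_annulus: "open (half_annulus :: ((real^'n) \<times> real) set)"
proof -
  have "half_annulus = (upper_half :: ((real^'n) \<times> real) set) \<inter> {q. 2 < norm q} \<inter> {q. norm q < 7}"
    by (auto simp: half_annulus_def)
  moreover have "open ((upper_half :: ((real^'n) \<times> real) set) \<inter> {q. 2 < norm q} \<inter> {q. norm q < 7})"
    by (intro open_Int open_upper_half open_Collect_less continuous_intros)
  ultimately show ?thesis by metis
qed

text \<open>A sequence of counterexamples with \<open>\<delta>\<close> and \<open>c\<close> tending to zero subconverges to a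
  \<open>0\<close>-homogeneous map that is constant along the limit frame, so its members are eventually
  \<open>\<epsilon>\<close>-close to a \<open>(k + 1)\<close>-symmetric map.\<close>

lemma directional_energy_lower_bound:
  fixes M \<epsilon> :: real
  assumes \<epsilon>: "\<epsilon> > 0"
  obtains \<delta> c :: real where "\<delta> > 0" "c > 0"
    and "\<And>(F :: (real^'n) \<times> real \<Rightarrow> real^'d) (v :: nat \<Rightarrow> real^'n) h. half_regular M F \<Longrightarrow>
     boundary_symmetric 0 h \<Longrightarrow> (\<integral>\<^sup>+q\<in>half_ball 0 8. ennreal ((norm (F q - h q))\<^sup>2) \<partial>lborel) \<le> ennreal \<delta> \<Longrightarrow>
     \<nexists>h. boundary_symmetric (Suc k) h \<and>
          (\<integral>\<^sup>+q\<in>half_ball 0 8. ennreal ((norm (F q - h q))\<^sup>2) \<partial>lborel) \<le> ennreal \<epsilon> \<Longrightarrow>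
     \<forall>i\<le>k. \<forall>j\<le>k. v i \<bullet> v j = (if i = j then 1 else 0) \<Longrightarrow>
     ennreal c \<le> (\<Sum>j\<le>k. \<integral>\<^sup>+q\<in>half_annulus. ennreal ((norm (frechet_derivative F (at q) (v j, 0)))\<^sup>2) \<partial>lborel)"
proof (rule ccontr)
  let ?E = "\<lambda>(F :: (real^'n) \<times> real \<Rightarrow> real^'d) h. \<integral>\<^sup>+q\<in>half_ball 0 8. ennreal ((norm (F q - h q))\<^sup>2) \<partial>lborel"
  let ?D = "\<lambda>(F :: (real^'n) \<times> real \<Rightarrow> real^'d) w. \<integral>\<^sup>+q\<in>half_annulus. ennreal ((norm (frechet_derivative F (at q) (w, 0)))\<^sup>2) \<partial>lborel"
  let ?c = "\<lambda>i. 1 / real (Suc i)"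
  assume contra: "\<not> thesis"
  \<comment> \<open>A counterexample at level \<open>i\<close>, with the same number
    \<open>?c i\<close> in the roles of \<open>\<delta>\<close> and \<open>c\<close>. If one level
    had none, that number would prove the claim.\<close>
  define R where "R i F v h \<longleftrightarrow> half_regular M F \<and>
      boundary_symmetric 0 h \<and> ?E F h \<le> ennreal (?c i) \<and>
      (\<forall>h. boundary_symmetric (Suc k) h \<longrightarrow> \<not> ?E F h \<le> ennreal \<epsilon>) \<and>
      (\<forall>a\<le>k. \<forall>b\<le>k. v a \<bullet> v b = (if a = b then 1 else 0)) \<and> (\<Sum>j\<le>k. ?D F (v j)) < ennreal (?c i)"
    for i and F :: "(real^'n) \<times> real \<Rightarrow> real^'d" and v :: "nat \<Rightarrow> real^'n" and h
  have "\<exists>F v h. R i F v h" for i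
  proof (rule ccontr)
    assume no: "\<not> (\<exists>F v h. R i F v h)"
    have "?c i > 0" by simp
    show False
    proof (rule notE[OF contra], rule that[OF \<open>?c i > 0\<close> \<open>?c i > 0\<close>])
      fix F :: "(real^'n) \<times> real \<Rightarrow> real^'d" and v :: "nat \<Rightarrow> real^'n" and h
      assume "half_regular M F" "boundary_symmetric 0 h" "?E F h \<le> ennreal (?c i)"
        "\<nexists>h. boundary_symmetric (Suc k) h \<and> ?E F h \<le> ennreal \<epsilon>"
        "\<forall>a\<le>k. \<forall>b\<le>k. v a \<bullet> v b = (if a = b then 1 else 0)"
      then have "\<not> (\<Sum>j\<le>k. ?D F (v j)) < ennreal (?c i)" using no unfolding R_def by blast
      then show "ennreal (?c i) \<le> (\<Sum>j\<le>k. ?D F (v j))" by (simp only: not_less)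
    qed
  qed
  then obtain F v h where R: "\<And>i. R i (F i) (v i) (h i)" by metis
  note R' = R[unfolded R_def]
  have F: "\<And>i. half_regular M (F i)" by (rule R'[THEN conjunct1])
  have h: "\<And>i. boundary_symmetric 0 (h i)" by (rule R'[THEN conjunct2, THEN conjunct1])
  have Fh: "\<And>i. ?E (F i) (h i) \<le> ennreal (?c i)" by (rule R'[THEN conjunct2, THEN conjunct2, THEN conjunct1])
  have ns: "\<And>i h. boundary_symmetric (Suc k) h \<Longrightarrow> \<not> ?E (F i) h \<le> ennreal \<epsilon>"
    by (rule R'[THEN conjunct2, THEN conjunct2, THEN conjunct2, THEN conjunct1, rule_format])
  have on: "\<And>i a b. a \<le> k \<Longrightarrow> b \<le> k \<Longrightarrow> v i a \<bullet> v i b = (if a = b then 1 else 0)"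
    by (rule R'[THEN conjunct2, THEN conjunct2, THEN conjunct2, THEN conjunct2, THEN conjunct1, rule_format])
  have D: "\<And>i. (\<Sum>j\<le>k. ?D (F i) (v i j)) < ennreal (?c i)"
    by (rule R'[THEN conjunct2, THEN conjunct2, THEN conjunct2, THEN conjunct2, THEN conjunct2])
  obtain s U where s: "strict_mono (s :: nat \<Rightarrow> nat)"
    and U: "\<And>p. p \<in> upper_half \<Longrightarrow> (\<lambda>i. F (s i) p) \<longlonglongrightarrow> U p"
    by (rule half_regular_convergent_subsequence[of M F, OF F]) blast
  have nv: "norm (v i j) = 1" if "j \<le> k" for i j
    using on[OF that that] by (simp add: norm_eq_sqrt_inner)
  \<comment> \<open>A second extraction makes the frames converge; the limit vectors are again
    orthonormal, because inner products are continuous.\<close>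
  obtain t :: "nat \<Rightarrow> nat" where t: "strict_mono t"
    and tl: "\<And>j. j \<in> {..k} \<Longrightarrow> \<exists>l. (\<lambda>i. v (s (t i)) j) \<longlonglongrightarrow> l"
    using function_convergent_subsequence[of "{..k}" "\<lambda>i. v (s i)" 1] nv by auto
  then obtain w where w: "\<And>j. j \<le> k \<Longrightarrow> (\<lambda>i. v (s (t i)) j) \<longlonglongrightarrow> w j" by (metis atMost_iff)
  define \<sigma> where "\<sigma> = s \<circ> t"
  have \<sigma>: "strict_mono \<sigma>" unfolding \<sigma>_def using s t by (rule strict_mono_o)
  have U': "(\<lambda>i. F (\<sigma> i) p) \<longlonglongrightarrow> U p" if "p \<in> upper_half" for p
    using LIMSEQ_subseq_LIMSEQ[OF U[OF that] t] by (simp add: \<sigma>_def o_def)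
  have w': "(\<lambda>i. v (\<sigma> i) j) \<longlonglongrightarrow> w j" if "j \<le> k" for j using w[OF that] by (simp add: \<sigma>_def)
  have c0: "(\<lambda>i. ?c (\<sigma> i)) \<longlonglongrightarrow> 0"
    using LIMSEQ_subseq_LIMSEQ[OF LIMSEQ_inverse_real_of_nat \<sigma>] by (simp add: o_def inverse_eq_divide)
  have "(\<lambda>i. ?E (F (\<sigma> i)) (h (\<sigma> i))) \<longlonglongrightarrow> 0"
  proof (rule tendsto_sandwich[OF _ _ tendsto_const])
    show "(\<lambda>i. ennreal (?c (\<sigma> i))) \<longlonglongrightarrow> 0" using tendsto_ennrealI[OF c0] by simp
  qed (use Fh in auto)
  note hom = limit_homogeneous[where F = "\<lambda>i. F (\<sigma> i)" and h = "\<lambda>i. h (\<sigma> i)", OF F U' h this]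
  have won: "w a \<bullet> w b = (if a = b then 1 else 0)" if "a \<le> k" "b \<le> k" for a b
  proof -
    have "(\<lambda>i. v (\<sigma> i) a \<bullet> v (\<sigma> i) b) \<longlonglongrightarrow> w a \<bullet> w b" by (intro tendsto_inner w' that)
    moreover have "(\<lambda>i. v (\<sigma> i) a \<bullet> v (\<sigma> i) b) = (\<lambda>i. if a = b then 1 else 0)" using on[OF that] by auto
    ultimately show ?thesis using LIMSEQ_unique tendsto_const by metis
  qed
  have dir: "norm (U (p + x *\<^sub>R (w j, 0)) - U p) \<le> M * x\<^sup>2 / (snd p)\<^sup>2"
    if j: "j \<le> k" and p: "p \<in> upper_half" "norm p = 5" and x: "\<bar>x\<bar> \<le> snd p / 2" for j p x
  proof (rule limit_directional[where F = "\<lambda>i. F (\<sigma> i)" and w = "\<lambda>i. v (\<sigma> i) j", OF F U' p(1) nv[OF j] w'[OF j] _ x])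
    show "(\<lambda>i. frechet_derivative (F (\<sigma> i)) (at p) (v (\<sigma> i) j, 0)) \<longlonglongrightarrow> 0"
    proof (rule derivative_tendsto_zero[where F = "\<lambda>i. F (\<sigma> i)" and w = "\<lambda>i. (v (\<sigma> i) j, 0)", OF F open_half_annulus _ p(1) _ _ c0])
      show "p \<in> half_annulus" using p by (simp add: half_annulus_def)
      show "norm (v (\<sigma> i) j, 0::real) = 1" for i using nv[OF j] by simp
      show "?D (F (\<sigma> i)) (v (\<sigma> i) j) \<le> ennreal (?c (\<sigma> i))" for i
      proof -
        have "?D (F (\<sigma> i)) (v (\<sigma> i) j) \<le> (\<Sum>j\<le>k. ?D (F (\<sigma> i)) (v (\<sigma> i) j))"
          using j by (intro member_le_sum) auto
        then show ?thesis using D[of "\<sigma> i"] by simp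
      qed
    qed
  qed
  obtain H where H: "boundary_symmetric (Suc k) H" and HU: "\<And>p. p \<in> half_ball 0 8 \<Longrightarrow> H p = U p"
    by (rule symmetric_extension[OF limit_continuous_on[where F = "\<lambda>i. F (\<sigma> i)", OF F U'] hom won dir], blast+)
  \<comment> \<open>\<open>H\<close> replaces \<open>U\<close> at no cost on the half ball, so the
    members come arbitrarily close to a \<open>(k + 1)\<close>-symmetric map, which each of them was
    chosen to exclude at level \<open>\<epsilon>\<close>.\<close>
  have "?E (F (\<sigma> i)) H = ?E (F (\<sigma> i)) U" for i
    by (intro nn_integral_cong) (auto simp: indicator_def HU)
  then have "(\<lambda>i. ?E (F (\<sigma> i)) H) \<longlonglongrightarrow> 0" using limit_L2[where F = "\<lambda>i. F (\<sigma> i)", OF F U'] by simp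
  then have "eventually (\<lambda>i. ?E (F (\<sigma> i)) H < ennreal \<epsilon>) sequentially"
    by (rule order_tendstoD) (use \<epsilon> in simp)
  then obtain i where "?E (F (\<sigma> i)) H < ennreal \<epsilon>" using eventually_happens'[OF sequentially_bot] by blast
  then show False using ns[OF H, of "\<sigma> i"] by simp
qed

section \<open>Comparison with the density of the boundary measure\<close>

lemma half_regular_derivative_continuous_on:
  fixes F :: "(real^'n) \<times> real \<Rightarrow> real^'d"
  assumes F: "half_regular M F"
  shows "continuous_on upper_half (\<lambda>p. frechet_derivative F (at p) w)"
proof (rule continuous_at_imp_continuous_on, rule ballI)
  fix p :: "(real^'n) \<times> real" assume p: "p \<in> upper_half"
  have z: "snd p > 0" using p by (simp add: upper_half_def)
  let ?D = "\<lambda>p. frechet_derivative F (at p) w"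
  have "((\<lambda>q. ?D q - ?D p) \<longlongrightarrow> 0) (at p)"
  proof (rule Lim_null_comparison)
    have "eventually (\<lambda>q. dist q p < snd p / 2) (at p)"
      using z by (auto simp: eventually_at intro!: exI[of _ "snd p / 2"])
    then show "eventually (\<lambda>q. norm (?D q - ?D p) \<le> M * norm (q - p) * norm w / (snd p)\<^sup>2) (at p)"
      by eventually_elim (rule half_regularD(5)[OF F p], auto simp: dist_norm)
    have "((\<lambda>q. M * norm (q - p) * norm w / (snd p)\<^sup>2) \<longlongrightarrow> M * norm (p - p) * norm w / (snd p)\<^sup>2) (at p)"
      using z by (intro tendsto_intros) auto
    then show "((\<lambda>q. M * norm (q - p) * norm w / (snd p)\<^sup>2) \<longlongrightarrow> 0) (at p)" by simp
  qed
  then show "isCont ?D p" by (simp add: isCont_def LIM_zero_iff)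
qed

text \<open>Joint continuity in the base point and the direction, by expanding the direction in a
  basis. It supplies the product measurability for the exchange of integrals, where the direction
  depends on both variables.\<close>

lemma half_regular_derivative_apply_continuous_on:
  fixes F :: "(real^'n) \<times> real \<Rightarrow> real^'d"
  assumes F: "half_regular M F" and f: "continuous_on S f" "f ` S \<subseteq> upper_half" and w: "continuous_on S w"
  shows "continuous_on S (\<lambda>s. frechet_derivative F (at (f s)) (w s))"
proof -
  have "continuous_on S (\<lambda>s. \<Sum>b\<in>Basis. (w s \<bullet> b) *\<^sub>R frechet_derivative F (at (f s)) b)"
    by (intro continuous_intros w
        continuous_on_compose2[OF half_regular_derivative_continuous_on[OF F] f])
  moreover have "frechet_derivative F (at (f s)) (w s)
      = (\<Sum>b\<in>Basis. (w s \<bullet> b) *\<^sub>R frechet_derivative F (at (f s)) b)" if "s \<in> S" for s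
  proof -
    have lin: "linear (frechet_derivative F (at (f s)))"
      by (rule half_regular_linear[OF F subsetD[OF f(2) imageI[OF that]]])
    have "frechet_derivative F (at (f s)) (w s) = frechet_derivative F (at (f s)) (\<Sum>b\<in>Basis. (w s \<bullet> b) *\<^sub>R b)"
      by (simp only: euclidean_representation)
    also have "\<dots> = (\<Sum>b\<in>Basis. (w s \<bullet> b) *\<^sub>R frechet_derivative F (at (f s)) b)"
      by (simp only: linear_sum[OF lin] linear_scale[OF lin])
    finally show ?thesis .
  qed
  ultimately show ?thesis by (simp cong: continuous_on_cong)
qed

lemma half_annulus_rescale:
  fixes q :: "(real^'n) \<times> real"
  assumes q: "q \<in> half_annulus" and r: "r > 0" and y: "dist x y < r"
  defines "p \<equiv> (x, 0) + r *\<^sub>R q"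
  shows "p \<in> half_ball y (8 * r) - half_ball y r"
proof -
  have n: "norm (r *\<^sub>R q) > 2 * r" "norm (r *\<^sub>R q) < 7 * r" using q r by (auto simp: half_annulus_def)
  have py: "p - (y, 0) = r *\<^sub>R q + (x - y, 0)" by (simp add: p_def)
  have xy: "norm (x - y, 0::real) < r" using y by (simp add: dist_norm)
  have "norm (p - (y, 0)) < 8 * r"
    unfolding py using norm_triangle_ineq[of "r *\<^sub>R q" "(x - y, 0)"] n xy by linarith
  moreover have "norm (p - (y, 0)) \<ge> r"
    unfolding py using norm_diff_ineq[of "r *\<^sub>R q" "(x - y, 0)"] n xy by linarith
  moreover have "p \<in> upper_half"
    using q r by (simp add: p_def half_annulus_def upper_half_def)
  ultimately show ?thesis by (simp add: half_ball_def dist_norm norm_minus_commute)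
qed

text \<open>\<open>r\<^sup>2\<close> comes from the chain rule, and \<open>(8 * r) ^ (n + 1)\<close>
  bounds the weight in \<open>W_density\<close>. Its power of \<open>r\<close> is consumed by the
  Jacobian of the rescaling, which leaves \<open>8 ^ (n + 1)\<close>.\<close>

lemma W_density_ge:
  fixes u :: "real^'n \<Rightarrow> real^'d"
  assumes U: "half_regular M (poisson_ext u)" and r: "r > 0" and y: "dist x y < r"
  defines "F \<equiv> \<lambda>q. poisson_ext u ((x, 0) + r *\<^sub>R q)"
  shows "(\<integral>\<^sup>+q\<in>half_annulus. ennreal ((norm (frechet_derivative F (at q) ((x, 0) + r *\<^sub>R q - (y, 0))))\<^sup>2) \<partial>lborel)
    \<le> ennreal (r\<^sup>2 * 8 ^ (CARD('n) + 1)) * W_density u r y"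
proof -
  let ?n = "CARD('n) + 1" and ?T = "\<lambda>q. (x, 0) + r *\<^sub>R q"
  let ?S = "half_ball y (8 * r) - half_ball y r"
  define D where "D p = frechet_derivative (poisson_ext u) (at p) (p - (y, 0))" for p
  define G where "G p = ennreal ((norm (D p))\<^sup>2 / norm (p - (y, 0)) ^ ?n) * indicator ?S p" for p
  have Su: "?S \<subseteq> upper_half" using half_ball_subset_upper_half by blast
  have Gm: "G \<in> borel_measurable borel"
  proof -
    have "(\<lambda>p. indicator upper_half p *\<^sub>R D p) \<in> borel_measurable borel"
      unfolding D_def
      by (intro borel_measurable_continuous_on_indicator borel_open open_upper_half
          half_regular_derivative_apply_continuous_on[OF U] continuous_intros) auto
    moreover have "(\<lambda>p. norm (p - (y, 0::real)) ^ ?n) \<in> borel_measurable borel"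
      by (intro borel_measurable_continuous_onI continuous_intros)
    ultimately have "(\<lambda>p. ennreal ((norm (indicator upper_half p *\<^sub>R D p))\<^sup>2 / norm (p - (y, 0)) ^ ?n) * indicator ?S p)
        \<in> borel_measurable borel"
      by measurable
    also have "(\<lambda>p. ennreal ((norm (indicator upper_half p *\<^sub>R D p))\<^sup>2 / norm (p - (y, 0)) ^ ?n) * indicator ?S p) = G"
      using Su by (auto simp: G_def indicator_def fun_eq_iff)
    finally show ?thesis .
  qed
  have GT: "(\<lambda>q. G (?T q)) \<in> borel_measurable borel"
    by (intro measurable_compose[OF _ Gm] borel_measurable_continuous_onI continuous_intros)
  have GL: "G \<in> borel_measurable lebesgue"
    using Gm by (intro measurable_completion) simp
  have "DIM((real^'n) \<times> real) = ?n" "r \<noteq> 0" using r by auto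
  then have affine: "(\<integral>\<^sup>+p. G p \<partial>lborel) = ennreal (r ^ ?n) * (\<integral>\<^sup>+q. G (?T q) \<partial>lborel)"
    using nn_integral_lborel_affine[OF GL, of r "(x, 0)"] by (simp only: abs_of_pos[OF r] simp_thms)
  have "(\<integral>\<^sup>+q\<in>half_annulus. ennreal ((norm (frechet_derivative F (at q) (?T q - (y, 0))))\<^sup>2) \<partial>lborel)
      \<le> (\<integral>\<^sup>+q. ennreal (r\<^sup>2 * (8 * r) ^ ?n) * G (?T q) \<partial>lborel)"
  proof (rule nn_integral_mono)
    fix q :: "(real^'n) \<times> real"
    show "ennreal ((norm (frechet_derivative F (at q) (?T q - (y, 0))))\<^sup>2) * indicator half_annulus q
        \<le> ennreal (r\<^sup>2 * (8 * r) ^ ?n) * G (?T q)"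
    proof (cases "q \<in> half_annulus")
      case True
      have qu: "q \<in> upper_half" using True by (simp add: half_annulus_def)
      have S: "?T q \<in> ?S" by (rule half_annulus_rescale[OF True r y])
      let ?N = "norm (?T q - (y, 0))"
      have "dist (y, 0) (?T q) < 8 * r" using S by (simp add: half_ball_def)
      then have N: "?N \<le> 8 * r" by (simp add: dist_norm norm_minus_commute)
      have N0: "?N > 0"
        using snd_le_norm_diff_boundary[of "?T q" y] S Su by (force simp: upper_half_def)
      have "(norm (frechet_derivative F (at q) (?T q - (y, 0))))\<^sup>2 = r\<^sup>2 * (norm (D (?T q)))\<^sup>2"
        unfolding F_def frechet_derivative_rescale(2)[OF U r qu] D_def using r by (simp add: power_mult_distrib)
      also have "\<dots> = r\<^sup>2 * (?N ^ ?n * ((norm (D (?T q)))\<^sup>2 / ?N ^ ?n))" using N0 by simp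
      also have "\<dots> \<le> r\<^sup>2 * ((8 * r) ^ ?n * ((norm (D (?T q)))\<^sup>2 / ?N ^ ?n))"
        by (intro mult_left_mono mult_right_mono power_mono N) auto
      finally have "ennreal ((norm (frechet_derivative F (at q) (?T q - (y, 0))))\<^sup>2)
          \<le> ennreal ((r\<^sup>2 * (8 * r) ^ ?n) * ((norm (D (?T q)))\<^sup>2 / ?N ^ ?n))"
        by (intro ennreal_leI) (simp only: mult.assoc)
      also have "\<dots> = ennreal (r\<^sup>2 * (8 * r) ^ ?n) * ennreal ((norm (D (?T q)))\<^sup>2 / ?N ^ ?n)"
        using r by (intro ennreal_mult) auto
      also have "ennreal ((norm (D (?T q)))\<^sup>2 / ?N ^ ?n) = G (?T q)"
        using S by (simp only: G_def indicator_simps mult_1_right)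
      finally show ?thesis using True by (simp only: indicator_simps mult_1_right)
    qed simp
  qed
  also have "\<dots> = ennreal (r\<^sup>2 * (8 * r) ^ ?n) * (\<integral>\<^sup>+q. G (?T q) \<partial>lborel)"
    by (rule nn_integral_cmult) (use GT in simp)
  also have "ennreal (r\<^sup>2 * (8 * r) ^ ?n) = ennreal (r\<^sup>2 * 8 ^ ?n) * ennreal (r ^ ?n)"
    using r by (subst ennreal_mult[symmetric]) (auto simp: power_mult_distrib mult_ac)
  also have "\<dots> * (\<integral>\<^sup>+q. G (?T q) \<partial>lborel) = ennreal (r\<^sup>2 * 8 ^ ?n) * (\<integral>\<^sup>+p. G p \<partial>lborel)"
    by (simp only: affine mult.assoc)
  also have "(\<integral>\<^sup>+p. G p \<partial>lborel) = W_density u r y"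
    by (simp add: W_density_def G_def D_def)
  finally show ?thesis .
qed

section \<open>From the energy of the frame to the Jones number\<close>

theorem mainTheorem14:
  fixes N :: "(real^'d) set"
  assumes n2: "CARD('n) \<ge> 2"
    and N: "compact N" "smooth_submanifold N"
    and Lam: "\<Lambda> > 0"
    and k: "k < CARD('n)"
    and eps: "\<epsilon> > 0"
  shows "\<exists>C>0. \<exists>\<delta>>0. \<forall>(u::real^'n \<Rightarrow> real^'d) r (x::real^'n).
     u \<in> H_half \<Lambda> (ball 0 10) N \<and> stationary_half_harmonic N (ball 0 10) u \<and>
     0 < r \<and> r \<le> 1 \<and> x \<in> ball 0 1 \<and>
     boundary_eps_symmetric 0 \<delta> (poisson_ext u) x (8 * r) \<and>
     \<not> boundary_eps_symmetric (Suc k) \<epsilon> (poisson_ext u) x (8 * r) \<longrightarrow>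
     (\<forall>\<mu>::(real^'n) measure. sets \<mu> = sets borel \<and> finite_measure \<mu> \<and>
        emeasure \<mu> (- ball x r) = 0 \<longrightarrow>
        jones_beta2 k \<mu> x r \<le> ennreal (C * r powr (- real k)) *
          (\<integral>\<^sup>+ y\<in>ball x r. W_density u r y \<partial>\<mu>))"
proof -
  let ?n = "CARD('n) + 1"
  obtain B where B: "B > 0" "\<And>y. y \<in> N \<Longrightarrow> norm y \<le> B"
    using compact_imp_bounded[OF N(1)] by (auto simp: bounded_pos)
  define M where "M = poisson_const TYPE('n) * B"
  \<comment> \<open>Symmetry is defined by averages, the compactness statement uses plain integrals
    at unit scale; \<open>m\<close> converts between them, hence \<open>\<epsilon> * m\<close> and
    \<open>\<delta>' / m\<close>.\<close>
  define m where "m = measure lborel (half_ball (0::real^'n) 8)"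
  have m: "m > 0" unfolding m_def by (rule measure_half_ball_pos) simp
  have "\<epsilon> * m > 0" using eps m by simp
  show ?thesis
  proof (rule directional_energy_lower_bound[OF \<open>\<epsilon> * m > 0\<close>, where k = k and M = M and 'n = 'n and 'd = 'd])
    fix \<delta>' c :: real
    assume \<delta>': "\<delta>' > 0" and c: "c > 0" and lower:
      "\<And>(F :: (real^'n) \<times> real \<Rightarrow> real^'d) (v :: nat \<Rightarrow> real^'n) h. half_regular M F \<Longrightarrow>
       boundary_symmetric 0 h \<Longrightarrow> (\<integral>\<^sup>+q\<in>half_ball 0 8. ennreal ((norm (F q - h q))\<^sup>2) \<partial>lborel) \<le> ennreal \<delta>' \<Longrightarrow>
       \<nexists>h. boundary_symmetric (Suc k) h \<and>
            (\<integral>\<^sup>+q\<in>half_ball 0 8. ennreal ((norm (F q - h q))\<^sup>2) \<partial>lborel) \<le> ennreal (\<epsilon> * m) \<Longrightarrow>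
       \<forall>i\<le>k. \<forall>j\<le>k. v i \<bullet> v j = (if i = j then 1 else 0) \<Longrightarrow>
       ennreal c \<le> (\<Sum>j\<le>k. \<integral>\<^sup>+q\<in>half_annulus. ennreal ((norm (frechet_derivative F (at q) (v j, 0)))\<^sup>2) \<partial>lborel)"
    \<comment> \<open>\<open>CARD('n)\<close> comes from the trace bound for the Jones number,
      \<open>Suc k\<close> from summing over the frame, \<open>8 ^ ?n\<close> from the weight of
      \<open>W_density\<close>, and \<open>c\<close> from compactness.\<close>
    define C where "C = real CARD('n) * (real (Suc k) * 8 ^ ?n) / c"
    have Cpos: "C > 0" using c k by (simp add: C_def)
    have \<delta>pos: "\<delta>' / m > 0" using \<delta>' m by simp
    show ?thesis
    proof (rule exI[of _ C], rule conjI[OF Cpos], rule exI[of _ "\<delta>' / m"], rule conjI[OF \<delta>pos],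
        intro allI impI, goal_cases)
      case (1 u r x \<mu>)
      then have u: "u \<in> H_half \<Lambda> (ball 0 10) N" and r: "0 < r"
        and sym: "boundary_eps_symmetric 0 (\<delta>' / m) (poisson_ext u) x (8 * r)"
        and nsym: "\<not> boundary_eps_symmetric (Suc k) \<epsilon> (poisson_ext u) x (8 * r)"
        and \<mu>: "sets \<mu> = sets borel" "finite_measure \<mu>" "emeasure \<mu> (- ball x r) = 0"
        by auto
      have U: "half_regular M (poisson_ext u)"
        unfolding M_def
      proof (rule poisson_ext_half_regular)
        show "u \<in> borel_measurable borel" using u by (simp add: H_half_def)
        have "AE y in lborel. u y \<in> N" using u by (simp add: H_half_def)
        then show "AE y in lborel. norm (u y) \<le> B" by eventually_elim (rule B(2))
      qed (use B in simp)
      define F where "F q = poisson_ext u ((x, 0) + r *\<^sub>R q)" for q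
      have F: "half_regular M F" unfolding F_def by (rule half_regular_rescale[OF U r])
      note resc = boundary_eps_symmetric_rescale[OF half_regular_continuous_on[OF U] r, where x = x,
          folded F_def m_def]
      have "\<delta>' / m * m = \<delta>'" using m by simp
      note resc[OF less_imp_le[OF \<delta>pos], THEN iffD1, OF sym, unfolded this]
      then obtain h where h: "boundary_symmetric 0 h"
        "(\<integral>\<^sup>+q\<in>half_ball 0 8. ennreal ((norm (F q - h q))\<^sup>2) \<partial>lborel) \<le> ennreal \<delta>'"
        by blast
      have nh: "\<nexists>h. boundary_symmetric (Suc k) h \<and>
            (\<integral>\<^sup>+q\<in>half_ball 0 8. ennreal ((norm (F q - h q))\<^sup>2) \<partial>lborel) \<le> ennreal (\<epsilon> * m)"
        using nsym unfolding resc[OF less_imp_le[OF eps]] .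
      show ?case
      proof (rule covariance_frame[OF \<mu> r k, where 'd = 'd])
        fix v :: "nat \<Rightarrow> real^'n" and l :: real
        assume l: "l \<ge> 0"
          and on: "\<And>i j. i \<le> k \<Longrightarrow> j \<le> k \<Longrightarrow> v i \<bullet> v j = (if i = j then 1 else 0)"
          and beta: "jones_beta2 k \<mu> x r \<le> ennreal (real CARD('n) * l / r ^ (k + 2))"
          and frame: "\<And>(T :: (real^'n) \<times> real \<Rightarrow> real^'d) p j. linear T \<Longrightarrow> j \<le> k \<Longrightarrow>
             ennreal (l * (norm (T (v j, 0)))\<^sup>2) \<le> (\<integral>\<^sup>+ y\<in>ball x r. ennreal ((norm (T (p - (y, 0))))\<^sup>2) \<partial>\<mu>)"
        interpret \<mu>: finite_measure \<mu> by (rule \<mu>)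
        interpret pair_sigma_finite "lborel :: ((real^'n) \<times> real) measure" \<mu> ..
        let ?A = "half_annulus :: ((real^'n) \<times> real) set"
        have Au: "?A \<subseteq> upper_half" by (auto simp: half_annulus_def)
        have mD: "(\<lambda>q. ennreal ((norm (frechet_derivative F (at q) w))\<^sup>2) * indicator ?A q) \<in> borel_measurable borel" for w
        proof -
          have "(\<lambda>q. indicator ?A q *\<^sub>R frechet_derivative F (at q) w) \<in> borel_measurable borel"
            by (intro borel_measurable_continuous_on_indicator borel_open open_half_annulus
                continuous_on_subset[OF half_regular_derivative_continuous_on[OF F] Au])
          then have "(\<lambda>q. ennreal ((norm (indicator ?A q *\<^sub>R frechet_derivative F (at q) w))\<^sup>2)) \<in> borel_measurable borel"
            by measurable
          also have "(\<lambda>q. ennreal ((norm (indicator ?A q *\<^sub>R frechet_derivative F (at q) w))\<^sup>2))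
              = (\<lambda>q. ennreal ((norm (frechet_derivative F (at q) w))\<^sup>2) * indicator ?A q)"
            by (auto simp: indicator_def fun_eq_iff)
          finally show ?thesis .
        qed
        define \<Phi> where "\<Phi> q y = ennreal ((norm (frechet_derivative F (at q) ((x, 0) + r *\<^sub>R q - (y, 0))))\<^sup>2)
            * indicator ?A q * indicator (ball x r) y" for q y
        have m\<Phi>: "case_prod \<Phi> \<in> borel_measurable (lborel \<Otimes>\<^sub>M \<mu>)"
        proof -
          have "(\<lambda>z. indicator (?A \<times> ball x r) z *\<^sub>R
              frechet_derivative F (at (fst z)) ((x, 0) + r *\<^sub>R fst z - (snd z, 0))) \<in> borel_measurable borel"
            using Au by (intro borel_measurable_continuous_on_indicator borel_open open_Times open_half_annulus open_ball
                half_regular_derivative_apply_continuous_on[OF F] continuous_intros) auto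
          then have "(\<lambda>z. ennreal ((norm (indicator (?A \<times> ball x r) z *\<^sub>R
              frechet_derivative F (at (fst z)) ((x, 0) + r *\<^sub>R fst z - (snd z, 0))))\<^sup>2)) \<in> borel_measurable borel"
            by measurable
          also have "(\<lambda>z. ennreal ((norm (indicator (?A \<times> ball x r) z *\<^sub>R
              frechet_derivative F (at (fst z)) ((x, 0) + r *\<^sub>R fst z - (snd z, 0))))\<^sup>2)) = case_prod \<Phi>"
            by (auto simp: \<Phi>_def indicator_def fun_eq_iff)
          finally have \<Phi>b: "case_prod \<Phi> \<in> borel_measurable borel" .
          have sets_eq: "sets (lborel \<Otimes>\<^sub>M \<mu>) = sets (borel :: (((real^'n) \<times> real) \<times> (real^'n)) measure)"
            using sets_pair_measure_cong[OF sets_lborel \<mu>(1)] by (simp only: borel_prod)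
          show ?thesis by (subst measurable_cong_sets[OF sets_eq refl]) (rule \<Phi>b)
        qed
        let ?W = "\<integral>\<^sup>+ y\<in>ball x r. W_density u r y \<partial>\<mu>"
        have "ennreal (l * c) = ennreal l * ennreal c" using l c by (simp add: ennreal_mult)
        also have "\<dots> \<le> ennreal l * (\<Sum>j\<le>k. \<integral>\<^sup>+q\<in>?A. ennreal ((norm (frechet_derivative F (at q) (v j, 0)))\<^sup>2) \<partial>lborel)"
          by (intro mult_left_mono lower[OF F h nh]) (use on in auto)
        also have "\<dots> = (\<Sum>j\<le>k. \<integral>\<^sup>+q. ennreal l * (ennreal ((norm (frechet_derivative F (at q) (v j, 0)))\<^sup>2) * indicator ?A q) \<partial>lborel)"
          unfolding sum_distrib_left using mD by (intro sum.cong nn_integral_cmult[symmetric]) auto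
        also have "\<dots> \<le> (\<Sum>j\<le>k. \<integral>\<^sup>+q. \<integral>\<^sup>+y. \<Phi> q y \<partial>\<mu> \<partial>lborel)"
        proof (intro sum_mono nn_integral_mono)
          fix j q assume j: "j \<in> {..k}"
          show "ennreal l * (ennreal ((norm (frechet_derivative F (at q) (v j, 0)))\<^sup>2) * indicator ?A q) \<le> (\<integral>\<^sup>+y. \<Phi> q y \<partial>\<mu>)"
          proof (cases "q \<in> ?A")
            case True
            have lin: "linear (frechet_derivative F (at q))" using True Au by (intro half_regular_linear[OF F]) auto
            have "ennreal l * ennreal ((norm (frechet_derivative F (at q) (v j, 0)))\<^sup>2)
                = ennreal (l * (norm (frechet_derivative F (at q) (v j, 0)))\<^sup>2)"
              using l by (simp add: ennreal_mult)
            \<comment> \<open>The frame inequality with the derivative of the rescaled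
              \<open>F\<close> at \<open>q\<close> but with the unscaled point
              \<open>(x, 0) + r q\<close>; the mismatch is the factor \<open>r\<^sup>2\<close> in
              \<open>K\<close>.\<close>
            also have "\<dots> \<le> (\<integral>\<^sup>+ y\<in>ball x r. ennreal ((norm (frechet_derivative F (at q) ((x, 0) + r *\<^sub>R q - (y, 0))))\<^sup>2) \<partial>\<mu>)"
              using frame[OF lin] j by auto
            finally show ?thesis using True by (simp only: \<Phi>_def indicator_simps mult_1_right)
          qed simp
        qed
        also have "\<dots> = of_nat (Suc k) * (\<integral>\<^sup>+q. \<integral>\<^sup>+y. \<Phi> q y \<partial>\<mu> \<partial>lborel)" by simp
        also have "(\<integral>\<^sup>+q. \<integral>\<^sup>+y. \<Phi> q y \<partial>\<mu> \<partial>lborel) = (\<integral>\<^sup>+y. \<integral>\<^sup>+q. \<Phi> q y \<partial>lborel \<partial>\<mu>)"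
          by (rule Fubini'[OF m\<Phi>, symmetric])
        finally have l_bound: "ennreal (l * c) \<le> of_nat (Suc k) * (\<integral>\<^sup>+y. \<integral>\<^sup>+q. \<Phi> q y \<partial>lborel \<partial>\<mu>)" .
        define K where "K = r\<^sup>2 * 8 ^ ?n"
        have K: "K > 0" using r by (simp add: K_def)
        \<comment> \<open>Measurability in \<open>y\<close> is at hand for \<open>\<Psi>\<close>,
          not for the density itself. The constant is therefore put on the side of
          \<open>\<Psi>\<close> as \<open>1 / K\<close>, the density enters by monotonicity alone,
          and \<open>K\<close> is restored after integration.\<close>
        define \<Psi> where "\<Psi> y = (\<integral>\<^sup>+q. \<Phi> q y \<partial>lborel)" for y
        have m\<Psi>: "\<Psi> \<in> borel_measurable \<mu>"
          unfolding \<Psi>_def using measurable_pair_swap[OF m\<Phi>]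
          by (intro lborel.borel_measurable_nn_integral) (simp add: case_prod_beta')
        have \<Psi>W: "ennreal (1 / K) * \<Psi> y \<le> W_density u r y * indicator (ball x r) y" for y
        proof (cases "y \<in> ball x r")
          case True
          have "\<Psi> y = (\<integral>\<^sup>+q\<in>?A. ennreal ((norm (frechet_derivative F (at q) ((x, 0) + r *\<^sub>R q - (y, 0))))\<^sup>2) \<partial>lborel)"
            using True by (simp only: \<Psi>_def \<Phi>_def indicator_simps mult_1_right)
          also have "\<dots> \<le> ennreal K * W_density u r y"
            using W_density_ge[OF U r, of x y] True unfolding K_def F_def by simp
          finally have "ennreal (1 / K) * \<Psi> y \<le> ennreal (1 / K) * (ennreal K * W_density u r y)"
            by (rule mult_left_mono) simp
          also have "\<dots> = W_density u r y"
            using K by (simp add: mult.assoc[symmetric] ennreal_mult[symmetric])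
          finally show ?thesis using True by simp
        next
          case False
          then show ?thesis by (simp add: \<Psi>_def \<Phi>_def)
        qed
        have "ennreal (1 / K) * (\<integral>\<^sup>+y. \<Psi> y \<partial>\<mu>) = (\<integral>\<^sup>+y. ennreal (1 / K) * \<Psi> y \<partial>\<mu>)"
          by (rule nn_integral_cmult[OF m\<Psi>, symmetric])
        also have "\<dots> \<le> ?W" by (intro nn_integral_mono \<Psi>W)
        finally have "ennreal K * (ennreal (1 / K) * (\<integral>\<^sup>+y. \<Psi> y \<partial>\<mu>)) \<le> ennreal K * ?W"
          by (rule mult_left_mono[OF _ zero_le])
        moreover have "ennreal K * ennreal (1 / K) = 1"
          using K by (subst ennreal_mult[symmetric]) auto
        ultimately have "(\<integral>\<^sup>+y. \<Psi> y \<partial>\<mu>) \<le> ennreal K * ?W"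
          by (simp only: mult.assoc[symmetric] mult_1_left)
        then have "of_nat (Suc k) * (\<integral>\<^sup>+y. \<Psi> y \<partial>\<mu>) \<le> of_nat (Suc k) * (ennreal K * ?W)"
          by (rule mult_left_mono[OF _ zero_le])
        with l_bound have lc: "ennreal (l * c) \<le> of_nat (Suc k) * (ennreal K * ?W)"
          unfolding \<Psi>_def by (rule order_trans)
        \<comment> \<open>Chosen so that the bound for the Jones number is \<open>?a\<close> times
          \<open>l * c\<close>. The \<open>r\<^sup>2\<close> in \<open>K\<close> then reduces
          \<open>r ^ (k + 2)\<close> to the required power \<open>r ^ k\<close>.\<close>
        let ?a = "real CARD('n) / (c * r ^ (k + 2))"
        have a: "?a \<ge> 0" using c r by simp
        note beta
        also have "ennreal (real CARD('n) * l / r ^ (k + 2)) = ennreal ?a * ennreal (l * c)"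
          using c r l by (subst ennreal_mult[symmetric]) auto
        also have "\<dots> \<le> ennreal ?a * (of_nat (Suc k) * (ennreal K * ?W))"
          by (rule mult_left_mono[OF lc zero_le])
        also have "\<dots> = (ennreal ?a * (ennreal (real (Suc k)) * ennreal K)) * ?W"
          by (simp only: mult.assoc ennreal_of_nat_eq_real_of_nat)
        also have "ennreal ?a * (ennreal (real (Suc k)) * ennreal K) = ennreal (?a * (real (Suc k) * K))"
          using a K by (simp only: ennreal_mult mult_nonneg_nonneg of_nat_0_le_iff less_imp_le)
        also have "?a * (real (Suc k) * K) = C * r powr (- real k)"
        proof -
          have "r powr (- real k) = 1 / r ^ k" using r by (simp add: powr_minus_divide powr_realpow)
          moreover have "b \<noteq> 0 \<Longrightarrow> n / (c * (a * b)) * (s * (b * e)) = n * (s * e) / c * (1 / a)" for n a b s e :: real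
            by simp
          ultimately show ?thesis using r by (simp only: C_def K_def power_add[of r k 2]) simp
        qed
        finally show "jones_beta2 k \<mu> x r \<le> ennreal (C * r powr (- real k)) * ?W" .
      qed
    qed
  qed
qed

end
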